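(* Let $\rho:[1,\infty)\to(0,1]$ be a decreasing bijection. Then for any $\delta\in(0,\tfrac12]$ and $p\in\mathbb N$ there exists a probability measure $\mathcal D_\delta$ on the functions in $\mathcal F^{p,\mathrm{ncvx}}_\infty$ such that for any $\mathrm A\in\mathcal A_{\mathrm{rand}}^{(p)}$, $$\mathbb P_{\mathrm A,\,F\sim\mathcal D_\delta}\left(\limsup_{n\to\infty}\frac{n^{\frac p{p+1}}\,\|\nabla F(\mathrm A[F]_n)\|}{\rho(n)}\ge1\right)\ge1-2\delta .$$
   Context: $\mathbb N=\{1,2,\dots\}$. $\mathcal H_\infty$ is an infinite-dimensional real Hilbert space (i.e. $\ell^2$). $f^\star:=\inf f$. Function class: $\mathcal F^{p,\mathrm{ncvx}}_\infty$ is the set of $f:\mathcal H_\infty\to\mathbb R$ that are $p$ times continuously (Fréchet) differentiable with $\|\nabla^pf(x)-\nabla^pf(y)\|\le\|x-y\|$ for all $x,y$ (operator norm on symmetric $p$-linear forms), with $-1\le f^\star\le f(\mathbf 0)\le1$ and $\|\nabla^rf(\mathbf 0)\|\le1$ for all $r\in\{1,\dots,p\}$. Randomized algorithms: $\nabla^{(0,\dots,p)}f(x)$ denotes the function value and all derivatives through order $p$ at $x$. $\mathrm A\in\mathcal A_{\mathrm{rand}}^{(p)}$ if it produces iterates $x^{(t)}=\mathrm A^{(t)}\big(\xi,\nabla^{(0,\dots,p)}f(x^{(1)}),\dots,\nabla^{(0,\dots,p)}f(x^{(t-1)})\big)$, $t\in\mathbb N$, with $\mathrm A^{(t)}$ measurable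 maps into $\mathcal H_\infty$ and $\xi\sim\mathsf{Unif}[0,1]$ drawn independently of $f$. $\mathrm A[f]_n:=x^{(n+1)}$ is the output after $n$ oracle calls (dependence on $\xi$ implicit). The probability is over the seed $\xi$ and the independent draw of $F$. *)

theory Defs
  imports "HOL-Probability.Probability"
begin

section \<open>Bounded multilinear forms\<close>

text \<open>
  A real \<open>r\<close>-linear form on \<open>'a\<close> is a function on lists of length \<open>r\<close>, extended by \<open>0\<close> to all
  other lists, so that two forms are equal as soon as they agree on lists of length \<open>r\<close>.
\<close>

definition forms :: "nat \<Rightarrow> ('a::real_normed_vector list \<Rightarrow> real) set" where
  "forms r = {T. (\<forall>vs. length vs \<noteq> r \<longrightarrow> T vs = 0) \<and>
                 (\<forall>vs i. length vs = r \<and> i < r \<longrightarrow> linear (\<lambda>v. T (vs[i := v]))) \<and>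
                 (\<exists>C. \<forall>vs. length vs = r \<longrightarrow> \<bar>T vs\<bar> \<le> C * prod_list (map norm vs))}"

definition form_norm :: "nat \<Rightarrow> ('a::real_normed_vector list \<Rightarrow> real) \<Rightarrow> real" where
  "form_norm r T = (SUP vs \<in> {vs. length vs = r \<and> (\<forall>v \<in> set vs. norm v \<le> 1)}. \<bar>T vs\<bar>)"

text \<open>
  The outer absolute value is redundant on \<^term>\<open>forms r\<close>; it is there because
  \<^locale>\<open>Metric_space\<close> asks for nonnegativity on the whole type.
\<close>

definition form_dist ::
    "nat \<Rightarrow> ('a::real_normed_vector list \<Rightarrow> real) \<Rightarrow> ('a list \<Rightarrow> real) \<Rightarrow> real" where
  "form_dist r S T = \<bar>form_norm r (\<lambda>vs. S vs - T vs)\<bar>"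

definition form_topology :: "nat \<Rightarrow> ('a::real_normed_vector list \<Rightarrow> real) topology" where
  "form_topology r = Metric_space.mtopology (forms r) (form_dist r)"

lemma form_bdd_above:
  assumes "S \<in> forms r" "T \<in> forms r"
  shows "bdd_above ((\<lambda>vs. \<bar>S vs - T vs\<bar>) ` {vs. length vs = r \<and> (\<forall>v \<in> set vs. norm v \<le> 1)})"
proof -
  have bound: "\<exists>B. \<forall>vs. length vs = r \<and> (\<forall>v \<in> set vs. norm v \<le> 1) \<longrightarrow> \<bar>U vs\<bar> \<le> B"
    if U: "U \<in> forms r" for U :: "'a list \<Rightarrow> real"
  proof -
    obtain C where C: "\<And>vs. length vs = r \<Longrightarrow> \<bar>U vs\<bar> \<le> C * prod_list (map norm vs)"
      using U unfolding forms_def by blast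
    have prod: "0 \<le> prod_list (map norm vs) \<and> prod_list (map norm vs) \<le> 1"
      if "\<forall>v \<in> set vs. norm v \<le> 1" for vs :: "'a list"
      using that by (induction vs) (auto intro: mult_le_one)
    have "\<bar>U vs\<bar> \<le> \<bar>C\<bar>" if vs: "length vs = r" "\<forall>v \<in> set vs. norm v \<le> 1" for vs
    proof -
      have "C * prod_list (map norm vs) \<le> \<bar>C\<bar> * prod_list (map norm vs)"
        using prod[OF vs(2)] by (intro mult_right_mono) auto
      also have "\<dots> \<le> \<bar>C\<bar> * 1"
        using prod[OF vs(2)] by (intro mult_left_mono) auto
      finally show ?thesis using C[OF vs(1)] by simp
    qed
    then show ?thesis by blast
  qed
  obtain B1 where B1: "\<And>vs. length vs = r \<and> (\<forall>v \<in> set vs. norm v \<le> 1) \<Longrightarrow> \<bar>S vs\<bar> \<le> B1"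
    using bound[OF assms(1)] by blast
  obtain B2 where B2: "\<And>vs. length vs = r \<and> (\<forall>v \<in> set vs. norm v \<le> 1) \<Longrightarrow> \<bar>T vs\<bar> \<le> B2"
    using bound[OF assms(2)] by blast
  show ?thesis
  proof (rule bdd_aboveI2)
    fix vs :: "'a list" assume "vs \<in> {vs. length vs = r \<and> (\<forall>v \<in> set vs. norm v \<le> 1)}"
    then show "\<bar>S vs - T vs\<bar> \<le> B1 + B2"
      using B1[of vs] B2[of vs] by fastforce
  qed
qed

lemma form_dist_upper:
  assumes "S \<in> forms r" "T \<in> forms r" "length vs = r" "\<forall>v \<in> set vs. norm v \<le> 1"
  shows "\<bar>S vs - T vs\<bar> \<le> form_dist r S T"
proof -
  have "\<bar>S vs - T vs\<bar> \<le> form_norm r (\<lambda>vs. S vs - T vs)"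
    unfolding form_norm_def
    using assms(3,4) by (intro cSUP_upper form_bdd_above assms(1,2)) auto
  then show ?thesis by (simp add: form_dist_def)
qed

lemma form_dist_least:
  fixes S T :: "'a::real_normed_vector list \<Rightarrow> real"
  assumes "S \<in> forms r" "T \<in> forms r"
    and "\<And>vs. length vs = r \<Longrightarrow> \<forall>v \<in> set vs. norm v \<le> 1 \<Longrightarrow> \<bar>S vs - T vs\<bar> \<le> B"
  shows "form_dist r S T \<le> B"
proof -
  have zero: "replicate r 0 \<in> {vs :: 'a list. length vs = r \<and> (\<forall>v \<in> set vs. norm v \<le> 1)}" by auto
  then have "form_norm r (\<lambda>vs. S vs - T vs) \<le> B"
    unfolding form_norm_def using assms(3) by (intro cSUP_least) blast+
  moreover have "\<bar>S (replicate r 0) - T (replicate r 0)\<bar> \<le> form_norm r (\<lambda>vs. S vs - T vs)"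
    unfolding form_norm_def by (intro cSUP_upper form_bdd_above assms(1,2) zero)
  ultimately show ?thesis by (simp add: form_dist_def)
qed

lemma form_scale:
  assumes "T \<in> forms r" "length vs = r" "k \<le> r"
  shows "T (map (\<lambda>v. c *\<^sub>R v) (take k vs) @ drop k vs) = c ^ k * T vs"
  using assms(3)
proof (induction k)
  case 0
  then show ?case by simp
next
  case (Suc k)
  define ws where "ws = map (\<lambda>v. c *\<^sub>R v) (take k vs) @ drop k vs"
  have len: "length ws = r" using assms(2) Suc.prems by (simp add: ws_def)
  have k: "k < r" using Suc.prems by simp
  have wk: "ws ! k = vs ! k" using k assms(2) by (simp add: ws_def nth_append)
  have eq: "map (\<lambda>v. c *\<^sub>R v) (take (Suc k) vs) @ drop (Suc k) vs = ws[k := c *\<^sub>R vs ! k]"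
    using k assms(2)
    by (intro nth_equalityI) (auto simp: ws_def nth_append nth_list_update less_Suc_eq)
  have "linear (\<lambda>v. T (ws[k := v]))" using assms(1) len k unfolding forms_def by blast
  then have "T (ws[k := c *\<^sub>R vs ! k]) = c * T (ws[k := vs ! k])"
    by (auto dest: linear_cmul[of _ c "vs ! k"])
  also have "ws[k := vs ! k] = ws" using wk by (metis list_update_id)
  finally show ?case using Suc.IH k eq by (simp add: ws_def)
qed

lemma Metric_space_forms:
  "Metric_space (forms r :: ('a::real_normed_vector list \<Rightarrow> real) set) (form_dist r)"
proof
  fix S T U :: "'a list \<Rightarrow> real"
  show "0 \<le> form_dist r S T" by (simp add: form_dist_def)
  show "form_dist r S T = form_dist r T S"
    by (simp add: form_dist_def form_norm_def abs_minus_commute)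
  show "form_dist r S U \<le> form_dist r S T + form_dist r T U"
    if "S \<in> forms r" "T \<in> forms r" "U \<in> forms r"
  proof (rule form_dist_least[OF that(1,3)])
    fix vs :: "'a list" assume vs: "length vs = r" "\<forall>v \<in> set vs. norm v \<le> 1"
    show "\<bar>S vs - U vs\<bar> \<le> form_dist r S T + form_dist r T U"
      using form_dist_upper[OF that(1,2) vs] form_dist_upper[OF that(2,3) vs] by linarith
  qed
  show "form_dist r S T = 0 \<longleftrightarrow> S = T" if ST: "S \<in> forms r" "T \<in> forms r"
  proof
    assume "S = T"
    then have "form_dist r S T \<le> 0" by (intro form_dist_least ST) auto
    then show "form_dist r S T = 0" by (simp add: form_dist_def)
  next
    assume zero: "form_dist r S T = 0"
    show "S = T"
    proof
      fix vs :: "'a list"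
      show "S vs = T vs"
      proof (cases "length vs = r")
        case False
        then show ?thesis using ST by (simp add: forms_def)
      next
        case True
        define N where "N = sum_list (map norm vs) + 1"
        have "0 \<le> sum_list (map norm vs)" by (intro sum_list_nonneg) auto
        then have N: "N > 0" by (simp add: N_def)
        define ws where "ws = map (\<lambda>v. (1 / N) *\<^sub>R v) vs"
        have "norm v \<le> N" if "v \<in> set vs" for v
        proof -
          have "norm v \<le> sum_list (map norm vs)"
            using that by (intro member_le_sum_list) auto
          then show ?thesis by (simp add: N_def)
        qed
        then have "\<forall>w \<in> set ws. norm w \<le> 1" using N by (auto simp: ws_def)
        then have "S ws = T ws"
          using form_dist_upper[OF ST, of ws] zero True by (simp add: ws_def)
        moreover have "S ws = (1 / N) ^ r * S vs" "T ws = (1 / N) ^ r * T vs"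
          using form_scale[OF ST(1) True, of r "1 / N"] form_scale[OF ST(2) True, of r "1 / N"] True
          by (simp_all add: ws_def)
        ultimately show ?thesis using N by simp
      qed
    qed
  qed
qed


section \<open>Higher derivatives and the function class\<close>

text \<open>
  \<open>nderiv r f x [v\<^sub>1, \<dots>, v\<^sub>r]\<close> is the \<open>r\<close>-th derivative of \<open>f\<close> at \<open>x\<close> in the directions
  \<open>v\<^sub>1, \<dots>, v\<^sub>r\<close>, the direction differentiated last coming first.  It is the Frechet derivative
  whenever the latter exists; existence with respect to the operator norm is part of
  \<open>cont_diff\<close>.
\<close>

primrec nderiv :: "nat \<Rightarrow> ('a::real_normed_vector \<Rightarrow> real) \<Rightarrow> 'a \<Rightarrow> 'a list \<Rightarrow> real" where
  "nderiv 0 f x = (\<lambda>vs. if vs = [] then f x else 0)"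
| "nderiv (Suc r) f x =
     (\<lambda>vs. case vs of [] \<Rightarrow> 0
            | v # ws \<Rightarrow> frechet_derivative (\<lambda>y. nderiv r f y ws) (at x) v)"

definition cont_diff :: "nat \<Rightarrow> ('a::real_normed_vector \<Rightarrow> real) \<Rightarrow> bool" where
  "cont_diff p f \<longleftrightarrow>
     (\<forall>r\<le>p. continuous_map euclidean (form_topology r) (nderiv r f)) \<and>
     (\<forall>r<p. \<forall>x. ((\<lambda>y. form_norm r (\<lambda>vs. nderiv r f y vs - nderiv r f x vs
                                        - nderiv (Suc r) f x ((y - x) # vs)) / norm (y - x))
                 \<longlongrightarrow> 0) (at x))"

definition ncvx_class :: "nat \<Rightarrow> ('a::real_normed_vector \<Rightarrow> real) set" where
  "ncvx_class p = {f. cont_diff p f \<and>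
     (\<forall>x y. form_norm p (\<lambda>vs. nderiv p f x vs - nderiv p f y vs) \<le> norm (x - y)) \<and>
     - 1 \<le> (INF x. ereal (f x)) \<and> (INF x. ereal (f x)) \<le> ereal (f 0) \<and> f 0 \<le> 1 \<and>
     (\<forall>r\<in>{1..p}. form_norm r (nderiv r f 0) \<le> 1)}"


section \<open>Randomized algorithms\<close>

definition borel_of :: "'x topology \<Rightarrow> 'x measure" where
  "borel_of X = sigma (topspace X) {U. openin X U}"

text \<open>
  An answer to a query is the tuple of the derivatives of orders \<open>0, \<dots>, p\<close>, and the history available
  for the \<open>t\<close>-th iterate consists of the answers at the iterates \<open>1, \<dots>, t - 1\<close>.  As the spaces of
  forms need not be separable, the Borel sets of the topological product may be more than the
  product of the Borel sets; the former is used, which admits more algorithms.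
\<close>

definition history_topology ::
    "nat \<Rightarrow> nat \<Rightarrow> (nat \<Rightarrow> nat \<Rightarrow> 'a::real_normed_vector list \<Rightarrow> real) topology" where
  "history_topology p t = product_topology (\<lambda>s. product_topology form_topology {..p}) {1..<t}"

definition jet ::
    "nat \<Rightarrow> ('a::real_normed_vector \<Rightarrow> real) \<Rightarrow> 'a \<Rightarrow> nat \<Rightarrow> 'a list \<Rightarrow> real" where
  "jet p f x = (\<lambda>r\<in>{..p}. nderiv r f x)"

definition seed :: "real measure" where
  "seed = uniform_measure lborel {0..1}"

type_synonym 'a algorithm = "nat \<Rightarrow> real \<Rightarrow> (nat \<Rightarrow> nat \<Rightarrow> 'a list \<Rightarrow> real) \<Rightarrow> 'a"

definition rand_algorithms :: "nat \<Rightarrow> 'a::real_normed_vector algorithm set" where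
  "rand_algorithms p = {A. \<forall>t\<ge>1.
     (\<lambda>(\<xi>, h). A t \<xi> h) \<in> seed \<Otimes>\<^sub>M borel_of (history_topology p t) \<rightarrow>\<^sub>M borel}"

text \<open>
  The conditional is \<open>\<lambda>s\<in>{1..<t}. jet p f (iterate A p f \<xi> s)\<close>, spelled out so that the
  termination prover sees the bound on \<open>s\<close>.
\<close>

fun iterate ::
    "'a::real_normed_vector algorithm \<Rightarrow> nat \<Rightarrow> ('a \<Rightarrow> real) \<Rightarrow> real \<Rightarrow> nat \<Rightarrow> 'a" where
  "iterate A p f \<xi> t =
     A t \<xi> (\<lambda>s. if 1 \<le> s \<and> s < t then jet p f (iterate A p f \<xi> s) else undefined)"

declare iterate.simps [simp del]

definition algorithm_output ::
    "'a::real_normed_vector algorithm \<Rightarrow> nat \<Rightarrow> ('a \<Rightarrow> real) \<Rightarrow> real \<Rightarrow> nat \<Rightarrow> 'a" where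
  "algorithm_output A p f \<xi> n = iterate A p f \<xi> (n + 1)"

end

theory Submission
  imports Defs
begin

text \<open>
  The hard functions are sums of rescaled blocks, one for each \<open>k\<close>.  Block \<open>k\<close> is built from a
  chain of length \<open>T\<close> in the style of Carmon, Duchi, Hinder and Sidford: for orthonormal directions
  \<open>u\<^sub>0, \<dots>, u\<^bsub>T-1\<^esub>\<close> and \<open>z\<^sub>j = z \<bullet> u\<^sub>j\<close>,
  \<open>H z = - \<Phi> z\<^sub>0 - (\<Sum>j. \<Psi> z\<^sub>j * \<Phi> z\<^bsub>j+1\<^esub>)\<close>, where \<open>\<Phi>\<close> is increasing and \<open>\<Psi>\<close> vanishes up to \<open>1 / 2\<close>
  and is \<open>1\<close> from \<open>1\<close> on.  The direction \<open>u\<^bsub>j+1\<^esub>\<close> is invisible in all derivatives at \<open>z\<close> as long as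
  \<open>z\<^sub>j \<le> 1 / 2\<close>, and the gradient is large as long as some \<open>z\<^sub>j\<close> is less than \<open>1\<close>.

  Each \<open>u\<^sub>j\<close> is drawn uniformly from its own pool of \<open>N\<close> orthonormal vectors, and \<open>H\<close> is multiplied by a
  cutoff of radius \<open>R \<sim> T\<close> and added to a quadratic bowl \<open>q / 4\<close>.  Inside the cutoff at most
  \<open>4 * R\<^sup>2\<close> vectors of a pool have a large inner product with a query, so a query hits an
  unseen \<open>u\<^sub>j\<close> with probability at most \<open>4 * R\<^sup>2 / N\<close>; outside the cutoff nothing is revealed and the
  bowl makes the gradient large.  For large \<open>N\<close> the gradient is thus large at the \<open>T\<close>-th query
  with probability at least \<open>1 - \<delta>\<close>.

  By Bessel's inequality the derivatives of \<open>H\<close> of order at least \<open>2\<close> are bounded independently of \<open>T\<close>,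
  so scaling space by \<open>T powr (1 / (p + 1))\<close> and values by \<open>a\<^sub>k / T\<close> gives gradients of size
  \<open>a\<^sub>k * T powr (- p / (p + 1))\<close> with a \<open>p\<close>-th derivative that is Lipschitz with a constant proportional
  to \<open>a\<^sub>k\<close>.  The \<open>a\<^sub>k\<close> are fixed first, with a small sum; the slack \<open>\<rho> \<longlonglongrightarrow> 0\<close> allows \<open>T = T\<^sub>k\<close> to be
  chosen so large that \<open>\<rho> (T\<^sub>k - 1) \<le> a\<^sub>k / 4\<close>.  Infinitely many of these events happen
  with probability at least \<open>1 - \<delta>\<close>.
\<close>

section \<open>Towers of derivatives\<close>

text \<open>As in \<^const>\<open>nderiv\<close>, the direction differentiated last comes first.\<close>

definition tower :: "nat \<Rightarrow> ('a::real_normed_vector \<Rightarrow> 'a list \<Rightarrow> real) \<Rightarrow> bool" where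
  "tower m G \<longleftrightarrow>
     (\<forall>vs x. length vs < m \<longrightarrow> ((\<lambda>y. G y vs) has_derivative (\<lambda>v. G x (v # vs))) (at x))"

definition const_tower :: "real \<Rightarrow> 'a \<Rightarrow> 'a list \<Rightarrow> real" where
  "const_tower c x vs = (if vs = [] then c else 0)"

text \<open>The terms of the Leibniz rule: every direction falls on one of two factors, and within
  each factor the order of differentiation is kept.\<close>

fun splits :: "'a list \<Rightarrow> ('a list \<times> 'a list) list" where
  "splits [] = [([], [])]"
| "splits (v # vs) =
     map (\<lambda>z. (v # fst z, snd z)) (splits vs) @ map (\<lambda>z. (fst z, v # snd z)) (splits vs)"

definition tower_mult ::
    "('a \<Rightarrow> 'a list \<Rightarrow> real) \<Rightarrow> ('a \<Rightarrow> 'a list \<Rightarrow> real) \<Rightarrow> 'a \<Rightarrow> 'a list \<Rightarrow> real" where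
  "tower_mult G H x vs = (\<Sum>z\<leftarrow>splits vs. G x (fst z) * H x (snd z))"

text \<open>The product rule for a product over blocks: one more differentiation in direction
  \<open>v\<close> puts \<open>v\<close> into exactly one of the blocks.\<close>

fun join_block :: "'a \<Rightarrow> 'a list list \<Rightarrow> 'a list list list" where
  "join_block v [] = []"
| "join_block v (B # P) = ((v # B) # P) # map ((#) B) (join_block v P)"

fun parts :: "'a list \<Rightarrow> 'a list list list" where
  "parts [] = [[]]"
| "parts (v # vs) = concat (map (\<lambda>P. ([v] # P) # join_block v P) (parts vs))"

text \<open>Faa di Bruno's formula: \<^const>\<open>parts\<close> lists the set partitions of the directions.\<close>

definition tower_comp ::
    "(nat \<Rightarrow> real \<Rightarrow> real) \<Rightarrow> ('a \<Rightarrow> 'a list \<Rightarrow> real) \<Rightarrow> 'a \<Rightarrow> 'a list \<Rightarrow> real" where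
  "tower_comp \<phi> G x vs = (\<Sum>P\<leftarrow>parts vs. \<phi> (length P) (G x []) * (\<Prod>B\<leftarrow>P. G x B))"

text \<open>All derivatives of the ridge function \<open>\<phi> 0 (x \<bullet> e)\<close> at once,
  where \<open>\<phi>\<close> lists the derivatives of a function of one variable.\<close>

definition ridge ::
    "(nat \<Rightarrow> real \<Rightarrow> real) \<Rightarrow> 'a::real_inner \<Rightarrow> 'a \<Rightarrow> 'a list \<Rightarrow> real" where
  "ridge \<phi> e x vs = \<phi> (length vs) (x \<bullet> e) * (\<Prod>v\<leftarrow>vs. v \<bullet> e)"

definition derivs :: "(nat \<Rightarrow> real \<Rightarrow> real) \<Rightarrow> bool" where
  "derivs \<phi> \<longleftrightarrow> (\<forall>n x. (\<phi> n has_real_derivative \<phi> (Suc n) x) (at x))"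

section \<open>Leibniz rule and Faa di Bruno's formula for towers\<close>

lemma towerD:
  "tower m G \<Longrightarrow> length vs < m \<Longrightarrow> ((\<lambda>y. G y vs) has_derivative (\<lambda>v. G x (v # vs))) (at x)"
  by (simp add: tower_def)

lemma has_derivative_sum_list:
  assumes "\<And>z. z \<in> set zs \<Longrightarrow> (f z has_derivative f' z) F"
  shows "((\<lambda>y. \<Sum>z\<leftarrow>zs. f z y) has_derivative (\<lambda>v. \<Sum>z\<leftarrow>zs. f' z v)) F"
  using assms by (induction zs) (auto intro!: has_derivative_add)

lemma splits_length:
  "(us, ws) \<in> set (splits vs) \<Longrightarrow> length us + length ws = length vs"
  by (induction vs arbitrary: us ws) auto

lemma splits_prod_list:
  fixes f :: "'a \<Rightarrow> real"
  shows "(us, ws) \<in> set (splits vs) \<Longrightarrow> (\<Prod>v\<leftarrow>us. f v) * (\<Prod>v\<leftarrow>ws. f v) = (\<Prod>v\<leftarrow>vs. f v)"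
  by (induction vs arbitrary: us ws) (auto simp: algebra_simps)

lemma length_splits: "length (splits vs) = 2 ^ length vs"
  by (induction vs) auto

lemma tower_const [intro]: "tower m (const_tower c)"
  by (auto simp: tower_def const_tower_def intro!: derivative_eq_intros)

lemma tower_cmult:
  "tower m G \<Longrightarrow> tower m (\<lambda>x vs. c * G x vs)"
  unfolding tower_def by (auto intro!: has_derivative_mult_right)

lemma tower_add:
  "tower m G \<Longrightarrow> tower m H \<Longrightarrow> tower m (\<lambda>x vs. G x vs + H x vs)"
  unfolding tower_def by (auto intro!: has_derivative_add)

lemma tower_sum:
  "(\<And>i. i \<in> I \<Longrightarrow> tower m (G i)) \<Longrightarrow> tower m (\<lambda>x vs. \<Sum>i\<in>I. G i x vs)"
  unfolding tower_def by (auto intro!: has_derivative_sum)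

lemma tower_scale:
  assumes "tower m G"
  shows "tower m (\<lambda>x vs. c ^ length vs * G (c *\<^sub>R x) vs)"
  unfolding tower_def
proof (intro allI impI)
  fix vs :: "'a list" and x assume vs: "length vs < m"
  have G: "((\<lambda>y. G y vs) has_derivative (\<lambda>v. G (c *\<^sub>R x) (v # vs))) (at (c *\<^sub>R x))"
    using assms vs by (rule towerD)
  then have "linear (\<lambda>v. G (c *\<^sub>R x) (v # vs))" by (rule has_derivative_linear)
  then have lin: "G (c *\<^sub>R x) (c *\<^sub>R v # vs) = c * G (c *\<^sub>R x) (v # vs)" for v
    by (auto dest: linear_cmul)
  have "((\<lambda>y. G (c *\<^sub>R y) vs) has_derivative (\<lambda>v. G (c *\<^sub>R x) (c *\<^sub>R v # vs))) (at x)"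
    by (rule has_derivative_compose[where f = "\<lambda>y. c *\<^sub>R y" and g = "\<lambda>y. G y vs", OF _ G]) (auto intro!: derivative_eq_intros)
  then have "((\<lambda>y. c ^ length vs * G (c *\<^sub>R y) vs) has_derivative
      (\<lambda>v. c ^ length vs * G (c *\<^sub>R x) (c *\<^sub>R v # vs))) (at x)"
    by (rule has_derivative_mult_right)
  then show "((\<lambda>y. c ^ length vs * G (c *\<^sub>R y) vs) has_derivative
      (\<lambda>v. c ^ length (v # vs) * G (c *\<^sub>R x) (v # vs))) (at x)"
    by (simp add: lin mult_ac)
qed

lemma tower_mult:
  assumes "tower m G" "tower m H"
  shows "tower m (tower_mult G H)"
  unfolding tower_def
proof (intro allI impI)
  fix vs :: "'a list" and x assume vs: "length vs < m"
  have "((\<lambda>y. \<Sum>z\<leftarrow>splits vs. G y (fst z) * H y (snd z)) has_derivative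
     (\<lambda>v. \<Sum>z\<leftarrow>splits vs. G x (fst z) * H x (v # snd z) + G x (v # fst z) * H x (snd z))) (at x)"
  proof (rule has_derivative_sum_list)
    fix z assume "z \<in> set (splits vs)"
    then have "length (fst z) < m" "length (snd z) < m"
      using splits_length[of "fst z" "snd z" vs] vs by auto
    then show "((\<lambda>y. G y (fst z) * H y (snd z)) has_derivative
      (\<lambda>v. G x (fst z) * H x (v # snd z) + G x (v # fst z) * H x (snd z))) (at x)"
      using assms by (intro has_derivative_mult) (auto intro: towerD)
  qed
  then show "((\<lambda>y. tower_mult G H y vs) has_derivative (\<lambda>v. tower_mult G H x (v # vs))) (at x)"
    by (simp add: tower_mult_def comp_def sum_list_addf add.commute)
qed

text \<open>The power of two counts the splits. The two factors may measure directions by different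
  gauges \<open>f\<close> and \<open>g\<close>, as the two coordinates of a link do. Only products
  \<open>a m * b l\<close> of complementary orders have to be controlled, so the decay of a cutoff
  in \<open>m\<close> can compensate for the growth of a chain at low order
  \<open>l\<close>.\<close>

lemma tower_mult_bound:
  assumes G: "\<And>us. \<bar>G x us\<bar> \<le> a (length us) * (\<Prod>v\<leftarrow>us. f v)"
    and H: "\<And>us. \<bar>H x us\<bar> \<le> b (length us) * (\<Prod>v\<leftarrow>us. g v)"
    and ab: "\<And>m l. m + l = length vs \<Longrightarrow> a m * b l \<le> K"
    and b0: "\<And>m. 0 \<le> b m"
    and nn: "\<And>m. 0 \<le> a m" "\<And>v. 0 \<le> f v" "\<And>v. f v \<le> t v" "\<And>v. 0 \<le> g v" "\<And>v. g v \<le> t v"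
  shows "\<bar>tower_mult G H x vs\<bar> \<le> 2 ^ length vs * K * (\<Prod>v\<leftarrow>vs. t v)"
proof -
  have t0: "0 \<le> t v" for v using nn(2,3)[of v] by linarith
  have p: "0 \<le> (\<Prod>v\<leftarrow>us. f v)" "(\<Prod>v\<leftarrow>us. f v) \<le> (\<Prod>v\<leftarrow>us. t v)" "0 \<le> (\<Prod>v\<leftarrow>us. g v)"
      "(\<Prod>v\<leftarrow>us. g v) \<le> (\<Prod>v\<leftarrow>us. t v)" "0 \<le> (\<Prod>v\<leftarrow>us. t v)" for us
    using nn t0 by (induction us) (auto intro!: mult_mono)
  have "\<bar>tower_mult G H x vs\<bar> \<le> (\<Sum>z\<leftarrow>splits vs. \<bar>G x (fst z) * H x (snd z)\<bar>)"
    using sum_list_abs[of "map (\<lambda>z. G x (fst z) * H x (snd z)) (splits vs)"]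
    by (simp add: tower_mult_def comp_def)
  also have "\<dots> \<le> (\<Sum>z\<leftarrow>splits vs. K * (\<Prod>v\<leftarrow>vs. t v))"
  proof (rule sum_list_mono)
    fix z assume z: "z \<in> set (splits vs)"
    obtain us ws where [simp]: "z = (us, ws)" by (cases z)
    have "\<bar>G x us * H x ws\<bar> \<le> (a (length us) * (\<Prod>v\<leftarrow>us. f v)) * (b (length ws) * (\<Prod>v\<leftarrow>ws. g v))"
      unfolding abs_mult using G[of us] H[of ws] by (intro mult_mono) (auto intro: mult_nonneg_nonneg nn p b0)
    also have "\<dots> = (a (length us) * b (length ws)) * ((\<Prod>v\<leftarrow>us. f v) * (\<Prod>v\<leftarrow>ws. g v))"
      by (simp add: mult_ac)
    also have "\<dots> \<le> K * ((\<Prod>v\<leftarrow>us. f v) * (\<Prod>v\<leftarrow>ws. g v))"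
      using ab splits_length[of us ws vs] z p by (intro mult_right_mono) auto
    also have "\<dots> \<le> K * ((\<Prod>v\<leftarrow>us. t v) * (\<Prod>v\<leftarrow>ws. t v))"
    proof -
      have "0 \<le> K" using ab[of "length vs" 0] nn(1)[of "length vs"] b0[of 0]
        by (meson add_0_right mult_nonneg_nonneg order_trans)
      then show ?thesis using p by (intro mult_left_mono mult_mono) auto
    qed
    finally show "\<bar>G x (fst z) * H x (snd z)\<bar> \<le> K * (\<Prod>v\<leftarrow>vs. t v)"
      using splits_prod_list[of us ws vs t] z by simp
  qed
  also have "\<dots> = 2 ^ length vs * K * (\<Prod>v\<leftarrow>vs. t v)"
    by (simp add: sum_list_triv length_splits)
  finally show ?thesis .
qed

lemma sum_list_concat_map:
  fixes g :: "'b \<Rightarrow> 'c::comm_monoid_add"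
  shows "(\<Sum>x\<leftarrow>concat (map f xs). g x) = (\<Sum>y\<leftarrow>xs. \<Sum>x\<leftarrow>f y. g x)"
  by (induction xs) auto

text \<open>A new direction \<open>v\<close> either hits the outer function, which raises the order
  of \<open>\<phi>\<close> and opens the block \<open>[v]\<close>, or hits one of the existing
  blocks. The recursion of \<open>parts\<close> lists exactly these cases.\<close>

lemma tower_comp:
  assumes \<phi>: "derivs \<phi>" and G: "tower m G"
  shows "tower m (tower_comp \<phi> G)"
  unfolding tower_def
proof (intro allI impI)
  fix vs :: "'a list" and x assume vs: "length vs < m"
  have len: "length B \<le> length vs" if "P \<in> set (parts vs)" "B \<in> set P" for P B
    using that
  proof (induction vs arbitrary: P B)
    case (Cons v vs)
    have J: "length B \<le> Suc k" if "\<And>B. B \<in> set P \<Longrightarrow> length B \<le> k" "Q \<in> set (join_block v P)" "B \<in> set Q"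
      for P Q B k
      using that by (induction P arbitrary: Q B) (auto simp: le_SucI)
    from Cons show ?case by (fastforce intro: J le_SucI)
  qed simp
  have prod: "((\<lambda>y. \<Prod>B\<leftarrow>P. G y B) has_derivative
      (\<lambda>v. \<Sum>Q\<leftarrow>join_block v P. \<Prod>B\<leftarrow>Q. G x B)) (at x)"
    if "\<And>B. B \<in> set P \<Longrightarrow> length B < m" for P
    using that
  proof (induction P)
    case (Cons B P)
    have "((\<lambda>y. G y B * (\<Prod>B\<leftarrow>P. G y B)) has_derivative
       (\<lambda>v. G x B * (\<Sum>Q\<leftarrow>join_block v P. \<Prod>B\<leftarrow>Q. G x B) + G x (v # B) * (\<Prod>B\<leftarrow>P. G x B))) (at x)"
      using Cons G by (intro has_derivative_mult) (auto intro: towerD)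
    then show ?case by (simp add: comp_def sum_list_const_mult add.commute)
  qed simp
  have jl: "length Q = length P" if "Q \<in> set (join_block v P)" for v P and Q :: "'a list list"
    using that by (induction P arbitrary: Q) auto
  have "((\<lambda>y. \<Sum>P\<leftarrow>parts vs. \<phi> (length P) (G y []) * (\<Prod>B\<leftarrow>P. G y B)) has_derivative
     (\<lambda>v. \<Sum>P\<leftarrow>parts vs. \<phi> (length P) (G x []) * (\<Sum>Q\<leftarrow>join_block v P. \<Prod>B\<leftarrow>Q. G x B)
        + \<phi> (Suc (length P)) (G x []) * G x [v] * (\<Prod>B\<leftarrow>P. G x B))) (at x)"
  proof (rule has_derivative_sum_list)
    fix P assume P: "P \<in> set (parts vs)"
    have "(\<phi> (length P) has_derivative (*) (\<phi> (Suc (length P)) (G x []))) (at (G x []))"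
      using \<phi> by (simp add: derivs_def has_field_derivative_def)
    moreover have "((\<lambda>y. G y []) has_derivative (\<lambda>v. G x [v])) (at x)"
      using G vs by (intro towerD) auto
    ultimately have "((\<lambda>y. \<phi> (length P) (G y [])) has_derivative
        (\<lambda>v. \<phi> (Suc (length P)) (G x []) * G x [v])) (at x)"
      by (rule has_derivative_compose[rotated])
    then show "((\<lambda>y. \<phi> (length P) (G y []) * (\<Prod>B\<leftarrow>P. G y B)) has_derivative
       (\<lambda>v. \<phi> (length P) (G x []) * (\<Sum>Q\<leftarrow>join_block v P. \<Prod>B\<leftarrow>Q. G x B)
        + \<phi> (Suc (length P)) (G x []) * G x [v] * (\<Prod>B\<leftarrow>P. G x B))) (at x)"
      using prod[of P] len[OF P] vs by (intro has_derivative_mult) (auto intro: le_less_trans)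
  qed
  moreover have "(\<Sum>P\<leftarrow>parts vs. \<phi> (length P) (G x []) * (\<Sum>Q\<leftarrow>join_block v P. \<Prod>B\<leftarrow>Q. G x B)
        + \<phi> (Suc (length P)) (G x []) * G x [v] * (\<Prod>B\<leftarrow>P. G x B)) = tower_comp \<phi> G x (v # vs)" for v
  proof -
    have "(\<Sum>Q\<leftarrow>join_block v P. \<phi> (length Q) (G x []) * (\<Prod>B\<leftarrow>Q. G x B)) =
       \<phi> (length P) (G x []) * (\<Sum>Q\<leftarrow>join_block v P. \<Prod>B\<leftarrow>Q. G x B)" for P
      using jl[of _ v P] by (simp add: sum_list_const_mult[symmetric] cong: map_cong)
    then show ?thesis
      by (simp add: tower_comp_def sum_list_concat_map mult_ac add_ac del: map_concat)
  qed
  ultimately show "((\<lambda>y. tower_comp \<phi> G y vs) has_derivative (\<lambda>v. tower_comp \<phi> G x (v # vs))) (at x)"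
    by (simp add: tower_comp_def[of \<phi> G _ vs])
qed

lemma parts_prod_list:
  fixes f :: "'a \<Rightarrow> real"
  assumes "P \<in> set (parts vs)"
  shows "(\<Prod>B\<leftarrow>P. \<Prod>v\<leftarrow>B. f v) = (\<Prod>v\<leftarrow>vs. f v)"
  using assms
proof (induction vs arbitrary: P)
  case (Cons v vs)
  have "(\<Prod>B\<leftarrow>Q. \<Prod>v\<leftarrow>B. f v) = f v * (\<Prod>B\<leftarrow>P. \<Prod>v\<leftarrow>B. f v)" if "Q \<in> set (join_block v P)" for P Q
    using that by (induction P arbitrary: Q) (auto simp: mult_ac)
  with Cons show ?case by auto
qed simp

lemma parts_nonempty: "P \<in> set (parts vs) \<Longrightarrow> [] \<notin> set P"
proof (induction vs arbitrary: P)
  case (Cons v vs)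
  have "[] \<notin> set Q" if "Q \<in> set (join_block v P)" "[] \<notin> set P" for P Q
    using that by (induction P arbitrary: Q) auto
  with Cons show ?case by auto
qed simp

lemma length_parts_le: "P \<in> set (parts vs) \<Longrightarrow> length P \<le> length vs"
proof (induction vs arbitrary: P)
  case (Cons v vs)
  have jl: "length Q = length P" if "Q \<in> set (join_block v P)" for v P and Q :: "'a list list"
    using that by (induction P arbitrary: Q) auto
  with Cons show ?case by (fastforce simp: le_SucI)
qed simp

text \<open>A crude bound for the Bell numbers: a new direction has at most
  \<open>Suc (length vs)\<close> places to go, namely a block of its own or one of the at most
  \<open>length vs\<close> old blocks.\<close>

lemma card_parts: "length (parts vs) \<le> fact (length vs)"
proof (induction vs)
  case (Cons v vs)
  have jl: "length (join_block v P) = length P" for P :: "'a list list"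
    by (induction P) auto
  have "length (parts (v # vs)) = (\<Sum>P\<leftarrow>parts vs. Suc (length P))"
    by (simp add: length_concat comp_def jl)
  also have "\<dots> \<le> (\<Sum>P\<leftarrow>parts vs. Suc (length vs))"
    by (intro sum_list_mono) (auto simp: length_parts_le)
  also have "\<dots> = length (parts vs) * Suc (length vs)" by (simp add: sum_list_triv)
  also have "\<dots> \<le> fact (length vs) * Suc (length vs)" using Cons by (rule mult_right_mono) simp
  finally show ?case by (simp add: mult.commute)
qed simp

text \<open>Blocks of a partition are nonempty, so the inner value \<open>G x []\<close> enters only
  as the argument of \<open>\<phi>\<close> and may be arbitrarily large.\<close>

lemma tower_comp_bound:
  assumes \<phi>: "\<And>n. n \<le> length vs \<Longrightarrow> \<bar>\<phi> n (G x [])\<bar> \<le> c"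
    and G: "\<And>B. B \<noteq> [] \<Longrightarrow> \<bar>G x B\<bar> \<le> (\<Prod>v\<leftarrow>B. f v)"
  shows "\<bar>tower_comp \<phi> G x vs\<bar> \<le> fact (length vs) * c * (\<Prod>v\<leftarrow>vs. f v)"
proof -
  have f: "0 \<le> f v" for v using G[of "[v]"] by simp
  then have f0: "0 \<le> (\<Prod>v\<leftarrow>B. f v)" for B by (induction B) auto
  have c: "0 \<le> c" using \<phi>[of 0] by simp
  have "\<bar>tower_comp \<phi> G x vs\<bar> \<le> (\<Sum>P\<leftarrow>parts vs. \<bar>\<phi> (length P) (G x []) * (\<Prod>B\<leftarrow>P. G x B)\<bar>)"
    using sum_list_abs[of "map (\<lambda>P. \<phi> (length P) (G x []) * (\<Prod>B\<leftarrow>P. G x B)) (parts vs)"]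
    by (simp add: tower_comp_def comp_def)
  also have "\<dots> \<le> (\<Sum>P\<leftarrow>parts vs. c * (\<Prod>v\<leftarrow>vs. f v))"
  proof (rule sum_list_mono)
    fix P assume P: "P \<in> set (parts vs)"
    have "\<bar>\<Prod>B\<leftarrow>P. G x B\<bar> \<le> (\<Prod>B\<leftarrow>P. \<Prod>v\<leftarrow>B. f v)" if "[] \<notin> set P" for P
      using that by (induction P) (auto simp: abs_mult intro!: mult_mono G f0)
    then show "\<bar>\<phi> (length P) (G x []) * (\<Prod>B\<leftarrow>P. G x B)\<bar> \<le> c * (\<Prod>v\<leftarrow>vs. f v)"
      using parts_nonempty[OF P] length_parts_le[OF P] c unfolding abs_mult
      by (intro mult_mono \<phi>) (auto simp: parts_prod_list[OF P, symmetric])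
  qed
  also have "\<dots> = length (parts vs) * (c * (\<Prod>v\<leftarrow>vs. f v))" by (simp add: sum_list_triv)
  also have "\<dots> \<le> fact (length vs) * (c * (\<Prod>v\<leftarrow>vs. f v))"
    using card_parts[of vs] c f0 by (intro mult_right_mono) (auto simp: of_nat_le_iff[symmetric, where 'a=real] simp del: of_nat_le_iff)
  finally show ?thesis by (simp add: mult_ac)
qed

lemma tower_ridge:
  assumes "derivs \<phi>"
  shows "tower m (ridge \<phi> e)"
  unfolding tower_def
proof (intro allI impI)
  fix vs :: "'a list" and x
  have "(\<phi> (length vs) has_derivative (*) (\<phi> (Suc (length vs)) (x \<bullet> e))) (at (x \<bullet> e))"
    using assms by (simp add: derivs_def has_field_derivative_def)
  moreover have "((\<lambda>y. y \<bullet> e) has_derivative (\<lambda>v. v \<bullet> e)) (at x)"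
    by (auto intro!: derivative_eq_intros)
  ultimately have "((\<lambda>y. \<phi> (length vs) (y \<bullet> e)) has_derivative
      (\<lambda>v. \<phi> (Suc (length vs)) (x \<bullet> e) * (v \<bullet> e))) (at x)"
    by (rule has_derivative_compose[rotated])
  then have "((\<lambda>y. \<phi> (length vs) (y \<bullet> e) * (\<Prod>v\<leftarrow>vs. v \<bullet> e)) has_derivative
      (\<lambda>v. \<phi> (Suc (length vs)) (x \<bullet> e) * (v \<bullet> e) * (\<Prod>v\<leftarrow>vs. v \<bullet> e))) (at x)"
    by (rule has_derivative_mult_left)
  then show "((\<lambda>y. ridge \<phi> e y vs) has_derivative (\<lambda>v. ridge \<phi> e x (v # vs))) (at x)"
    by (simp add: ridge_def mult_ac)
qed

section \<open>From towers to \<open>nderiv\<close>, forms and continuous differentiability\<close>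

lemma nderiv_tower:
  assumes "tower m G" "r \<le> m"
  shows "nderiv r (\<lambda>x. G x []) x = (\<lambda>vs. if length vs = r then G x vs else 0)"
  using assms(2)
proof (induction r arbitrary: x)
  case (Suc r)
  show ?case
  proof
    fix vs :: "'a list"
    show "nderiv (Suc r) (\<lambda>x. G x []) x vs = (if length vs = Suc r then G x vs else 0)"
    proof (cases vs)
      case (Cons v ws)
      have IH: "nderiv r (\<lambda>x. G x []) y ws = (if length ws = r then G y ws else 0)" for y
        using Suc by simp
      show ?thesis
      proof (cases "length ws = r")
        case True
        then have "((\<lambda>y. G y ws) has_derivative (\<lambda>v. G x (v # ws))) (at x)"
          using assms(1) Suc.prems by (intro towerD) auto
        then have "frechet_derivative (\<lambda>y. G y ws) (at x) = (\<lambda>v. G x (v # ws))"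
          by (rule frechet_derivative_at[symmetric])
        then show ?thesis using True by (simp add: Cons IH)
      qed (simp add: Cons IH)
    qed simp
  qed
qed auto

text \<open>In the outermost direction linearity is that of a derivative. In the others it is
  inherited: differentiating the linear relation for shorter lists, which holds at every point,
  gives the relation one order higher by uniqueness of derivatives.\<close>

lemma tower_linear:
  assumes "tower m G" "length vs \<le> m" "i < length vs"
  shows "linear (\<lambda>v. G x (vs[i := v]))"
  using assms(2,3)
proof (induction vs arbitrary: i x)
  case (Cons w vs)
  have D: "((\<lambda>y. G y us) has_derivative (\<lambda>v. G x (v # us))) (at x)" if "length us = length vs" for us x
    using assms(1) Cons.prems that by (intro towerD) auto
  show ?case
  proof (cases i)
    case 0
    then show ?thesis using has_derivative_linear[OF D, of vs] by simp
  next
    case (Suc i')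
    have lin: "linear (\<lambda>v. G y (vs[i' := v]))" for y
      using Cons Suc by auto
    show ?thesis
    proof (rule linearI)
      fix a b :: 'a
      have "((\<lambda>y. G y (vs[i' := a]) + G y (vs[i' := b])) has_derivative
          (\<lambda>v. G x (v # vs[i' := a]) + G x (v # vs[i' := b]))) (at x)"
        by (intro has_derivative_add D) auto
      moreover have "((\<lambda>y. G y (vs[i' := a + b])) has_derivative (\<lambda>v. G x (v # vs[i' := a + b]))) (at x)"
        by (intro D) auto
      ultimately have "(\<lambda>v. G x (v # vs[i' := a + b])) = (\<lambda>v. G x (v # vs[i' := a]) + G x (v # vs[i' := b]))"
        using linear_add[OF lin] by (intro has_derivative_unique) auto
      from fun_cong[OF this, of w]
      show "G x ((w # vs)[i := a + b]) = G x ((w # vs)[i := a]) + G x ((w # vs)[i := b])"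
        using Suc by simp
    next
      fix c :: real and a :: 'a
      have "((\<lambda>y. c * G y (vs[i' := a])) has_derivative (\<lambda>v. c * G x (v # vs[i' := a]))) (at x)"
        by (intro has_derivative_mult_right D) auto
      moreover have "((\<lambda>y. G y (vs[i' := c *\<^sub>R a])) has_derivative (\<lambda>v. G x (v # vs[i' := c *\<^sub>R a]))) (at x)"
        by (intro D) auto
      ultimately have "(\<lambda>v. G x (v # vs[i' := c *\<^sub>R a])) = (\<lambda>v. c * G x (v # vs[i' := a]))"
        using linear_cmul[OF lin] by (intro has_derivative_unique) auto
      from fun_cong[OF this, of w]
      show "G x ((w # vs)[i := c *\<^sub>R a]) = c *\<^sub>R G x ((w # vs)[i := a])"
        using Suc by simp
    qed
  qed
qed simp

lemma prod_norm_le_1: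
  "\<forall>v\<in>set vs. norm v \<le> 1 \<Longrightarrow> 0 \<le> (\<Prod>v\<leftarrow>vs. norm v) \<and> (\<Prod>v\<leftarrow>vs. norm v) \<le> 1"
  by (induction vs) (auto intro: mult_le_one)

lemma form_norm_le:
  fixes T :: "'a::real_normed_vector list \<Rightarrow> real"
  assumes "\<And>vs. length vs = r \<Longrightarrow> \<bar>T vs\<bar> \<le> B * (\<Prod>v\<leftarrow>vs. norm v)" "0 \<le> B"
  shows "0 \<le> form_norm r T" "form_norm r T \<le> B"
proof -
  let ?S = "{vs :: 'a list. length vs = r \<and> (\<forall>v \<in> set vs. norm v \<le> 1)}"
  have *: "\<bar>T vs\<bar> \<le> B" if "vs \<in> ?S" for vs
  proof -
    have "B * (\<Prod>v\<leftarrow>vs. norm v) \<le> B * 1"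
      using prod_norm_le_1[of vs] that assms(2) by (intro mult_left_mono) auto
    then show ?thesis using assms(1)[of vs] that by simp
  qed
  have z: "replicate r 0 \<in> ?S" by auto
  show "form_norm r T \<le> B"
    unfolding form_norm_def using z * by (intro cSUP_least) blast+
  have "\<bar>T (replicate r 0)\<bar> \<le> form_norm r T"
    unfolding form_norm_def using z * by (intro cSUP_upper bdd_aboveI2) blast+
  then show "0 \<le> form_norm r T" by linarith
qed

lemma tower_forms:
  assumes "tower m G" "r \<le> m"
    and "\<And>vs. length vs = r \<Longrightarrow> \<bar>G x vs\<bar> \<le> C * (\<Prod>v\<leftarrow>vs. norm v)"
  shows "nderiv r (\<lambda>x. G x []) x \<in> forms r"
  using assms tower_linear[OF assms(1)]
  unfolding nderiv_tower[OF assms(1,2)] forms_def by auto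

lemma tower_lipschitz:
  assumes "tower m G" "length vs < m" "convex S" "x \<in> S" "y \<in> S"
    and "\<And>z v. z \<in> S \<Longrightarrow> \<bar>G z (v # vs)\<bar> \<le> K * norm v" "0 \<le> K"
  shows "\<bar>G y vs - G x vs\<bar> \<le> K * norm (y - x)"
proof -
  have "norm (G y vs - G x vs) \<le> K * norm (y - x)"
  proof (rule differentiable_bound[OF assms(3) _ _ assms(5,4)])
    fix z assume z: "z \<in> S"
    show "((\<lambda>y. G y vs) has_derivative (\<lambda>v. G z (v # vs))) (at z within S)"
      using towerD[OF assms(1,2)] by (rule has_derivative_at_withinI)
    show "onorm (\<lambda>v. G z (v # vs)) \<le> K"
      using assms(6)[OF z] assms(7) by (intro onorm_bound) auto
  qed
  then show ?thesis by simp
qed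

text \<open>The parameter \<open>w\<close> will be the random choice of directions. Joint continuity
  in the point and in \<open>w\<close> makes the answers of the oracle measurable in both. Movement
  of the point is controlled by the derivative one order higher, movement of \<open>w\<close> by the
  uniform hypothesis on balls.\<close>

lemma continuous_map_nderiv:
  fixes G :: "'w::topological_space \<Rightarrow> 'a::real_normed_vector \<Rightarrow> 'a list \<Rightarrow> real"
  assumes G: "\<And>w. tower (Suc p) (G w)"
    and K: "\<And>w x vs R. norm x \<le> R \<Longrightarrow> length vs \<le> Suc p \<Longrightarrow> \<bar>G w x vs\<bar> \<le> K R * (\<Prod>v\<leftarrow>vs. norm v)"
    and cont: "\<And>w R \<epsilon>. 0 < \<epsilon> \<Longrightarrow> \<exists>U. open U \<and> w \<in> U \<and>
       (\<forall>w'\<in>U. \<forall>x vs. norm x \<le> R \<longrightarrow> length vs \<le> p \<longrightarrow> \<bar>G w' x vs - G w x vs\<bar> \<le> \<epsilon> * (\<Prod>v\<leftarrow>vs. norm v))"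
    and r: "r \<le> p"
  shows "continuous_map euclidean (form_topology r) (\<lambda>z. nderiv r (\<lambda>x. G (snd z) x []) (fst z))"
proof -
  interpret M: Metric_space "forms r :: ('a list \<Rightarrow> real) set" "form_dist r"
    by (rule Metric_space_forms)
  let ?J = "\<lambda>w x. nderiv r (\<lambda>x. G w x []) x"
  have J: "?J w x = (\<lambda>vs. if length vs = r then G w x vs else 0)" for w x
    using r by (intro nderiv_tower[OF G]) auto
  have forms: "?J w x \<in> forms r" for w x
    using r K[of x "norm x" _ w] by (intro tower_forms[OF G, of _ _ _ "K (norm x)"]) auto
  show ?thesis
    unfolding form_topology_def M.continuous_map_to_metric
  proof (intro ballI allI impI)
    fix z :: "'a \<times> 'w" and e :: real assume "0 < e"
    obtain x w where z: "z = (x, w)" by (cases z)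
    define R where "R = norm x + 1"
    obtain U where U: "open U" "w \<in> U"
      "\<And>w' x vs. w' \<in> U \<Longrightarrow> norm x \<le> R \<Longrightarrow> length vs \<le> p \<Longrightarrow>
          \<bar>G w' x vs - G w x vs\<bar> \<le> e / 4 * (\<Prod>v\<leftarrow>vs. norm v)"
      using cont[of "e / 4" w R] \<open>0 < e\<close> by auto
    have KR: "0 \<le> K R" using K[of x R "[]" w] by (simp add: R_def)
    define d where "d = min 1 (e / (4 * (K R + 1)))"
    have d: "0 < d" using \<open>0 < e\<close> KR by (simp add: d_def)
    have close: "form_dist r (?J w x) (?J w' x') \<le> e / 2"
      if w': "w' \<in> U" and x': "x' \<in> ball x d" for w' x'
    proof (rule form_dist_least[OF forms forms])
      fix vs :: "'a list" assume vs: "length vs = r" "\<forall>v\<in>set vs. norm v \<le> 1"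
      have xR: "norm x' \<le> R" "norm x \<le> R" "norm (x' - x) \<le> d"
        using x' norm_triangle_ineq2[of x' x] by (auto simp: R_def d_def dist_norm norm_minus_commute)
      have "\<bar>G w x' vs - G w x vs\<bar> \<le> K R * (\<Prod>v\<leftarrow>vs. norm v) * norm (x' - x)"
      proof (rule tower_lipschitz[OF G, where S = "cball 0 R"])
        fix z v :: 'a assume "z \<in> cball 0 R"
        then show "\<bar>G w z (v # vs)\<bar> \<le> K R * (\<Prod>v\<leftarrow>vs. norm v) * norm v"
          using K[of z R "v # vs" w] vs r by (simp add: mult_ac)
      qed (use vs r xR KR in \<open>auto intro!: mult_nonneg_nonneg prod_list_nonneg\<close>)
      also have "\<dots> \<le> K R * 1 * d"
        using prod_norm_le_1[OF vs(2)] KR xR by (intro mult_mono) auto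
      also have "\<dots> \<le> K R * (e / (4 * (K R + 1)))"
        using KR unfolding d_def mult_1_right by (intro mult_left_mono) auto
      also have "\<dots> \<le> e / 4"
        using KR \<open>0 < e\<close> by (simp add: field_simps)
      finally have 1: "\<bar>G w x' vs - G w x vs\<bar> \<le> e / 4" .
      have "\<bar>G w' x' vs - G w x' vs\<bar> \<le> e / 4 * (\<Prod>v\<leftarrow>vs. norm v)"
        using w' xR vs r by (intro U) auto
      also have "\<dots> \<le> e / 4 * 1"
        using prod_norm_le_1[OF vs(2)] \<open>0 < e\<close> by (intro mult_left_mono) auto
      finally have "\<bar>G w' x' vs - G w x' vs\<bar> \<le> e / 4" by simp
      with 1 have "\<bar>G w x vs - G w' x' vs\<bar> \<le> e / 2" by arith
      then show "\<bar>?J w x vs - ?J w' x' vs\<bar> \<le> e / 2"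
        using vs by (simp add: J)
    qed
    have "ball x d \<times> U \<subseteq> {y. ?J (snd y) (fst y) \<in> M.mball (?J (snd z) (fst z)) e}"
      using close forms \<open>0 < e\<close> by (fastforce simp: z)
    moreover have "open (ball x d \<times> U)" using U by (intro open_Times) auto
    moreover have "z \<in> ball x d \<times> U" using U d z by auto
    ultimately show "\<exists>U. openin euclidean U \<and> z \<in> U \<and>
        (\<forall>y\<in>U. ?J (snd y) (fst y) \<in> M.mball (?J (snd z) (fst z)) e)"
      unfolding open_openin[symmetric] by blast
  qed
qed

text \<open>A tower is differentiable separately for each list of directions, whereas
  \<open>cont_diff\<close> needs the operator norm. The Taylor remainder of order
  \<open>r < p\<close> is bounded through order \<open>r + 2\<close>, which is at most
  \<open>Suc p\<close>, by \<open>K R * (norm (y - x))\<^sup>2\<close> uniformly over the unit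
  directions.\<close>

lemma cont_diff_tower:
  fixes G :: "'a::real_normed_vector \<Rightarrow> 'a list \<Rightarrow> real"
  assumes G: "tower (Suc p) G"
    and K: "\<And>x vs R. norm x \<le> R \<Longrightarrow> length vs \<le> Suc p \<Longrightarrow> \<bar>G x vs\<bar> \<le> K R * (\<Prod>v\<leftarrow>vs. norm v)"
  shows "cont_diff p (\<lambda>x. G x [])"
  unfolding cont_diff_def
proof (intro conjI allI impI)
  fix r assume r: "r \<le> p"
  \<comment> \<open>A dummy real parameter turns the joint statement into the one for a single
    function.\<close>
  have "continuous_map euclidean (form_topology r)
      ((\<lambda>z::'a \<times> real. nderiv r (\<lambda>x. G x []) (fst z)) \<circ> (\<lambda>x. (x, 0)))"
  proof (rule continuous_map_compose)
    show "continuous_map euclidean euclidean (\<lambda>x::'a. (x, 0::real))"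
      by (auto intro!: continuous_intros)
    show "continuous_map euclidean (form_topology r) (\<lambda>z::'a \<times> real. nderiv r (\<lambda>x. G x []) (fst z))"
      using r by (intro continuous_map_nderiv[where G = "\<lambda>_. G" and K = K and p = p] G K exI[of _ UNIV])
        (auto intro!: mult_nonneg_nonneg prod_list_nonneg)
  qed
  then show "continuous_map euclidean (form_topology r) (nderiv r (\<lambda>x. G x []))"
    by (simp add: comp_def)
next
  fix r and x :: 'a assume r: "r < p"
  define R where "R = norm x + 1"
  have KR: "0 \<le> K R" using K[of x R "[]"] by (simp add: R_def)
  let ?f = "\<lambda>y. form_norm r (\<lambda>vs. nderiv r (\<lambda>x. G x []) y vs - nderiv r (\<lambda>x. G x []) x vs
              - nderiv (Suc r) (\<lambda>x. G x []) x ((y - x) # vs))"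
  have bound: "0 \<le> ?f y" "?f y \<le> K R * (norm (y - x))\<^sup>2" if y: "y \<in> ball x 1" for y
  proof -
    \<comment> \<open>The second ball ensures that every point of the convex set is at most as far
      from \<open>x\<close> as \<open>y\<close> is.\<close>
    let ?S = "cball 0 R \<inter> cball x (norm (y - x))"
    have "\<bar>nderiv r (\<lambda>x. G x []) y vs - nderiv r (\<lambda>x. G x []) x vs
              - nderiv (Suc r) (\<lambda>x. G x []) x ((y - x) # vs)\<bar> \<le> K R * (norm (y - x))\<^sup>2 * (\<Prod>v\<leftarrow>vs. norm v)"
      if vs: "length vs = r" for vs
    proof -
      have xy: "x \<in> ?S" "y \<in> ?S" "convex ?S"
        using y norm_triangle_ineq2[of y x]
        by (auto simp: R_def dist_norm norm_minus_commute intro!: convex_Int)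
      have lin: "linear (\<lambda>v. G x (v # vs))"
        by (rule has_derivative_linear[OF towerD[OF G]]) (use vs r in simp)
      \<comment> \<open>The mean value inequality is applied to \<open>G y vs\<close> minus its
        linear part at \<open>x\<close>; the derivative of this difference is itself small by a
        second use of the mean value inequality.\<close>
      have "norm ((G y vs - G x (y # vs)) - (G x vs - G x (x # vs))) \<le>
          (K R * norm (y - x) * (\<Prod>v\<leftarrow>vs. norm v)) * norm (y - x)"
      proof (rule differentiable_bound[where f = "\<lambda>y. G y vs - G x (y # vs)"
            and f' = "\<lambda>z v. G z (v # vs) - G x (v # vs)", OF xy(3) _ _ xy(2,1)])
        fix z assume z: "z \<in> ?S"
        have "((\<lambda>y. G y vs) has_derivative (\<lambda>v. G z (v # vs))) (at z within ?S)"
          by (rule has_derivative_at_withinI[OF towerD[OF G]]) (use vs r in simp)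
        moreover have "((\<lambda>y. G x (y # vs)) has_derivative (\<lambda>v. G x (v # vs))) (at z within ?S)"
          by (rule bounded_linear_imp_has_derivative[OF has_derivative_bounded_linear[OF towerD[OF G]]])
            (use vs r in simp)
        ultimately show "((\<lambda>y. G y vs - G x (y # vs)) has_derivative
            (\<lambda>v. G z (v # vs) - G x (v # vs))) (at z within ?S)"
          by (rule has_derivative_diff)
        show "onorm (\<lambda>v. G z (v # vs) - G x (v # vs)) \<le> K R * norm (y - x) * (\<Prod>v\<leftarrow>vs. norm v)"
        proof (rule onorm_bound)
          fix v
          have "\<bar>G z (v # vs) - G x (v # vs)\<bar> \<le> (K R * (norm v * (\<Prod>v\<leftarrow>vs. norm v))) * norm (z - x)"
          proof (rule tower_lipschitz[OF G, where S = "cball 0 R"])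
            fix z' v' :: 'a assume "z' \<in> cball 0 R"
            then show "\<bar>G z' (v' # v # vs)\<bar> \<le> K R * (norm v * (\<Prod>v\<leftarrow>vs. norm v)) * norm v'"
              using K[of z' R "v' # v # vs"] vs r by (simp add: mult_ac)
          qed (use vs r xy z KR in \<open>auto intro!: mult_nonneg_nonneg prod_list_nonneg\<close>)
          also have "\<dots> \<le> (K R * (norm v * (\<Prod>v\<leftarrow>vs. norm v))) * norm (y - x)"
            using z KR by (intro mult_left_mono) (auto simp: dist_norm norm_minus_commute
                intro!: mult_nonneg_nonneg prod_list_nonneg)
          finally show "norm (G z (v # vs) - G x (v # vs)) \<le> K R * norm (y - x) * (\<Prod>v\<leftarrow>vs. norm v) * norm v"
            by (simp add: mult_ac)
        qed (use KR in \<open>auto intro!: mult_nonneg_nonneg prod_list_nonneg\<close>)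
      qed
      then show ?thesis
        using vs r linear_diff[OF lin, of y x]
        by (simp add: nderiv_tower[OF G] power2_eq_square mult_ac algebra_simps del: nderiv.simps)
    qed
    from form_norm_le[OF this] KR show "0 \<le> ?f y" "?f y \<le> K R * (norm (y - x))\<^sup>2"
      by simp_all
  qed
  show "((\<lambda>y. ?f y / norm (y - x)) \<longlongrightarrow> 0) (at x)"
  proof (rule Lim_null_comparison[where g = "\<lambda>y. K R * norm (y - x)"])
    have "\<forall>\<^sub>F y in at x. y \<in> ball x 1"
      by (intro eventually_at_in_open') auto
    then show "\<forall>\<^sub>F y in at x. norm (?f y / norm (y - x)) \<le> K R * norm (y - x)"
    proof eventually_elim
      case (elim y)
      show ?case
      proof (cases "y = x")
        case True
        then show ?thesis by simp
      next
        case False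
        then show ?thesis using bound[OF elim] by (simp add: divide_simps power2_eq_square mult_ac)
      qed
    qed
    show "((\<lambda>y. K R * norm (y - x)) \<longlongrightarrow> 0) (at x)"
      by (auto intro!: tendsto_eq_intros)
  qed
qed

section \<open>A smooth step\<close>

text \<open>With \<open>y = 1 / x\<close>, differentiating \<open>P y * exp (- y)\<close> in
  \<open>x\<close> gives \<open>y\<^sup>2 * (P y - P' y) * exp (- y)\<close>, where the factor
  \<open>[:0, 0, 1:]\<close> is the square of \<open>y\<close>.\<close>

primrec flat_poly :: "nat \<Rightarrow> real poly" where
  "flat_poly 0 = 1"
| "flat_poly (Suc n) = [:0, 0, 1:] * (flat_poly n - pderiv (flat_poly n))"

text \<open>The derivatives of \<open>exp (- 1 / x)\<close> are polynomials in \<open>1 / x\<close> times \<open>exp (- 1 / x)\<close>.\<close>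

definition flat :: "nat \<Rightarrow> real \<Rightarrow> real" where
  "flat n x = (if 0 < x then poly (flat_poly n) (1 / x) * exp (- (1 / x)) else 0)"

lemma poly_times_exp_tendsto_0:
  fixes P :: "real poly"
  shows "((\<lambda>y. poly P y * exp (- y)) \<longlongrightarrow> 0) at_top"
proof -
  have "((\<lambda>y. \<Sum>i\<le>degree P. coeff P i * (y ^ i / exp y)) \<longlongrightarrow> (\<Sum>i\<le>degree P. coeff P i * 0)) at_top"
    by (intro tendsto_sum tendsto_mult tendsto_const tendsto_power_div_exp_0)
  then show ?thesis
    by (simp add: poly_altdef exp_minus sum_distrib_left divide_inverse mult_ac)
qed

lemma derivs_flat: "derivs flat"
  unfolding derivs_def
proof (intro allI)
  fix n and x :: real
  show "(flat n has_real_derivative flat (Suc n) x) (at x)"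
  proof (cases x "0 :: real" rule: linorder_cases)
    case less
    have "(flat n has_real_derivative 0) (at x)"
      by (rule has_field_derivative_transform_within_open[of "\<lambda>_. 0" _ _ "{..<0}"])
        (use less in \<open>auto simp: flat_def\<close>)
    then show ?thesis using less by (simp add: flat_def)
  next
    case greater
    have "((\<lambda>x. poly (flat_poly n) (1 / x) * exp (- (1 / x))) has_real_derivative flat (Suc n) x) (at x)"
      using greater
      by (auto intro!: derivative_eq_intros DERIV_chain2[OF poly_DERIV]
          simp: flat_def power2_eq_square field_simps)
    then show ?thesis
      by (rule has_field_derivative_transform_within_open[of _ _ _ "{0<..}"])
        (use greater in \<open>auto simp: flat_def\<close>)
  next
    case equal
    have "((\<lambda>h. flat n h / h) \<longlongrightarrow> 0) (at_right 0)"
    proof -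
      \<comment> \<open>The factor \<open>[:0, 1:]\<close> is the division by \<open>h\<close>: the
        difference quotient at the origin is again a polynomial in \<open>1 / h\<close> times
        \<open>exp (- 1 / h)\<close>.\<close>
      have "((\<lambda>h. poly ([:0, 1:] * flat_poly n) (inverse h) * exp (- inverse h)) \<longlongrightarrow> 0) (at_right 0)"
        by (rule filterlim_compose[OF poly_times_exp_tendsto_0 filterlim_inverse_at_top_right])
      then show ?thesis
        by (rule Lim_transform_eventually)
          (auto simp: eventually_at_right_field flat_def divide_inverse intro!: exI[of _ 1])
    qed
    moreover have "((\<lambda>h. flat n h / h) \<longlongrightarrow> 0) (at_left 0)"
      by (rule Lim_transform_eventually[of "\<lambda>_. 0"])
        (auto simp: eventually_at_left_field flat_def intro!: exI[of _ "-1"])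
    ultimately show ?thesis
      using equal by (simp add: DERIV_def flat_def filterlim_split_at)
  qed
qed

text \<open>A product of two flat functions that is positive exactly on the open unit interval.
  Viewing the reals as an inner product space with \<open>e = 1\<close> and taking all directions to
  be 1, the Leibniz towers supply all of its derivatives.\<close>

definition bump :: "nat \<Rightarrow> real \<Rightarrow> real" where
  "bump n x = tower_mult (ridge flat 1) (ridge (\<lambda>n x. (- 1) ^ n * flat n (1 - x)) 1) x (replicate n 1)"

lemma derivs_bump: "derivs bump"
  unfolding derivs_def
proof (intro allI)
  fix n and x :: real
  let ?G = "tower_mult (ridge flat 1) (ridge (\<lambda>n x. (- 1) ^ n * flat n (1 - x)) (1 :: real))"
  have "derivs (\<lambda>n x. (- 1) ^ n * flat n (1 - x))"
    unfolding derivs_def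
  proof (intro allI)
    fix n and x :: real
    have "((\<lambda>x. (- 1) ^ n * flat n (1 - x)) has_real_derivative (- 1) ^ n * (flat (Suc n) (1 - x) * (- 1))) (at x)"
      using derivs_flat unfolding derivs_def
      by (intro DERIV_cmult DERIV_chain2[of "flat n"]) (auto intro!: derivative_eq_intros)
    then show "((\<lambda>x. (- 1) ^ n * flat n (1 - x)) has_real_derivative (- 1) ^ Suc n * flat (Suc n) (1 - x)) (at x)"
      by simp
  qed
  then have T: "tower (Suc n) ?G" by (intro tower_mult tower_ridge derivs_flat)
  have *: "((\<lambda>y. ?G y (replicate n 1)) has_derivative (\<lambda>v. ?G x (v # replicate n 1))) (at x)"
    by (rule towerD[OF T, of "replicate n 1" x]) simp
  have "(\<lambda>v. ?G x (v # replicate n 1)) = (*) (bump (Suc n) x)"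
  proof
    fix v :: real
    have "?G x ((v *\<^sub>R 1) # replicate n 1) = v *\<^sub>R ?G x (1 # replicate n 1)"
      by (rule linear_cmul[OF has_derivative_linear[OF *]])
    then show "?G x (v # replicate n 1) = bump (Suc n) x * v"
      unfolding bump_def replicate_Suc real_scaleR_def mult_1_right by (subst mult.commute)
  qed
  from *[unfolded this] show "(bump n has_real_derivative bump (Suc n) x) (at x)"
    by (simp add: has_field_derivative_def bump_def[abs_def])
qed

lemma bump_outside: "x \<le> 0 \<or> 1 \<le> x \<Longrightarrow> bump n x = 0"
  by (auto simp: bump_def tower_mult_def ridge_def flat_def intro!: sum_list_0)

lemma bump_0: "bump 0 x = flat 0 x * flat 0 (1 - x)"
  by (simp add: bump_def tower_mult_def ridge_def)

lemma derivs_continuous: "derivs \<phi> \<Longrightarrow> continuous_on A (\<phi> n)"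
  unfolding derivs_def by (meson DERIV_isCont continuous_at_imp_continuous_on)

text \<open>The step is the antiderivative of \<open>bump\<close>, shifted to vanish at 0 and
  divided by its total increase \<open>I\<close> over the unit interval.\<close>

lemma smooth_step:
  obtains S :: "nat \<Rightarrow> real \<Rightarrow> real"
  where "derivs S" "\<And>n. \<exists>c. \<forall>x. \<bar>S n x\<bar> \<le> c" "\<And>n x. x \<le> 0 \<Longrightarrow> S n x = 0"
    "\<And>x. 1 \<le> x \<Longrightarrow> S 0 x = 1" "\<And>n x. 1 \<le> x \<Longrightarrow> S (Suc n) x = 0"
    "\<And>x. 0 \<le> S 0 x" "\<And>x. 0 \<le> S 1 x" "\<And>x. 0 < x \<Longrightarrow> x < 1 \<Longrightarrow> 0 < S 1 x"
proof -
  have bump_nonneg: "0 \<le> bump 0 x" for x by (simp add: bump_0 flat_def)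
  have bump_pos: "0 < bump 0 x" if "0 < x" "x < 1" for x using that by (simp add: bump_0 flat_def)
  obtain B where "\<forall>x::real. -\<infinity> < ereal x \<longrightarrow> ereal x < \<infinity> \<longrightarrow> (B has_vector_derivative bump 0 x) (at x)"
    using einterval_antiderivative[of "-\<infinity>" \<infinity> "bump 0"] derivs_bump
    by (auto simp: derivs_def intro: DERIV_isCont)
  then have B: "(B has_real_derivative bump 0 x) (at x)" for x
    by (simp add: has_real_derivative_iff_has_vector_derivative)
  have B0: "B x = B 0" if x: "x \<le> 0" for x
  proof (cases "x = 0")
    case False
    then obtain z where "x < z" "z < 0" "B 0 - B x = (0 - x) * bump 0 z"
      using MVT2[of x 0 B "bump 0"] B x by auto
    then show ?thesis by (simp add: bump_outside)
  qed simp
  have B1: "B x = B 1" if x: "1 \<le> x" for x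
  proof (cases "x = 1")
    case False
    then obtain z where "1 < z" "z < x" "B x - B 1 = (x - 1) * bump 0 z"
      using MVT2[of 1 x B "bump 0"] B x by auto
    then show ?thesis by (simp add: bump_outside)
  qed simp
  have mono: "B x \<le> B y" if "x \<le> y" for x y
    using B bump_nonneg by (intro DERIV_nonneg_imp_nondecreasing[OF that]) blast
  define I where "I = B 1 - B 0"
  have I: "0 < I"
  proof -
    obtain z where "0 < z" "z < 1" "B 1 - B 0 = (1 - 0) * bump 0 z"
      using MVT2[of 0 1 B "bump 0"] B by auto
    then show ?thesis using bump_pos by (simp add: I_def)
  qed
  define S where "S n x = (case n of 0 \<Rightarrow> (B x - B 0) / I | Suc m \<Rightarrow> bump m x / I)" for n x
  have S_Suc: "S (Suc m) x = bump m x / I" and S_0: "S 0 x = (B x - B 0) / I" for m x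
    by (simp_all add: S_def)
  have "derivs S"
    unfolding derivs_def
  proof (intro allI)
    fix n x
    have "(S 0 has_real_derivative S 1 x) (at x)"
      unfolding S_0[abs_def] S_Suc One_nat_def using I
      by (auto intro!: derivative_eq_intros B)
    moreover have "(S (Suc m) has_real_derivative S (Suc (Suc m)) x) (at x)" for m
      unfolding S_Suc[abs_def] S_Suc using I derivs_bump
      by (auto intro!: derivative_eq_intros simp: derivs_def)
    ultimately show "(S n has_real_derivative S (Suc n) x) (at x)" by (cases n) auto
  qed
  moreover have "\<exists>c. \<forall>x. \<bar>S n x\<bar> \<le> c" for n
  proof -
    \<comment> \<open>Outside the unit interval \<open>S n\<close> agrees with its value at the
      nearer endpoint, so compactness of the interval gives a global bound.\<close>
    have "compact (S n ` {0..1})"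
      using \<open>derivs S\<close> by (intro compact_continuous_image derivs_continuous) auto
    then obtain c where "\<forall>x\<in>{0..1}. \<bar>S n x\<bar> \<le> c"
      by (auto dest!: compact_imp_bounded simp: bounded_iff)
    then have c: "\<bar>S n x\<bar> \<le> c" if "0 \<le> x" "x \<le> 1" for x using that by simp
    have "\<bar>S n x\<bar> \<le> c" for x
    proof (cases "x \<le> 0")
      case True
      then have "S n x = S n 0" using B0[OF True] by (cases n) (auto simp: S_0 S_Suc bump_outside)
      then show ?thesis using c[of 0] by simp
    next
      case x0: False
      show ?thesis
      proof (cases "1 \<le> x")
        case True
        then have "S n x = S n 1" using B1[OF True] by (cases n) (auto simp: S_0 S_Suc bump_outside)
        then show ?thesis using c[of 1] by simp
      qed (use x0 c in auto)
    qed
    then show ?thesis by blast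
  qed
  moreover have "S n x = 0" if "x \<le> 0" for n x
    using that B0[OF that] by (cases n) (auto simp: S_0 S_Suc bump_outside)
  moreover have "S 0 x = 1" "S (Suc n) x = 0" if "1 \<le> x" for n x
    using that I B1[OF that] by (auto simp: S_0 S_Suc bump_outside I_def)
  moreover have "0 \<le> S 0 x" for x
    using mono[of 0 x] B0[of x] I by (cases "0 \<le> x") (auto simp: S_0)
  moreover have "0 \<le> S 1 x" for x
    using I bump_nonneg by (simp add: S_Suc)
  moreover have "0 < S 1 x" if "0 < x" "x < 1" for x
    using I bump_pos[OF that] by (simp add: S_Suc)
  ultimately show thesis by (rule that)
qed

section \<open>The switch \<Psi> and the ramp \<Phi>\<close>

lemma derivs_affine:
  assumes "derivs \<phi>"
  shows "derivs (\<lambda>n x. c * (a ^ n * \<phi> n (a * x + b)))"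
  unfolding derivs_def
proof (intro allI)
  fix n and x :: real
  have "((\<lambda>x. c * (a ^ n * \<phi> n (a * x + b))) has_real_derivative c * (a ^ n * (\<phi> (Suc n) (a * x + b) * a))) (at x)"
    using assms unfolding derivs_def
    by (intro DERIV_cmult DERIV_chain2[of "\<phi> n"]) (auto intro!: derivative_eq_intros)
  then show "((\<lambda>x. c * (a ^ n * \<phi> n (a * x + b))) has_real_derivative c * (a ^ Suc n * \<phi> (Suc n) (a * x + b))) (at x)"
    by (simp add: mult_ac)
qed

text \<open>\<Psi> switches a link on once the preceding coordinate has passed 1/2, and \<Phi>
  rewards progress in the next one. A slope of \<Phi> of at least 1 is asked for only on
  \<open>[- 1, 1]\<close>: further to the left the quadratic bowl supplies the gradient.\<close>

locale chain_functions =
  fixes \<Psi> \<Phi> :: "nat \<Rightarrow> real \<Rightarrow> real" and c :: "nat \<Rightarrow> real"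
  assumes derivs_\<Psi>: "derivs \<Psi>" and derivs_\<Phi>: "derivs \<Phi>"
    and \<Psi>_bound: "\<bar>\<Psi> n x\<bar> \<le> c n" and \<Phi>_bound: "\<bar>\<Phi> n x\<bar> \<le> c n"
    and \<Psi>_left: "x \<le> 1 / 2 \<Longrightarrow> \<Psi> n x = 0"
    and \<Psi>_right: "1 \<le> x \<Longrightarrow> \<Psi> 0 x = 1" and \<Psi>_Suc_right: "1 \<le> x \<Longrightarrow> \<Psi> (Suc n) x = 0"
    and \<Psi>_nonneg: "0 \<le> \<Psi> 0 x" and \<Psi>_mono: "0 \<le> \<Psi> 1 x"
    and \<Phi>_nonneg: "0 \<le> \<Phi> 0 x" and \<Phi>_mono: "0 \<le> \<Phi> 1 x"
    and \<Phi>_steep: "- 1 \<le> x \<Longrightarrow> x \<le> 1 \<Longrightarrow> 1 \<le> \<Phi> 1 x"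

lemma chain_functions_exist: "\<exists>\<Psi> \<Phi> c. chain_functions \<Psi> \<Phi> c"
proof -
  obtain S :: "nat \<Rightarrow> real \<Rightarrow> real"
    where S: "derivs S" "\<And>n. \<exists>c. \<forall>x. \<bar>S n x\<bar> \<le> c" "\<And>n x. x \<le> 0 \<Longrightarrow> S n x = 0"
    "\<And>x. 1 \<le> x \<Longrightarrow> S 0 x = 1" "\<And>n x. 1 \<le> x \<Longrightarrow> S (Suc n) x = 0"
    "\<And>x. 0 \<le> S 0 x" "\<And>x. 0 \<le> S 1 x" "\<And>x. 0 < x \<Longrightarrow> x < 1 \<Longrightarrow> 0 < S 1 x"
    by (rule smooth_step) blast
  obtain s where s: "\<And>n x. \<bar>S n x\<bar> \<le> s n" using S(2) by metis
  \<comment> \<open>The slope of the step has a positive minimum on the middle half of the unit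
    interval; \<Phi> will use only this part over \<open>[- 1, 1]\<close>.\<close>
  have "\<exists>m\<in>{1/4..3/4}. \<forall>y\<in>{1/4..3/4}. S 1 m \<le> S 1 y"
    using S(1) by (intro continuous_attains_inf derivs_continuous) auto
  then obtain m where m: "m \<in> {1/4..3/4}" "\<And>y. y \<in> {1/4..3/4} \<Longrightarrow> S 1 m \<le> S 1 y" by blast
  define \<mu> where "\<mu> = S 1 m"
  have \<mu>: "0 < \<mu>" using S(8)[of m] m(1) by (simp add: \<mu>_def)
  \<comment> \<open>The map \<open>2 * x - 1\<close> sends \<open>[1 / 2, 1]\<close> to the unit
    interval, and \<open>x / 4 + 1 / 2\<close> sends \<open>[- 1, 1]\<close> to
    \<open>[1 / 4, 3 / 4]\<close>. The factor \<open>4 / \<mu>\<close> undoes the inner derivative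
    1/4 and the minimal slope \<open>\<mu>\<close>.\<close>
  define \<Psi> where "\<Psi> n x = 1 * (2 ^ n * S n (2 * x + (- 1)))" for n x
  define \<Phi> where "\<Phi> n x = (4 / \<mu>) * ((1 / 4) ^ n * S n (1 / 4 * x + 1 / 2))" for n x
  define c where "c n = 2 ^ n * s n + 4 / \<mu> * ((1 / 4) ^ n * s n)" for n
  have s0: "0 \<le> s n" for n using s[of n 0] by linarith
  have "chain_functions \<Psi> \<Phi> c"
  proof
    show "derivs \<Psi>" "derivs \<Phi>"
      unfolding \<Psi>_def[abs_def] \<Phi>_def[abs_def] using S(1) by (rule derivs_affine)+
    fix n x
    show "\<bar>\<Psi> n x\<bar> \<le> c n"
    proof -
      have "\<bar>\<Psi> n x\<bar> \<le> 2 ^ n * s n" using s by (simp add: \<Psi>_def abs_mult)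
      moreover have "0 \<le> 4 / \<mu> * ((1 / 4) ^ n * s n)" using \<mu> s0 by simp
      ultimately show ?thesis by (simp add: c_def)
    qed
    show "\<bar>\<Phi> n x\<bar> \<le> c n"
    proof -
      have "\<bar>\<Phi> n x\<bar> = 4 / \<mu> * ((1 / 4) ^ n * \<bar>S n (1 / 4 * x + 1 / 2)\<bar>)"
        using \<mu> by (simp add: \<Phi>_def abs_mult)
      also have "\<dots> \<le> 4 / \<mu> * ((1 / 4) ^ n * s n)" using \<mu> s by (intro mult_left_mono) auto
      finally have "\<bar>\<Phi> n x\<bar> \<le> 4 / \<mu> * ((1 / 4) ^ n * s n)" .
      moreover have "0 \<le> 2 ^ n * s n" using s0 by simp
      ultimately show ?thesis by (simp add: c_def)
    qed
    show "\<Psi> n x = 0" if "x \<le> 1 / 2" using that S(3) by (simp add: \<Psi>_def)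
    show "\<Psi> 0 x = 1" "\<Psi> (Suc n) x = 0" if "1 \<le> x" using that S(4,5) by (simp_all add: \<Psi>_def)
    show "0 \<le> \<Psi> 0 x" "0 \<le> \<Psi> 1 x" using S(6,7) by (simp_all add: \<Psi>_def)
    show "0 \<le> \<Phi> 0 x" "0 \<le> \<Phi> 1 x" using S(6,7) \<mu> by (simp_all add: \<Phi>_def)
    show "1 \<le> \<Phi> 1 x" if "- 1 \<le> x" "x \<le> 1"
    proof -
      have "\<mu> \<le> S 1 (1 / 4 * x + 1 / 2)" unfolding \<mu>_def using that by (intro m(2)) auto
      then show ?thesis using \<mu> by (simp add: \<Phi>_def field_simps)
    qed
  qed
  then show ?thesis by blast
qed

section \<open>Chains of hidden directions\<close>

definition orthonormal :: "'a::real_inner set \<Rightarrow> bool" where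
  "orthonormal E \<longleftrightarrow> (\<forall>a\<in>E. \<forall>b\<in>E. a \<bullet> b = of_bool (a = b))"

lemma bessel:
  assumes "orthonormal E" "finite E"
  shows "(\<Sum>e\<in>E. (x \<bullet> e)\<^sup>2) \<le> (norm x)\<^sup>2"
proof -
  define y where "y = (\<Sum>e\<in>E. (x \<bullet> e) *\<^sub>R e)"
  have xy: "x \<bullet> y = (\<Sum>e\<in>E. (x \<bullet> e)\<^sup>2)"
    by (simp add: y_def inner_sum_right power2_eq_square)
  have "y \<bullet> e = x \<bullet> e" if "e \<in> E" for e
  proof -
    have "y \<bullet> e = (\<Sum>d\<in>E. if d = e then x \<bullet> d else 0)"
      using assms(1) that by (auto simp: y_def inner_sum_left orthonormal_def intro!: sum.cong)
    then show ?thesis using assms(2) that by simp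
  qed
  then have "y \<bullet> y = (\<Sum>e\<in>E. (x \<bullet> e)\<^sup>2)"
    by (subst (2) y_def) (simp add: inner_sum_right power2_eq_square)
  moreover have "0 \<le> (x - y) \<bullet> (x - y)" by simp
  ultimately show ?thesis
    using xy by (simp add: inner_diff_left inner_diff_right inner_commute power2_norm_eq_inner)
qed

definition sq :: "nat \<Rightarrow> real \<Rightarrow> real" where
  "sq n t = (if n = 0 then t\<^sup>2 else if n = 1 then 2 * t else if n = 2 then 2 else 0)"

lemma derivs_sq: "derivs sq"
  unfolding derivs_def
proof (intro allI)
  fix n :: nat and x :: real
  consider "n = 0" | "n = 1" | "n = 2" | "3 \<le> n" by linarith
  then show "(sq n has_real_derivative sq (Suc n) x) (at x)"
    by cases (auto simp: sq_def[abs_def] intro!: derivative_eq_intros)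
qed

text \<open>For orthonormal \<open>E\<close> the value is the squared norm of the projection to the
  span of \<open>E\<close>. Blocks with mutually orthogonal pools therefore do not interact.\<close>

definition quad :: "'a::real_inner set \<Rightarrow> 'a \<Rightarrow> 'a list \<Rightarrow> real" where
  "quad E x vs = (\<Sum>e\<in>E. ridge sq e x vs)"

lemma tower_quad: "tower m (quad E)"
  unfolding quad_def by (intro tower_sum tower_ridge derivs_sq)

lemma quad_0: "quad E x [] = (\<Sum>e\<in>E. (x \<bullet> e)\<^sup>2)"
  and quad_1: "quad E x [v] = 2 * (\<Sum>e\<in>E. (x \<bullet> e) * (v \<bullet> e))"
  and quad_2: "quad E x [v, w] = 2 * (\<Sum>e\<in>E. (v \<bullet> e) * (w \<bullet> e))"
  and quad_3: "3 \<le> length vs \<Longrightarrow> quad E x vs = 0"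
proof -
  show "quad E x vs = 0" if "3 \<le> length vs"
    using that by (cases vs) (auto simp: quad_def ridge_def sq_def intro!: sum.neutral)
qed (auto simp: quad_def ridge_def sq_def sum_distrib_left mult_ac)

lemma quad_nonneg: "0 \<le> quad E x []"
  by (simp add: quad_0 sum_nonneg)

lemma abs_sum_mult_le: "\<bar>\<Sum>i\<in>I. a i * b i\<bar> \<le> sqrt (\<Sum>i\<in>I. (a i)\<^sup>2) * sqrt (\<Sum>i\<in>I. (b i)\<^sup>2)" for a b :: "'i \<Rightarrow> real"
  using Cauchy_Schwarz_ineq_sum[of a b I]
  by (metis real_sqrt_abs real_sqrt_le_mono real_sqrt_mult)

lemma quad_bounds:
  assumes "orthonormal E" "finite E"
  shows "quad E x [] \<le> (norm x)\<^sup>2"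
    and "\<bar>quad E x [v]\<bar> \<le> 2 * sqrt (quad E x []) * norm v"
    and "\<bar>quad E x [v, w]\<bar> \<le> 2 * (norm v * norm w)"
proof -
  have b: "quad E x [] \<le> (norm x)\<^sup>2" for x using bessel[OF assms] by (simp add: quad_0)
  then show "quad E x [] \<le> (norm x)\<^sup>2" .
  have s: "sqrt (quad E x []) \<le> norm x" for x
    using real_sqrt_le_mono[OF b[of x]] by simp
  have "\<bar>quad E x [v]\<bar> \<le> 2 * (sqrt (quad E x []) * sqrt (quad E v []))"
    using abs_sum_mult_le[of "\<lambda>e. x \<bullet> e" "\<lambda>e. v \<bullet> e" E] by (simp add: quad_0 quad_1 abs_mult)
  also have "\<dots> \<le> 2 * (sqrt (quad E x []) * norm v)"
    using s quad_nonneg by (intro mult_left_mono) auto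
  finally show "\<bar>quad E x [v]\<bar> \<le> 2 * sqrt (quad E x []) * norm v" by simp
  have "\<bar>quad E x [v, w]\<bar> \<le> 2 * (sqrt (quad E v []) * sqrt (quad E w []))"
    using abs_sum_mult_le[of "\<lambda>e. v \<bullet> e" "\<lambda>e. w \<bullet> e" E] by (simp add: quad_0 quad_2 abs_mult)
  also have "\<dots> \<le> 2 * (norm v * norm w)"
    using s quad_nonneg by (intro mult_left_mono mult_mono) auto
  finally show "\<bar>quad E x [v, w]\<bar> \<le> 2 * (norm v * norm w)" .
qed

text \<open>The growth in \<open>T\<close> of the \<open>r\<close>-th derivative of a chain with \<open>T\<close> links.\<close>

definition weight :: "nat \<Rightarrow> nat \<Rightarrow> real" where
  "weight T r = (if r = 0 then real T else if r = 1 then sqrt (real T) else 1)"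

lemma weight_nonneg: "0 \<le> weight T r"
  by (simp add: weight_def)

text \<open>From one order to the next \<open>weight\<close> drops by at most the factor
  \<open>sqrt T\<close>, while a derivative falling on the cutoff gains a full factor
  \<open>1 / T\<close>.\<close>

lemma weight_shift:
  assumes "1 \<le> T"
  shows "(1 / real T) ^ m * weight T l \<le> weight T (m + l)"
proof -
  have T: "1 \<le> real T" using assms by simp
  have s: "sqrt (real T) \<le> real T" using T by (simp add: real_le_lsqrt power2_eq_square)
  have s1: "1 \<le> sqrt (real T)" using T by simp
  have q: "(1 / real T) ^ m \<le> (1 / real T) ^ k" if "k \<le> m" for k
    using that T by (intro power_decreasing) auto
  consider "m = 0" | "m = 1" "l = 0" | "m \<ge> 2" "l = 0" | "m \<ge> 1" "l = 1" | "l \<ge> 2" by linarith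
  then show ?thesis
  proof cases
    case 3
    have "(1 / real T) ^ m * real T \<le> (1 / real T) ^ 1 * real T"
      using q[of 1] 3 T by (intro mult_right_mono) auto
    then show ?thesis using 3 T by (simp add: weight_def)
  next
    case 4
    have "(1 / real T) ^ m * sqrt (real T) \<le> (1 / real T) ^ 1 * real T"
      using q[of 1] 4 T s by (intro mult_mono) auto
    then show ?thesis using 4 T by (simp add: weight_def)
  next
    case 5
    then show ?thesis using q[of 0] by (simp add: weight_def)
  qed (use T s1 in \<open>auto simp: weight_def\<close>)
qed

definition orthonormal_seq :: "(nat \<Rightarrow> 'a::real_inner) \<Rightarrow> bool" where
  "orthonormal_seq u \<longleftrightarrow> (\<forall>i j. u i \<bullet> u j = of_bool (i = j))"

lemma orthonormal_seqD: "orthonormal_seq u \<Longrightarrow> u i \<bullet> u j = of_bool (i = j)"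
  by (simp add: orthonormal_seq_def)

lemma bessel_seq:
  assumes "orthonormal_seq u"
  shows "(\<Sum>j<L. (x \<bullet> u j)\<^sup>2) \<le> (norm x)\<^sup>2"
proof -
  have inj: "inj u"
  proof (rule injI)
    fix i j assume "u i = u j"
    then have "u i \<bullet> u j = u j \<bullet> u j" by simp
    then show "i = j" using assms by (simp add: orthonormal_seq_def)
  qed
  have "orthonormal (u ` {..<L})"
    using assms inj by (auto simp: orthonormal_def orthonormal_seq_def inj_eq)
  from bessel[OF this] show ?thesis
    using inj by (simp add: sum.reindex inj_on_subset)
qed

definition link_size :: "(nat \<Rightarrow> 'a::real_inner) \<Rightarrow> nat \<Rightarrow> 'a \<Rightarrow> real" where
  "link_size u j v = (if j = 0 then 0 else \<bar>v \<bullet> u (j - 1)\<bar>) + \<bar>v \<bullet> u j\<bar>"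

lemma link_size_nonneg: "0 \<le> link_size u j v"
  by (simp add: link_size_def)

text \<open>This is where the dependence on the length disappears. With two or more directions,
  Cauchy-Schwarz in two of them and Bessel bound the sum over the links, the others being estimated
  crudely by twice their norm. A single direction is paired with the constant 1, at the cost of
  \<open>sqrt L\<close>.\<close>

lemma sum_link_size:
  assumes "orthonormal_seq u"
  shows "(\<Sum>j<L. \<Prod>v\<leftarrow>vs. link_size u j v) \<le> 2 ^ length vs * weight L (length vs) * (\<Prod>v\<leftarrow>vs. norm v)"
proof -
  have u1: "norm (u j) = 1" for j
    using orthonormal_seqD[OF assms, of j j] by (simp add: norm_eq_1)
  have le: "link_size u j v \<le> 2 * norm v" for j v
    using Cauchy_Schwarz_ineq2[of v "u (j - 1)"] Cauchy_Schwarz_ineq2[of v "u j"] u1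
    by (auto simp: link_size_def)
  have sq: "(\<Sum>j<L. (link_size u j v)\<^sup>2) \<le> (2 * norm v)\<^sup>2" for v
  proof -
    \<comment> \<open>After \<open>(a + b)\<^sup>2 \<le> 2 * a\<^sup>2 + 2 * b\<^sup>2\<close>,
      Bessel applies to the sequence and to its shift by one, each giving
      \<open>2 * (norm v)\<^sup>2\<close>.\<close>
    have "(link_size u j v)\<^sup>2 \<le> 2 * (if j = 0 then 0 else (v \<bullet> u (j - 1))\<^sup>2) + 2 * (v \<bullet> u j)\<^sup>2" for j
      using sum_squares_bound[of "\<bar>v \<bullet> u (j - 1)\<bar>" "\<bar>v \<bullet> u j\<bar>"] by (auto simp: link_size_def power2_sum)
    then have "(\<Sum>j<L. (link_size u j v)\<^sup>2) \<le>
        (\<Sum>j<L. 2 * (if j = 0 then 0 else (v \<bullet> u (j - 1))\<^sup>2) + 2 * (v \<bullet> u j)\<^sup>2)"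
      by (rule sum_mono)
    also have "\<dots> = 2 * (\<Sum>j<L. if j = 0 then 0 else (v \<bullet> u (j - 1))\<^sup>2) + 2 * (\<Sum>j<L. (v \<bullet> u j)\<^sup>2)"
      by (simp add: sum.distrib sum_distrib_left)
    also have "(\<Sum>j<L. if j = 0 then 0 else (v \<bullet> u (j - 1))\<^sup>2) \<le> (norm v)\<^sup>2"
      using bessel_seq[OF assms, of v "L - 1"]
      by (cases L) (simp_all add: sum.lessThan_Suc_shift del: sum.lessThan_Suc)
    also have "(\<Sum>j<L. (v \<bullet> u j)\<^sup>2) \<le> (norm v)\<^sup>2" by (rule bessel_seq[OF assms])
    finally show ?thesis by (simp add: power2_eq_square)
  qed
  have sq': "sqrt (\<Sum>j<L. (link_size u j v)\<^sup>2) \<le> 2 * norm v" for v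
    using sq[of v] by (intro real_le_lsqrt) auto
  consider "vs = []" | v where "vs = [v]" | v w us where "vs = v # w # us"
    by (metis neq_Nil_conv)
  then show ?thesis
  proof cases
    case 1
    then show ?thesis by (simp add: weight_def)
  next
    case (2 v)
    have "(\<Sum>j<L. link_size u j v) \<le> \<bar>\<Sum>j<L. 1 * link_size u j v\<bar>" by simp
    also have "\<dots> \<le> sqrt (\<Sum>j<L. 1\<^sup>2) * sqrt (\<Sum>j<L. (link_size u j v)\<^sup>2)"
      by (rule abs_sum_mult_le)
    also have "\<dots> \<le> sqrt L * (2 * norm v)" using sq'[of v] by (simp add: mult_left_mono)
    finally show ?thesis using 2 by (simp add: weight_def mult_ac)
  next
    case (3 v w us)
    have us: "0 \<le> (\<Prod>v\<leftarrow>us. link_size u j v)"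
      "(\<Prod>v\<leftarrow>us. link_size u j v) \<le> 2 ^ length us * (\<Prod>v\<leftarrow>us. norm v)" for j
    proof (induction us)
      case (Cons a us)
      { case 1 show ?case using Cons by (auto simp: link_size_nonneg) }
      { case 2
        have "link_size u j a * (\<Prod>v\<leftarrow>us. link_size u j v) \<le> (2 * norm a) * (2 ^ length us * (\<Prod>v\<leftarrow>us. norm v))"
          using Cons le[of j a] link_size_nonneg by (intro mult_mono) auto
        then show ?case by (simp add: mult_ac) }
    qed auto
    have "(\<Sum>j<L. \<Prod>v\<leftarrow>vs. link_size u j v) \<le>
        (\<Sum>j<L. (link_size u j v * link_size u j w) * (2 ^ length us * (\<Prod>v\<leftarrow>us. norm v)))"
    proof (rule sum_mono)
      fix j
      have "(link_size u j v * link_size u j w) * (\<Prod>v\<leftarrow>us. link_size u j v) \<le>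
          (link_size u j v * link_size u j w) * (2 ^ length us * (\<Prod>v\<leftarrow>us. norm v))"
        by (intro mult_left_mono us mult_nonneg_nonneg link_size_nonneg)
      then show "(\<Prod>v\<leftarrow>vs. link_size u j v) \<le>
          (link_size u j v * link_size u j w) * (2 ^ length us * (\<Prod>v\<leftarrow>us. norm v))"
        using 3 by (simp add: mult.assoc)
    qed
    also have "\<dots> = (\<Sum>j<L. link_size u j v * link_size u j w) * (2 ^ length us * (\<Prod>v\<leftarrow>us. norm v))"
      by (simp add: sum_distrib_right)
    also have "\<dots> \<le> (2 * norm v) * (2 * norm w) * (2 ^ length us * (\<Prod>v\<leftarrow>us. norm v))"
    proof (rule mult_right_mono)
      have "(\<Sum>j<L. link_size u j v * link_size u j w) \<le>
          sqrt (\<Sum>j<L. (link_size u j v)\<^sup>2) * sqrt (\<Sum>j<L. (link_size u j w)\<^sup>2)"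
        using abs_sum_mult_le[of "\<lambda>j. link_size u j v" "\<lambda>j. link_size u j w" "{..<L}"] by linarith
      also have "\<dots> \<le> (2 * norm v) * (2 * norm w)"
        using sq' by (intro mult_mono) (auto intro!: sum_nonneg)
      finally show "(\<Sum>j<L. link_size u j v * link_size u j w) \<le> (2 * norm v) * (2 * norm w)" .
    qed (auto intro!: mult_nonneg_nonneg prod_list_nonneg)
    finally show ?thesis
      using 3 by (simp add: weight_def mult_ac)
  qed
qed

section \<open>Chain, cutoff and bowl, with bounds for their derivatives\<close>

context chain_functions
begin

definition \<theta> :: "nat \<Rightarrow> real \<Rightarrow> real" where
  "\<theta> n s = of_bool (n = 0) - \<Psi> n s"

text \<open>A majorant of \<open>c\<close> that is monotone in the order and at least 1, so that it
  also covers the constant terms in \<open>\<theta>\<close> and in link 0.\<close>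

definition C :: "nat \<Rightarrow> real" where
  "C r = 1 + (\<Sum>n\<le>r. c n)"

definition link :: "(nat \<Rightarrow> 'a::real_inner) \<Rightarrow> nat \<Rightarrow> 'a \<Rightarrow> 'a list \<Rightarrow> real" where
  "link u j = tower_mult (if j = 0 then const_tower 1 else ridge \<Psi> (u (j - 1))) (ridge \<Phi> (u j))"

definition chain :: "(nat \<Rightarrow> 'a::real_inner) \<Rightarrow> nat \<Rightarrow> 'a \<Rightarrow> 'a list \<Rightarrow> real" where
  "chain u L x vs = - (\<Sum>j<L. link u j x vs)"

text \<open>The cutoff is a function of the squared norm of the projection, so it is smooth at the
  origin as well. It is 1 up to \<open>R\<^sup>2 / 2\<close> and 0 from \<open>R\<^sup>2\<close>
  on.\<close>

definition cut :: "'a::real_inner set \<Rightarrow> real \<Rightarrow> 'a \<Rightarrow> 'a list \<Rightarrow> real" where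
  "cut E R = tower_comp \<theta> (\<lambda>x vs. 1 / R\<^sup>2 * quad E x vs)"

definition hump where
  "hump u L E R = tower_mult (cut E R) (chain u L)"

definition block where
  "block u L E R x vs = hump u L E R x vs + 1 / 4 * quad E x vs"

text \<open>The factors come from the Leibniz rule, from Faa di Bruno for the cutoff and from the
  chain. None of them involves the length of the chain, the pool or the radius.\<close>

definition K :: "nat \<Rightarrow> real" where
  "K r = 2 ^ r * (fact r * C r * (4 ^ r * (C r)\<^sup>2))"

lemma c_nonneg: "0 \<le> c n"
  using \<Psi>_bound[of n 0] by linarith

lemma C_ge_1: "1 \<le> C r" and C_mono: "r \<le> s \<Longrightarrow> C r \<le> C s" and c_le_C: "c r \<le> C r"
proof -
  show "1 \<le> C r" by (simp add: C_def sum_nonneg c_nonneg)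
  show "r \<le> s \<Longrightarrow> C r \<le> C s" by (auto simp: C_def c_nonneg intro!: sum_mono2)
  have "c r \<le> (\<Sum>n\<le>r. c n)" by (rule member_le_sum) (auto simp: c_nonneg)
  then show "c r \<le> C r" by (simp add: C_def)
qed

lemma C_nonneg: "0 \<le> C r"
  using C_ge_1[of r] by simp

lemma K_nonneg: "0 \<le> K r"
  by (simp add: K_def C_nonneg)

lemma derivs_\<theta>: "derivs \<theta>"
  using derivs_\<Psi> unfolding derivs_def \<theta>_def
  by (auto intro!: derivative_eq_intros)

lemma \<theta>_right: "1 \<le> s \<Longrightarrow> \<theta> n s = 0"
  using \<Psi>_right \<Psi>_Suc_right by (cases n) (auto simp: \<theta>_def)

lemma \<theta>_left: "s \<le> 1 / 2 \<Longrightarrow> \<theta> n s = of_bool (n = 0)"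
  by (simp add: \<theta>_def \<Psi>_left)

lemma \<theta>_bound: "\<bar>\<theta> n s\<bar> \<le> C n"
proof -
  have "\<bar>\<theta> n s\<bar> \<le> 1 + c n" using \<Psi>_bound[of n s] by (auto simp: \<theta>_def)
  also have "c n \<le> (\<Sum>n\<le>n. c n)" by (rule member_le_sum) (auto simp: c_nonneg)
  finally show ?thesis by (simp add: C_def)
qed

lemma tower_link: "tower m (link u j)"
  unfolding link_def by (auto intro!: tower_mult tower_ridge derivs_\<Psi> derivs_\<Phi>)

lemma tower_chain: "tower m (chain u L)"
  using tower_cmult[OF tower_sum[of "{..<L}" m "link u"], of "- 1"]
  by (simp add: chain_def[abs_def] tower_link)

lemma tower_cut: "tower m (cut E R)"
  unfolding cut_def by (intro tower_comp derivs_\<theta> tower_cmult tower_quad)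

lemma tower_hump: "tower m (hump u L E R)"
  unfolding hump_def by (intro tower_mult tower_cut tower_chain)

lemma tower_block: "tower m (block u L E R)"
  unfolding block_def[abs_def] by (intro tower_add tower_hump tower_cmult tower_quad)

lemma ridge_bound:
  assumes "\<And>n t. \<bar>\<phi> n t\<bar> \<le> c n"
  shows "\<bar>ridge \<phi> e x vs\<bar> \<le> C (length vs) * (\<Prod>v\<leftarrow>vs. \<bar>v \<bullet> e\<bar>)"
proof -
  have "\<bar>\<Prod>v\<leftarrow>vs. v \<bullet> e\<bar> = (\<Prod>v\<leftarrow>vs. \<bar>v \<bullet> e\<bar>)" by (induction vs) (auto simp: abs_mult)
  then show ?thesis
    using order_trans[OF assms c_le_C] C_nonneg by (auto simp: ridge_def abs_mult intro!: mult_mono)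
qed

lemma link_bound:
  "\<bar>link u j x vs\<bar> \<le> 2 ^ length vs * (C (length vs))\<^sup>2 * (\<Prod>v\<leftarrow>vs. link_size u j v)"
  unfolding link_def
proof (rule tower_mult_bound[where a = C and b = C
      and f = "\<lambda>v. if j = 0 then 0 else \<bar>v \<bullet> u (j - 1)\<bar>" and g = "\<lambda>v. \<bar>v \<bullet> u j\<bar>"])
  fix us :: "'a list"
  \<comment> \<open>Link 0 has no predecessor; its constant factor has vanishing derivatives, so the
    gauge 0 is enough for it.\<close>
  show "\<bar>(if j = 0 then const_tower 1 else ridge \<Psi> (u (j - 1))) x us\<bar> \<le>
      C (length us) * (\<Prod>v\<leftarrow>us. if j = 0 then 0 else \<bar>v \<bullet> u (j - 1)\<bar>)"
    using ridge_bound[of \<Psi> "u (j - 1)" x us] \<Psi>_bound C_ge_1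
    by (cases us) (auto simp: const_tower_def)
  show "\<bar>ridge \<Phi> (u j) x us\<bar> \<le> C (length us) * (\<Prod>v\<leftarrow>us. \<bar>v \<bullet> u j\<bar>)"
    using \<Phi>_bound by (rule ridge_bound)
next
  fix m l assume "m + l = length vs"
  then show "C m * C l \<le> (C (length vs))\<^sup>2"
    unfolding power2_eq_square by (intro mult_mono C_mono C_nonneg) auto
qed (auto simp: C_nonneg link_size_def)

lemma chain_bound:
  assumes "orthonormal_seq u"
  shows "\<bar>chain u L x vs\<bar> \<le> 4 ^ length vs * (C (length vs))\<^sup>2 * weight L (length vs) * (\<Prod>v\<leftarrow>vs. norm v)"
proof -
  let ?A = "2 ^ length vs * (C (length vs))\<^sup>2"
  have "\<bar>chain u L x vs\<bar> \<le> (\<Sum>j<L. \<bar>link u j x vs\<bar>)"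
    by (simp add: chain_def)
  also have "\<dots> \<le> (\<Sum>j<L. ?A * (\<Prod>v\<leftarrow>vs. link_size u j v))"
    by (intro sum_mono link_bound)
  also have "\<dots> = ?A * (\<Sum>j<L. \<Prod>v\<leftarrow>vs. link_size u j v)" by (simp add: sum_distrib_left)
  also have "\<dots> \<le> ?A * (2 ^ length vs * weight L (length vs) * (\<Prod>v\<leftarrow>vs. norm v))"
    by (intro mult_left_mono sum_link_size assms) simp
  also have "\<dots> = (2 * 2) ^ length vs * (C (length vs))\<^sup>2 * weight L (length vs) * (\<Prod>v\<leftarrow>vs. norm v)"
    unfolding power_mult_distrib by (simp add: mult_ac)
  finally show ?thesis by simp
qed

text \<open>Outside the cutoff all derivatives vanish. Inside, \<open>quad / R\<^sup>2\<close> has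
  first derivative at most \<open>2 / R\<close>, second derivative at most
  \<open>2 / R\<^sup>2\<close> and no higher ones, so \<open>2 / R\<close> per direction is a valid
  gauge for Faa di Bruno.\<close>

lemma cut_bound:
  assumes E: "orthonormal E" "finite E" and R: "0 < R"
  shows "\<bar>cut E R x vs\<bar> \<le> (fact (length vs) * C (length vs) * (2 / R) ^ length vs) * (\<Prod>v\<leftarrow>vs. norm v)"
proof (cases "quad E x [] \<le> R\<^sup>2")
  case True
  have s: "sqrt (quad E x []) \<le> R" using True R by (simp add: real_le_lsqrt)
  have prod: "(\<Prod>v\<leftarrow>vs. 2 / R * norm v) = (2 / R) ^ length vs * (\<Prod>v\<leftarrow>vs. norm v)" for vs :: "'a list"
    by (induction vs) (auto simp: mult_ac)
  have "\<bar>cut E R x vs\<bar> \<le> fact (length vs) * C (length vs) * (\<Prod>v\<leftarrow>vs. 2 / R * norm v)"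
    unfolding cut_def
  proof (rule tower_comp_bound)
    fix n assume "n \<le> length vs"
    then show "\<bar>\<theta> n (1 / R\<^sup>2 * quad E x [])\<bar> \<le> C (length vs)"
      using \<theta>_bound C_mono order_trans by blast
  next
    fix B :: "'a list" assume "B \<noteq> []"
    then have "(\<exists>v. B = [v]) \<or> (\<exists>v w. B = [v, w]) \<or> 3 \<le> length B"
      by (cases B; cases "tl B"; cases "tl (tl B)") auto
    then consider v where "B = [v]" | v w where "B = [v, w]" | "3 \<le> length B" by blast
    then show "\<bar>1 / R\<^sup>2 * quad E x B\<bar> \<le> (\<Prod>v\<leftarrow>B. 2 / R * norm v)"
    proof cases
      case (1 v)
      have "1 / R\<^sup>2 * \<bar>quad E x [v]\<bar> \<le> 1 / R\<^sup>2 * (2 * R * norm v)"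
        using quad_bounds(2)[OF E, of x v] s
        by (intro mult_left_mono) (auto elim!: order_trans intro!: mult_right_mono)
      then show ?thesis using 1 R by (simp add: abs_mult power2_eq_square)
    next
      case (2 v w)
      have "1 / R\<^sup>2 * \<bar>quad E x [v, w]\<bar> \<le> 1 / R\<^sup>2 * (4 * (norm v * norm w))"
        using quad_bounds(3)[OF E, of x v w] by (intro mult_left_mono) (auto elim!: order_trans)
      then show ?thesis using 2 R by (simp add: abs_mult power2_eq_square mult_ac)
    next
      case 3
      have "0 \<le> (\<Prod>v\<leftarrow>B. 2 / R * norm v)" using R by (auto intro!: prod_list_nonneg)
      then show ?thesis using 3 by (simp add: quad_3)
    qed
  qed
  then show ?thesis unfolding prod by (simp add: mult.assoc)
next
  case False
  then have "\<theta> n (1 / R\<^sup>2 * quad E x []) = 0" for n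
    using R by (intro \<theta>_right) simp
  then have "cut E R x vs = 0" by (simp add: cut_def tower_comp_def)
  then show ?thesis using R by (auto intro!: mult_nonneg_nonneg prod_list_nonneg simp: C_nonneg)
qed

lemma weight_mono: "L \<le> T \<Longrightarrow> weight L r \<le> weight T r"
  by (simp add: weight_def)

text \<open>A radius of at least \<open>2 * T\<close> makes \<open>2 / R\<close> at most
  \<open>1 / T\<close>, the rate that \<open>weight_shift\<close> can absorb. The bound is stated
  with \<open>T\<close> instead of \<open>L\<close> so that it is uniform over all truncations of a
  chain.\<close>

lemma hump_bound:
  assumes E: "orthonormal E" "finite E" and u: "orthonormal_seq u"
    and T: "1 \<le> T" "L \<le> T" "2 * real T \<le> R"
  shows "\<bar>hump u L E R x vs\<bar> \<le> K (length vs) * weight T (length vs) * (\<Prod>v\<leftarrow>vs. norm v)"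
proof -
  have R: "0 < R" using T by linarith
  let ?r = "length vs"
  have "\<bar>hump u L E R x vs\<bar> \<le> 2 ^ ?r * (fact ?r * C ?r * (4 ^ ?r * (C ?r)\<^sup>2) * weight T ?r) * (\<Prod>v\<leftarrow>vs. norm v)"
    unfolding hump_def
  proof (rule tower_mult_bound[where f = norm and g = norm])
    fix us :: "'a list"
    show "\<bar>cut E R x us\<bar> \<le> fact (length us) * C (length us) * (2 / R) ^ length us * (\<Prod>v\<leftarrow>us. norm v)"
      by (rule cut_bound[OF E R])
    show "\<bar>chain u L x us\<bar> \<le> 4 ^ length us * (C (length us))\<^sup>2 * weight L (length us) * (\<Prod>v\<leftarrow>us. norm v)"
      by (rule chain_bound[OF u])
  next
    fix m l assume ml: "m + l = ?r"
    have "(2 / R) ^ m \<le> (1 / real T) ^ m"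
      using T R by (intro power_mono) (auto simp: field_simps)
    then have "(2 / R) ^ m * weight L l \<le> (1 / real T) ^ m * weight T l"
      using T by (intro mult_mono weight_mono weight_nonneg) auto
    also have "\<dots> \<le> weight T ?r" using weight_shift[OF T(1), of m l] ml by simp
    finally have w: "(2 / R) ^ m * weight L l \<le> weight T ?r" .
    have "fact m * C m * (2 / R) ^ m * (4 ^ l * (C l)\<^sup>2 * weight L l) =
        fact m * C m * (4 ^ l * (C l)\<^sup>2) * ((2 / R) ^ m * weight L l)" by (simp add: mult_ac)
    also have "\<dots> \<le> fact ?r * C ?r * (4 ^ ?r * (C ?r)\<^sup>2) * weight T ?r"
      using ml R w
      by (intro mult_mono C_mono fact_mono power_mono power_increasing)
        (auto simp: C_nonneg weight_nonneg)
    finally show "fact m * C m * (2 / R) ^ m * (4 ^ l * (C l)\<^sup>2 * weight L l) \<le>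
        fact ?r * C ?r * (4 ^ ?r * (C ?r)\<^sup>2) * weight T ?r" .
  qed (use R in \<open>auto simp: C_nonneg weight_nonneg\<close>)
  then show ?thesis by (simp add: K_def mult_ac)
qed

end

section \<open>Hidden links, large gradients and separation of different chains\<close>

context chain_functions
begin

lemma cut_outside:
  assumes "0 < R" "R\<^sup>2 \<le> quad E x []"
  shows "cut E R x vs = 0"
  using \<theta>_right[of "1 / R\<^sup>2 * quad E x []"] assms by (simp add: cut_def tower_comp_def)

lemma cut_inside:
  assumes "0 < R" "quad E x [] \<le> R\<^sup>2 / 2"
  shows "cut E R x [] = 1" "cut E R x [v] = 0"
  using \<theta>_left[of "1 / R\<^sup>2 * quad E x []"] assms
  by (simp_all add: cut_def tower_comp_def field_simps)

lemma link_0: "link u j x [] = (if j = 0 then 1 else \<Psi> 0 (x \<bullet> u (j - 1))) * \<Phi> 0 (x \<bullet> u j)"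
  by (simp add: link_def tower_mult_def const_tower_def ridge_def)

lemma link_1: "link u j x [v] =
    (if j = 0 then 0 else \<Psi> 1 (x \<bullet> u (j - 1)) * (v \<bullet> u (j - 1)) * \<Phi> 0 (x \<bullet> u j)) +
    (if j = 0 then 1 else \<Psi> 0 (x \<bullet> u (j - 1))) * \<Phi> 1 (x \<bullet> u j) * (v \<bullet> u j)"
  by (simp add: link_def tower_mult_def const_tower_def ridge_def)

lemma link_hidden:
  assumes "j \<noteq> 0" "x \<bullet> u (j - 1) \<le> 1 / 2"
  shows "link u j x vs = 0"
  using assms by (auto simp: link_def tower_mult_def ridge_def \<Psi>_left intro!: sum_list_0)

text \<open>Link \<open>j\<close> contains the factor \<Psi> of coordinate \<open>j - 1\<close>,
  which vanishes with all derivatives up to 1/2. Hence the links from \<open>L\<close> on disappear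
  once the coordinates from \<open>L - 1\<close> on are at most 1/2. Link 0 has no such factor,
  whence \<open>1 \<le> L\<close>.\<close>

lemma hump_trunc:
  assumes R: "0 < R" and L: "1 \<le> L" "L \<le> T"
    and x: "R\<^sup>2 \<le> quad E x [] \<or> (\<forall>j<T. L \<le> Suc j \<longrightarrow> x \<bullet> u j \<le> 1 / 2)"
  shows "hump u T E R x vs = hump u L E R x vs"
proof (cases "R\<^sup>2 \<le> quad E x []")
  case True
  then show ?thesis using cut_outside[OF R True] by (simp add: hump_def tower_mult_def)
next
  case False
  have "chain u T x ws = chain u L x ws" for ws
  proof -
    have "link u j x ws = 0" if "j \<in> {..<T} - {..<L}" for j
      using that x False L by (intro link_hidden) auto
    then have "(\<Sum>j<T. link u j x ws) = (\<Sum>j<L. link u j x ws)"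
      using L by (intro sum.mono_neutral_right) auto
    then show ?thesis by (simp add: chain_def)
  qed
  then show ?thesis by (simp add: hump_def tower_mult_def)
qed

lemma hump_cong:
  assumes "\<And>j. j < L \<Longrightarrow> u j = u' j"
  shows "hump u L E R = hump u' L E R"
proof -
  have "link u j = link u' j" if "j < L" for j
    using assms[of j] assms[of "j - 1"] that by (auto simp: link_def)
  then have "chain u L = chain u' L" by (simp add: chain_def fun_eq_iff)
  then show ?thesis by (simp add: hump_def)
qed

text \<open>Wherever \<open>quad\<close> is at least \<open>R\<^sup>2 / 2\<close> the bowl has slope
  at least \<open>R / 4 = K 1 * T + T\<close>, which exceeds the slope of the hump, at most
  \<open>K 1 * T\<close>, by \<open>T\<close>.\<close>

definition cut_radius :: "nat \<Rightarrow> real" where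
  "cut_radius T = 4 * (K 1 + 1) * real T"

lemma cut_radius:
  assumes "1 \<le> T"
  shows "2 * real T \<le> cut_radius T" "0 < cut_radius T"
proof -
  have "4 * (0 + 1) * real T \<le> cut_radius T"
    unfolding cut_radius_def using K_nonneg by (intro mult_right_mono mult_left_mono add_right_mono) auto
  then show "2 * real T \<le> cut_radius T" "0 < cut_radius T" using assms by auto
qed

text \<open>Far out the bowl dominates; where the cutoff is constantly 1, the first coordinate below
  1 gives a descent direction. The direction is taken in the span of \<open>E\<close> so that it is
  orthogonal to the pools of all other blocks.\<close>

lemma block_gradient:
  assumes E: "orthonormal E" "finite E" and u: "orthonormal_seq u" "\<And>j. j < T \<Longrightarrow> u j \<in> E"
    and T: "1 \<le> T"
    and x: "(cut_radius T)\<^sup>2 \<le> quad E x [] \<or> x \<bullet> u (T - 1) \<le> 1 / 2"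
  shows "\<exists>v. norm v \<le> 1 \<and> v \<in> span E \<and> 1 / 2 \<le> \<bar>block u T E (cut_radius T) x [v]\<bar>"
proof -
  define R where "R = cut_radius T"
  have R: "0 < R" "2 * real T \<le> R" using cut_radius[OF T] by (simp_all add: R_def)
  show ?thesis
  proof (cases "R\<^sup>2 / 2 \<le> quad E x []")
    case True
    define s where "s = sqrt (quad E x [])"
    have "(R / 2)\<^sup>2 \<le> quad E x []" using True quad_nonneg[of E x] by (simp add: power_divide)
    then have s: "R / 2 \<le> s" unfolding s_def by (rule real_le_rsqrt)
    then have s0: "0 < s" using R by linarith
    have ss: "s * s = quad E x []" using quad_nonneg[of E x] by (simp add: s_def)
    \<comment> \<open>The projection of \<open>x\<close>, normalised to \<open>v\<close>, is the
      radial direction, in which \<open>quad\<close> has the derivative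
      \<open>2 * s\<close>.\<close>
    define y where "y = (\<Sum>e\<in>E. (x \<bullet> e) *\<^sub>R e)"
    have ye: "y \<bullet> e = x \<bullet> e" if "e \<in> E" for e
    proof -
      have "y \<bullet> e = (\<Sum>d\<in>E. if d = e then x \<bullet> d else 0)"
        using E(1) that by (auto simp: y_def inner_sum_left orthonormal_def intro!: sum.cong)
      then show ?thesis using E(2) that by simp
    qed
    have "y \<bullet> y = quad E x []"
      by (subst (2) y_def) (simp add: inner_sum_right quad_0 ye power2_eq_square)
    then have ny: "norm y = s" by (simp add: s_def norm_eq_sqrt_inner)
    define v where "v = (1 / s) *\<^sub>R y"
    have v: "norm v = 1" using s0 ny by (simp add: v_def)
    have "v \<in> span E"
      unfolding v_def y_def by (intro span_scale span_sum span_base)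
    have "quad E x [v] = 2 * (\<Sum>e\<in>E. (1 / s) * (x \<bullet> e)\<^sup>2)"
      by (simp add: quad_1 v_def ye power2_eq_square)
    also have "\<dots> = 2 * (1 / s * (s * s))"
      unfolding sum_distrib_left[symmetric] ss quad_0 ..
    also have "\<dots> = 2 * s" using s0 by simp
    finally have q: "1 / 4 * quad E x [v] = s / 2" by simp
    have "\<bar>hump u T E R x [v]\<bar> \<le> K 1 * sqrt (real T)"
      using hump_bound[OF E u(1) T order_refl R(2), of x "[v]"] v by (simp add: weight_def)
    also have "\<dots> \<le> K 1 * real T"
      using T K_nonneg by (intro mult_left_mono) (auto simp: real_le_lsqrt power2_eq_square)
    finally have "\<bar>hump u T E R x [v]\<bar> \<le> K 1 * real T" .
    moreover have "R / 4 = K 1 * real T + real T" by (simp add: R_def cut_radius_def algebra_simps)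
    ultimately have "1 \<le> \<bar>block u T E R x [v]\<bar>"
      using q s T by (simp add: block_def)
    then show ?thesis using v \<open>v \<in> span E\<close> by (intro exI[of _ v]) (auto simp: R_def)
  next
    case False
    then have q: "quad E x [] \<le> R\<^sup>2 / 2" by simp
    have last: "x \<bullet> u (T - 1) < 1" using x False quad_nonneg[of E x] by (auto simp: R_def[symmetric])
    \<comment> \<open>The predecessor of the first coordinate below 1 is at least 1, so link
      \<open>j\<close> is fully switched on. All links have nonnegative derivative along
      \<open>u j\<close>, so nothing cancels its slope.\<close>
    define j where "j = (LEAST j. x \<bullet> u j < 1)"
    have j: "x \<bullet> u j < 1" "j \<le> T - 1"
      using last unfolding j_def by (auto intro: LeastI Least_le)
    have prev: "1 \<le> x \<bullet> u i" if "i < j" for i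
      using not_less_Least[of i "\<lambda>j. x \<bullet> u j < 1"] that by (simp add: j_def)
    have jT: "j < T" using j T by linarith
    let ?v = "u j"
    have uu: "u i \<bullet> u k = of_bool (i = k)" for i k by (rule orthonormal_seqD[OF u(1)])
    have nonneg: "0 \<le> link u i x [?v]" for i
      using \<Psi>_nonneg \<Psi>_mono \<Phi>_nonneg \<Phi>_mono by (auto simp: link_1 uu)
    have "\<Phi> 1 (x \<bullet> u j) \<le> link u j x [?v]"
      using prev[of "j - 1"] \<Psi>_right by (auto simp: link_1 uu)
    also have "\<dots> \<le> (\<Sum>i<T. link u i x [?v])"
      using jT nonneg by (intro member_le_sum) auto
    finally have "chain u T x [?v] \<le> - \<Phi> 1 (x \<bullet> u j)" by (simp add: chain_def)
    then have h: "hump u T E R x [?v] \<le> - \<Phi> 1 (x \<bullet> u j)"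
      using cut_inside[OF R(1) q] by (simp add: hump_def tower_mult_def)
    have "(\<Sum>e\<in>E. (x \<bullet> e) * (?v \<bullet> e)) = (\<Sum>e\<in>E. if e = ?v then x \<bullet> e else 0)"
      using E(1) u(2)[OF jT] by (auto simp: orthonormal_def intro!: sum.cong)
    also have "\<dots> = x \<bullet> ?v" using E(2) u(2)[OF jT] by simp
    finally have "quad E x [?v] = 2 * (x \<bullet> ?v)" by (simp add: quad_1)
    then have "block u T E R x [?v] \<le> - \<Phi> 1 (x \<bullet> u j) + (x \<bullet> u j) / 2"
      using h by (simp add: block_def)
    \<comment> \<open>On \<open>[- 1, 1)\<close> the ramp contributes at most -1 and the bowl less
      than 1/2; below -1 the bowl alone contributes less than -1/2.\<close>
    also have "\<dots> \<le> - 1 / 2"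
      using \<Phi>_steep[of "x \<bullet> u j"] \<Phi>_mono[of "x \<bullet> u j"] j(1) by (cases "- 1 \<le> x \<bullet> u j") auto
    finally have "1 / 2 \<le> \<bar>block u T E R x [?v]\<bar>" by linarith
    moreover have "norm ?v \<le> 1" using uu[of j j] by (simp add: norm_eq_sqrt_inner)
    ultimately show ?thesis using u(2)[OF jT] by (auto simp: R_def intro: span_base)
  qed
qed

text \<open>At the sum of the first \<open>j + 1\<close> directions, link \<open>j\<close> of
  \<open>u\<close> has reached \<Phi> at 1, while for \<open>u'\<close> it is still at 0 and all
  later links are off. This yields injectivity of the map from choices to functions.\<close>

lemma block_separates:
  assumes E: "orthonormal E" "finite E" and u: "orthonormal_seq u" "\<And>j. j < T \<Longrightarrow> u j \<in> E"
    and u': "orthonormal_seq u'" "\<And>i. i < T \<Longrightarrow> u' i \<bullet> u j = 0"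
    and j: "j < T" "\<And>i. i < j \<Longrightarrow> u i = u' i"
  shows "\<exists>z\<in>span E. block u T E (cut_radius T) z [] \<noteq> block u' T E (cut_radius T) z []"
proof -
  define R where "R = cut_radius T"
  have T: "1 \<le> T" using j by simp
  have R: "0 < R" "2 * real T \<le> R" using cut_radius[OF T] by (simp_all add: R_def)
  define z where "z = (\<Sum>l\<le>j. u l)"
  have zu: "z \<bullet> u i = of_bool (i \<le> j)" for i
  proof -
    have "z \<bullet> u i = (\<Sum>l\<le>j. if l = i then 1 else 0)"
      using orthonormal_seqD[OF u(1)] by (simp add: z_def inner_sum_left of_bool_def)
    then show ?thesis by simp
  qed
  have zu': "z \<bullet> u' i = of_bool (i < j)" if "i < T" for i
  proof (cases "i < j")
    case True
    then show ?thesis using zu[of i] j(2)[of i] by simp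
  next
    case False
    have "u l \<bullet> u' i = 0" if "l \<le> j" for l
      using j(2)[of l] orthonormal_seqD[OF u'(1), of l i] u'(2)[OF \<open>i < T\<close>] False that
      by (cases "l = j") (auto simp: inner_commute)
    then show ?thesis using False by (simp add: z_def inner_sum_left)
  qed
  have "z \<bullet> z = (\<Sum>l\<le>j. z \<bullet> u l)"
    by (subst (2) z_def) (simp add: inner_sum_right)
  also have "\<dots> = real (Suc j)" by (simp add: zu)
  finally have "(norm z)\<^sup>2 \<le> real T" using j(1) by (simp add: power2_norm_eq_inner)
  \<comment> \<open>The radius is at least \<open>2 * T\<close>, so the cutoff is 1 at
    \<open>z\<close> and the two chains are compared directly.\<close>
  also have "\<dots> \<le> R\<^sup>2 / 2"
  proof -
    have "real T * 1 \<le> real T * real T" using T by (intro mult_left_mono) auto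
    moreover have "(2 * real T)\<^sup>2 \<le> R\<^sup>2" using R T by (intro power_mono) auto
    ultimately show ?thesis by (simp add: power2_eq_square)
  qed
  finally have q: "quad E z [] \<le> R\<^sup>2 / 2" using quad_bounds(1)[OF E, of z] by linarith
  have \<Phi>: "\<Phi> 0 0 < \<Phi> 0 1"
  proof -
    obtain t where t: "0 < t" "t < 1" "\<Phi> 0 1 - \<Phi> 0 0 = (1 - 0) * \<Phi> 1 t"
      using MVT2[of 0 1 "\<Phi> 0" "\<Phi> 1"] derivs_\<Phi> by (auto simp: derivs_def)
    then show ?thesis using \<Phi>_steep[of t] by simp
  qed
  have "(\<Sum>i<T. link u' i z []) < (\<Sum>i<T. link u i z [])"
  proof (rule sum_strict_mono_ex1)
    show "\<forall>i\<in>{..<T}. link u' i z [] \<le> link u i z []"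
    proof
      fix i assume "i \<in> {..<T}"
      then have i: "i < T" "i - 1 < T" by auto
      consider "i < j" | "i = j" | "j < i" by linarith
      then show "link u' i z [] \<le> link u i z []"
      proof cases
        case 2
        then show ?thesis using \<Phi> zu zu'[OF i(1)] zu'[OF i(2)] \<Psi>_right[of 1] by (auto simp: link_0)
      next
        case 3
        then have "link u' i z [] = 0" using zu'[OF i(2)] by (simp add: link_0 \<Psi>_left)
        moreover have "0 \<le> link u i z []" using \<Psi>_nonneg \<Phi>_nonneg by (simp add: link_0)
        ultimately show ?thesis by simp
      qed (use zu zu'[OF i(1)] zu'[OF i(2)] in \<open>auto simp: link_0\<close>)
    qed
    have "link u' j z [] < link u j z []"
      using \<Phi> zu zu'[of j] zu'[of "j - 1"] j(1) \<Psi>_right[of 1] by (auto simp: link_0)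
    then show "\<exists>i\<in>{..<T}. link u' i z [] < link u i z []" using j(1) by blast
  qed simp
  then have "block u T E R z [] \<noteq> block u' T E R z []"
    using cut_inside(1)[OF R(1) q] by (simp add: block_def hump_def tower_mult_def chain_def)
  moreover have "z \<in> span E"
    unfolding z_def using j(1) by (intro span_sum span_base u(2)) auto
  ultimately show ?thesis by (auto simp: R_def)
qed

section \<open>Rescaled blocks\<close>

definition scaled_block where
  "scaled_block a p T u L E x vs =
     a / real T * ((real T powr (1 / (real p + 1))) ^ length vs *
       block u L E (cut_radius T) ((real T powr (1 / (real p + 1))) *\<^sub>R x) vs)"

text \<open>A majorant for the derivatives of the bowl at distance \<open>y\<close> from the origin.
  From order 2 on it no longer depends on the point.\<close>

definition bowl_size :: "nat \<Rightarrow> real \<Rightarrow> real" where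
  "bowl_size r y = (if r = 0 then y\<^sup>2 else if r = 1 then y else if r = 2 then 1 else 0)"

lemma tower_scaled_block: "tower m (scaled_block a p T u L E)"
  unfolding scaled_block_def by (intro tower_cmult tower_scale tower_block)

lemma scaled_block_lower:
  assumes E: "orthonormal E" "finite E" and u: "orthonormal_seq u"
    and T: "1 \<le> T" "L \<le> T" and a: "0 \<le> a"
  shows "- (a * K 0) \<le> scaled_block a p T u L E x []"
proof -
  let ?z = "(real T powr (1 / (real p + 1))) *\<^sub>R x"
  have "- (K 0 * real T) \<le> block u L E (cut_radius T) ?z []"
    using hump_bound[OF E u T cut_radius(1)[OF T(1)], of ?z "[]"] quad_nonneg[of E ?z]
    by (simp add: block_def weight_def)
  then have "a / real T * (- (K 0 * real T)) \<le> a / real T * block u L E (cut_radius T) ?z []"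
    using a by (intro mult_left_mono) auto
  then show ?thesis using T by (simp add: scaled_block_def)
qed

text \<open>With \<open>\<tau> ^ (p + 1) = T\<close> the prefactor \<open>a / T\<close> absorbs
  \<open>\<tau> ^ r * weight T r\<close> at every order up to \<open>p + 1\<close>. At order 1 this
  uses \<open>\<tau> \<le> sqrt T\<close>, which holds because \<open>p\<close> is at least
  1.\<close>

lemma scaled_block_bound:
  assumes E: "orthonormal E" "finite E" and u: "orthonormal_seq u"
    and T: "1 \<le> T" "L \<le> T" and a: "0 \<le> a" and p: "1 \<le> p" and r: "length vs \<le> Suc p"
  shows "\<bar>scaled_block a p T u L E x vs\<bar> \<le>
     a * (K (length vs) + bowl_size (length vs) (norm x)) * (\<Prod>v\<leftarrow>vs. norm v)"
proof -
  define \<tau> where "\<tau> = real T powr (1 / (real p + 1))"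
  define r where "r = length vs"
  define R where "R = cut_radius T"
  have T1: "1 \<le> real T" using T by simp
  have \<tau>1: "1 \<le> \<tau>" using T1 by (simp add: \<tau>_def ge_one_powr_ge_zero)
  have \<tau>p: "\<tau> ^ Suc p = real T"
  proof -
    have "\<tau> ^ Suc p = \<tau> powr real (Suc p)" using \<tau>1 by (subst powr_realpow) auto
    also have "\<dots> = real T powr (1 / (real p + 1) * real (Suc p))" by (simp add: \<tau>_def powr_powr)
    also have "1 / (real p + 1) * real (Suc p) = 1" by simp
    finally show ?thesis using T1 by simp
  qed
  have \<tau>r: "\<tau> ^ k \<le> real T" if "k \<le> Suc p" for k
    using power_increasing[OF that \<tau>1] \<tau>p by simp
  have \<tau>2: "\<tau>\<^sup>2 \<le> real T" using \<tau>r[of 2] p by simp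
  have \<tau>s: "\<tau> \<le> sqrt (real T)" using \<tau>2 by (rule real_le_rsqrt)
  have w: "\<tau> ^ r * weight T r \<le> real T"
  proof -
    consider "r = 0" | "r = 1" | "2 \<le> r" by linarith
    then show ?thesis
    proof cases
      case 2
      have "\<tau> * sqrt (real T) \<le> sqrt (real T) * sqrt (real T)" using \<tau>s by (intro mult_right_mono) auto
      then show ?thesis using 2 by (simp add: weight_def)
    qed (use \<tau>r[of r] r in \<open>auto simp: weight_def r_def\<close>)
  qed
  let ?P = "\<Prod>v\<leftarrow>vs. norm v"
  have P: "0 \<le> ?P" by (intro prod_list_nonneg) auto
  have "\<tau> ^ r * \<bar>hump u L E R (\<tau> *\<^sub>R x) vs\<bar> \<le> \<tau> ^ r * (K r * weight T r * ?P)"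
    unfolding r_def R_def using \<tau>1
    by (intro mult_left_mono hump_bound[OF E u T cut_radius(1)[OF T(1)]]) auto
  also have "\<dots> = (\<tau> ^ r * weight T r) * (K r * ?P)" by (simp add: mult_ac)
  also have "\<dots> \<le> real T * (K r * ?P)"
    using w P by (intro mult_right_mono) (auto simp: K_nonneg)
  finally have h: "\<tau> ^ r * \<bar>hump u L E R (\<tau> *\<^sub>R x) vs\<bar> \<le> real T * (K r * ?P)" .
  have b: "\<tau> ^ r * \<bar>1 / 4 * quad E (\<tau> *\<^sub>R x) vs\<bar> \<le> real T * (bowl_size r (norm x) * ?P)"
  proof -
    have "(\<exists>v. vs = [v]) \<or> (\<exists>v w. vs = [v, w]) \<or> vs = [] \<or> 3 \<le> length vs"
      by (cases vs; cases "tl vs"; cases "tl (tl vs)") auto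
    then consider "vs = []" | v where "vs = [v]" | v w where "vs = [v, w]" | "3 \<le> length vs"
      by blast
    then show ?thesis
    proof cases
      case 1
      have "\<bar>1 / 4 * quad E (\<tau> *\<^sub>R x) []\<bar> \<le> \<tau>\<^sup>2 * (norm x)\<^sup>2"
        using quad_bounds(1)[OF E, of "\<tau> *\<^sub>R x"] quad_nonneg[of E "\<tau> *\<^sub>R x"]
        by (simp add: power_mult_distrib)
      also have "\<dots> \<le> real T * (norm x)\<^sup>2" using \<tau>2 by (intro mult_right_mono) auto
      finally show ?thesis using 1 by (simp add: r_def bowl_size_def)
    next
      case (2 v)
      have "sqrt (quad E (\<tau> *\<^sub>R x) []) \<le> \<tau> * norm x"
        using quad_bounds(1)[OF E, of "\<tau> *\<^sub>R x"] \<tau>1 by (intro real_le_lsqrt) auto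
      then have "2 * sqrt (quad E (\<tau> *\<^sub>R x) []) * norm v \<le> 2 * (\<tau> * norm x) * norm v"
        by (intro mult_right_mono mult_left_mono) auto
      then have "\<bar>1 / 4 * quad E (\<tau> *\<^sub>R x) [v]\<bar> \<le> \<tau> * norm x * norm v"
        using quad_bounds(2)[OF E, of "\<tau> *\<^sub>R x" v] \<tau>1 by (simp add: abs_mult)
      then have "\<tau> * \<bar>1 / 4 * quad E (\<tau> *\<^sub>R x) [v]\<bar> \<le> \<tau> * (\<tau> * norm x * norm v)"
        using \<tau>1 by (intro mult_left_mono) auto
      also have "\<dots> = \<tau>\<^sup>2 * (norm x * norm v)" by (simp add: power2_eq_square mult_ac)
      also have "\<dots> \<le> real T * (norm x * norm v)" using \<tau>2 by (intro mult_right_mono) auto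
      finally show ?thesis using 2 by (simp add: r_def bowl_size_def)
    next
      case (3 v w)
      have "\<tau>\<^sup>2 * \<bar>1 / 4 * quad E (\<tau> *\<^sub>R x) [v, w]\<bar> \<le> real T * (norm v * norm w)"
        using quad_bounds(3)[OF E, of "\<tau> *\<^sub>R x" v w] \<tau>2 by (intro mult_mono) auto
      then show ?thesis using 3 by (simp add: r_def bowl_size_def numeral_2_eq_2)
    next
      case 4
      then show ?thesis using P by (simp add: quad_3 bowl_size_def r_def)
    qed
  qed
  have "\<bar>scaled_block a p T u L E x vs\<bar> = a / real T * (\<tau> ^ r * \<bar>block u L E R (\<tau> *\<^sub>R x) vs\<bar>)"
    using a \<tau>1 by (simp add: scaled_block_def abs_mult \<tau>_def r_def R_def)
  also have "\<dots> \<le> a / real T * (\<tau> ^ r * (\<bar>hump u L E R (\<tau> *\<^sub>R x) vs\<bar> + \<bar>1 / 4 * quad E (\<tau> *\<^sub>R x) vs\<bar>))"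
    unfolding block_def using a \<tau>1 by (intro mult_left_mono abs_triangle_ineq) auto
  also have "\<dots> \<le> a / real T * (real T * (K r * ?P) + real T * (bowl_size r (norm x) * ?P))"
    using h b a by (intro mult_left_mono) (auto simp: distrib_left)
  also have "\<dots> = a * (K r + bowl_size r (norm x)) * ?P"
    using T1 by (simp add: distrib_left distrib_right)
  finally show ?thesis by (simp add: r_def)
qed

end

section \<open>The hard functions\<close>

context chain_functions
begin

lemma block_orthogonal_direction:
  assumes "\<And>e. e \<in> E \<Longrightarrow> v \<bullet> e = 0" "\<And>j. v \<bullet> u j = 0"
  shows "block u L E R x [v] = 0"
proof -
  have q: "quad E x [v] = 0" using assms(1) by (simp add: quad_1)
  have "chain u L x [v] = 0" using assms(2) by (auto simp: chain_def link_1 intro!: sum.neutral)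
  then show ?thesis using q by (simp add: block_def hump_def tower_mult_def cut_def tower_comp_def)
qed

lemma block_orthogonal_point:
  assumes "\<And>j. z \<bullet> u j = 0" "\<And>j. z \<bullet> u' j = 0"
  shows "block u L E R z [] = block u' L E R z []"
proof -
  have "(\<Sum>j<L. link u j z []) = (\<Sum>j<L. link u' j z [])"
    using assms by (intro sum.cong) (auto simp: link_0)
  then show ?thesis by (simp add: block_def hump_def tower_mult_def chain_def)
qed

lemma block_cong:
  assumes "\<And>j. j < L \<Longrightarrow> u j = u' j"
  shows "block u L E R = block u' L E R"
proof -
  have "hump u L E R = hump u' L E R" using assms by (rule hump_cong)
  then show ?thesis by (simp add: block_def fun_eq_iff)
qed

end

text \<open>The indices of \<open>e\<close> are block, position in the chain and candidate in the
  pool of that position. The extra 1 in \<open>a_small\<close> pays for the bowl, and the powers of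
  1/2 sum to 1, the constant of the function class.\<close>

locale hard_functions = chain_functions +
  fixes e :: "nat \<Rightarrow> nat \<Rightarrow> nat \<Rightarrow> 'a::real_inner" and T N :: "nat \<Rightarrow> nat"
    and a :: "nat \<Rightarrow> real" and p :: nat
  assumes e_inner: "e k j i \<bullet> e k' j' i' = of_bool (k = k' \<and> j = j' \<and> i = i')"
    and T_pos: "1 \<le> T k" and p_pos: "1 \<le> p" and a_pos: "0 < a k"
    and a_small: "r \<le> Suc p \<Longrightarrow> a k * (K r + 1) \<le> (1 / 2) ^ Suc k"
begin

definition E :: "nat \<Rightarrow> 'a set" where
  "E k = (\<lambda>(j, i). e k j i) ` ({..<T k} \<times> {..<N k})"

definition dirs :: "(nat \<times> nat \<Rightarrow> nat) \<Rightarrow> nat \<Rightarrow> nat \<Rightarrow> 'a" where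
  "dirs \<omega> k j = e k j (\<omega> (k, j))"

definition scale :: "nat \<Rightarrow> real" where
  "scale k = real (T k) powr (1 / (real p + 1))"

definition summand :: "(nat \<Rightarrow> nat) \<Rightarrow> (nat \<times> nat \<Rightarrow> nat) \<Rightarrow> nat \<Rightarrow> 'a \<Rightarrow> 'a list \<Rightarrow> real" where
  "summand L \<omega> k = scaled_block (a k) p (T k) (dirs \<omega> k) (L k) (E k)"

text \<open>The function to be optimised is the case \<open>L = T\<close>. Smaller \<open>L\<close>
  truncate the chains and describe what is visible after a few queries.\<close>

definition hard_tower :: "(nat \<Rightarrow> nat) \<Rightarrow> (nat \<times> nat \<Rightarrow> nat) \<Rightarrow> 'a \<Rightarrow> 'a list \<Rightarrow> real" where
  "hard_tower L \<omega> x vs = (\<Sum>k. summand L \<omega> k x vs)"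

definition hard :: "(nat \<Rightarrow> nat) \<Rightarrow> (nat \<times> nat \<Rightarrow> nat) \<Rightarrow> 'a \<Rightarrow> real" where
  "hard L \<omega> x = hard_tower L \<omega> x []"

lemma summand_eq:
  "summand L \<omega> k x vs = a k / real (T k) * (scale k ^ length vs *
     block (dirs \<omega> k) (L k) (E k) (cut_radius (T k)) (scale k *\<^sub>R x) vs)"
  by (simp add: summand_def scaled_block_def scale_def)

lemma scale_pos: "0 < scale k"
  using T_pos[of k] by (simp add: scale_def)

lemma e_eq_iff: "e k j i = e k' j' i' \<longleftrightarrow> k = k' \<and> j = j' \<and> i = i'"
  using e_inner[of k j i k' j' i'] e_inner[of k' j' i' k' j' i'] by auto

lemma E_orthonormal: "orthonormal (E k)" and E_finite: "finite (E k)"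
  by (auto simp: E_def orthonormal_def e_inner e_eq_iff)

lemma e_in_E: "j < T k \<Longrightarrow> i < N k \<Longrightarrow> e k j i \<in> E k"
  by (auto simp: E_def)

lemma dirs_orthonormal: "orthonormal_seq (dirs \<omega> k)"
  by (auto simp: orthonormal_seq_def dirs_def e_inner)

lemma span_E_orthogonal:
  assumes "v \<in> span (E k)" "k' \<noteq> k"
  shows "v \<bullet> e k' j i = 0"
proof -
  have "orthogonal (e k' j i) v"
    by (rule orthogonal_to_span[OF assms(1)]) (use assms(2) in \<open>auto simp: orthogonal_def E_def e_inner\<close>)
  then show ?thesis by (simp add: orthogonal_def inner_commute)
qed

section \<open>Convergence of the series and membership in the function class\<close>

definition growth :: "real \<Rightarrow> real" where
  "growth R = 2 + R + R\<^sup>2"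

text \<open>The second alternative for \<open>\<kappa>\<close> covers the origin and all orders from
  2 on, where the bowl contributes at most 1. There the constant has to be exactly 1 to meet the
  bounds of the function class.\<close>

lemma summand_bound:
  assumes "L k \<le> T k" "length vs \<le> Suc p"
    and \<kappa>: "1 + bowl_size (length vs) (norm x) \<le> \<kappa> \<or> (bowl_size (length vs) (norm x) \<le> 1 \<and> \<kappa> = 1)"
  shows "\<bar>summand L \<omega> k x vs\<bar> \<le> (1 / 2) ^ Suc k * (\<kappa> * (\<Prod>v\<leftarrow>vs. norm v))"
proof -
  let ?b = "bowl_size (length vs) (norm x)" and ?P = "\<Prod>v\<leftarrow>vs. norm v" and ?K = "K (length vs)"
  have P: "0 \<le> ?P" by (intro prod_list_nonneg) auto
  have b: "0 \<le> ?b" by (simp add: bowl_size_def)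
  have \<kappa>1: "1 \<le> \<kappa>" using \<kappa> b by auto
  have "?K + ?b \<le> (?K + 1) * \<kappa>"
  proof (cases "\<kappa> = 1")
    case True
    then show ?thesis using \<kappa> b by auto
  next
    case False
    then have "1 + ?b \<le> \<kappa>" using \<kappa> by auto
    then have "(?K + 1) * (1 + ?b) \<le> (?K + 1) * \<kappa>" using K_nonneg[of "length vs"] by (intro mult_left_mono) auto
    moreover have "?K + ?b \<le> (?K + 1) * (1 + ?b)" using K_nonneg[of "length vs"] b by (simp add: algebra_simps)
    ultimately show ?thesis by linarith
  qed
  then have "a k * (?K + ?b) \<le> a k * (?K + 1) * \<kappa>"
    using a_pos[of k] by (simp add: mult.assoc)
  also have "\<dots> \<le> (1 / 2) ^ Suc k * \<kappa>"
    using a_small[OF assms(2)] \<kappa>1 by (intro mult_right_mono) auto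
  finally have "a k * (?K + ?b) * ?P \<le> (1 / 2) ^ Suc k * \<kappa> * ?P"
    using P by (rule mult_right_mono)
  with scaled_block_bound[OF E_orthonormal E_finite dirs_orthonormal T_pos assms(1) less_imp_le[OF a_pos] p_pos assms(2)]
  show ?thesis unfolding summand_def mult.assoc by (rule order_trans)
qed

lemma bowl_size_le: "norm x \<le> R \<Longrightarrow> 1 + bowl_size r (norm x) \<le> growth R"
proof -
  assume R: "norm x \<le> R"
  then have "(norm x)\<^sup>2 \<le> R\<^sup>2" by (intro power_mono) auto
  moreover have "0 \<le> R" using R norm_ge_zero[of x] by linarith
  moreover have "bowl_size r (norm x) \<in> {(norm x)\<^sup>2, norm x, 1, 0}" by (simp add: bowl_size_def)
  ultimately show ?thesis using R zero_le_power2[of R] unfolding growth_def by (elim insertE emptyE) linarith+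
qed

lemma half_sums: "(\<lambda>k. (1 / 2 :: real) ^ Suc k) sums 1"
  using power_half_series by simp

context
  fixes L :: "nat \<Rightarrow> nat"
  assumes L: "\<And>k. L k \<le> T k"
begin

lemma summable_summand:
  assumes "length vs \<le> Suc p"
  shows "summable (\<lambda>k. summand L \<omega> k x vs)"
proof (rule summable_comparison_test')
  show "summable (\<lambda>k. (1 / 2) ^ Suc k * (growth (norm x) * (\<Prod>v\<leftarrow>vs. norm v)))"
    using half_sums by (intro summable_mult2) (auto simp: sums_iff)
  show "norm (summand L \<omega> k x vs) \<le> (1 / 2) ^ Suc k * (growth (norm x) * (\<Prod>v\<leftarrow>vs. norm v))" for k
    using summand_bound[of L k vs x "growth (norm x)" \<omega>, OF L assms] bowl_size_le[of x "norm x"] by simp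
qed

lemma hard_tower_tail:
  assumes "length vs \<le> Suc p"
    and \<kappa>: "1 + bowl_size (length vs) (norm x) \<le> \<kappa> \<or> (bowl_size (length vs) (norm x) \<le> 1 \<and> \<kappa> = 1)"
  shows "\<bar>hard_tower L \<omega> x vs - (\<Sum>k<n. summand L \<omega> k x vs)\<bar> \<le> (1 / 2) ^ n * (\<kappa> * (\<Prod>v\<leftarrow>vs. norm v))"
proof -
  let ?P = "\<kappa> * (\<Prod>v\<leftarrow>vs. norm v)"
  let ?g = "\<lambda>k. (1 / 2) ^ n * ?P * (1 / 2) ^ Suc k"
  have g: "?g sums ((1 / 2) ^ n * ?P * 1)" by (rule sums_mult[OF half_sums])
  have s: "summable (\<lambda>k. summand L \<omega> (k + n) x vs)"
    using summable_summand[OF assms(1)] by (rule summable_ignore_initial_segment)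
  have le: "\<bar>summand L \<omega> (k + n) x vs\<bar> \<le> ?g k" for k
    using summand_bound[of L "k + n" vs x \<kappa> \<omega>, OF L assms(1) \<kappa>] by (simp add: power_add mult_ac)
  have sa: "summable (\<lambda>k. \<bar>summand L \<omega> (k + n) x vs\<bar>)"
    by (rule summable_comparison_test'[of ?g 0]) (use g le in \<open>auto simp: sums_iff\<close>)
  have "\<bar>hard_tower L \<omega> x vs - (\<Sum>k<n. summand L \<omega> k x vs)\<bar> = \<bar>\<Sum>k. summand L \<omega> (k + n) x vs\<bar>"
    unfolding hard_tower_def
    using suminf_minus_initial_segment[OF summable_summand[OF assms(1)], where k = n] by simp
  also have "\<dots> \<le> (\<Sum>k. \<bar>summand L \<omega> (k + n) x vs\<bar>)" by (rule summable_rabs[OF sa])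
  also have "\<dots> \<le> (\<Sum>k. ?g k)" using sa g le by (intro suminf_le) (auto simp: sums_iff)
  also have "\<dots> = (1 / 2) ^ n * ?P" using g by (simp add: sums_iff)
  finally show ?thesis .
qed

lemma hard_tower_bound:
  assumes "length vs \<le> Suc p"
    and "1 + bowl_size (length vs) (norm x) \<le> \<kappa> \<or> (bowl_size (length vs) (norm x) \<le> 1 \<and> \<kappa> = 1)"
  shows "\<bar>hard_tower L \<omega> x vs\<bar> \<le> \<kappa> * (\<Prod>v\<leftarrow>vs. norm v)"
  using hard_tower_tail[OF assms, of \<omega> 0] by simp

text \<open>Termwise differentiation is justified on a ball around \<open>x\<close>, where the
  geometric tail bounds make the differentiated series converge uniformly.\<close>

lemma tower_hard_tower: "tower (Suc p) (hard_tower L \<omega>)"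
  unfolding tower_def
proof (intro allI impI)
  fix vs :: "'a list" and x :: 'a assume vs: "length vs < Suc p"
  define R where "R = norm x + 1"
  define B where "B = growth R * (\<Prod>v\<leftarrow>vs. norm v)"
  have B: "0 \<le> B" by (auto simp: B_def growth_def R_def intro!: mult_nonneg_nonneg prod_list_nonneg)
  have tail: "\<bar>(\<Sum>k<n. summand L \<omega> k y ws) - hard_tower L \<omega> y ws\<bar> \<le> (1 / 2) ^ n * (growth R * (\<Prod>v\<leftarrow>ws. norm v))"
    if "y \<in> ball 0 R" "length ws \<le> Suc p" for y ws n
    using hard_tower_tail[OF that(2), of y "growth R" \<omega> n] bowl_size_le[of y R] that(1)
    by (simp add: abs_minus_commute)
  have ev: "\<forall>\<^sub>F n in sequentially. \<forall>y\<in>ball 0 R. \<forall>h.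
      norm ((\<Sum>k<n. summand L \<omega> k y (h # vs)) - hard_tower L \<omega> y (h # vs)) \<le> \<epsilon> * norm h"
    if "0 < \<epsilon>" for \<epsilon>
  proof -
    have "((\<lambda>n. (1 / 2 :: real) ^ n * B) \<longlonglongrightarrow> 0 * B)"
      by (intro tendsto_mult tendsto_const LIMSEQ_power_zero) auto
    then have "\<forall>\<^sub>F n in sequentially. (1 / 2) ^ n * B < \<epsilon>"
      using that by (auto dest: order_tendstoD)
    then show ?thesis
    proof eventually_elim
      case (elim n)
      show ?case
      proof (intro ballI allI)
        fix y h assume y: "y \<in> ball (0::'a) R"
        have "norm ((\<Sum>k<n. summand L \<omega> k y (h # vs)) - hard_tower L \<omega> y (h # vs)) \<le> (1 / 2) ^ n * B * norm h"
          using tail[OF y, of "h # vs" n] vs by (simp add: B_def mult_ac)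
        also have "\<dots> \<le> \<epsilon> * norm h" using elim by (intro mult_right_mono) auto
        finally show "norm ((\<Sum>k<n. summand L \<omega> k y (h # vs)) - hard_tower L \<omega> y (h # vs)) \<le> \<epsilon> * norm h" .
      qed
    qed
  qed
  have "\<exists>g. \<forall>y\<in>ball 0 R. (\<lambda>k. summand L \<omega> k y vs) sums g y \<and>
      (g has_derivative (\<lambda>v. hard_tower L \<omega> y (v # vs))) (at y within ball 0 R)"
  proof (rule has_derivative_series[where f' = "\<lambda>k y v. summand L \<omega> k y (v # vs)" and x = x])
    show "((\<lambda>y. summand L \<omega> k y vs) has_derivative (\<lambda>v. summand L \<omega> k y (v # vs))) (at y within ball 0 R)"
      for k y
      unfolding summand_def
      by (rule has_derivative_at_withinI[OF towerD[OF tower_scaled_block, of _ "Suc p"]]) (use vs in simp)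
    show "(\<lambda>k. summand L \<omega> k x vs) sums hard_tower L \<omega> x vs"
      unfolding hard_tower_def using vs by (intro summable_sums summable_summand) simp
  qed (use ev in \<open>auto simp: R_def\<close>)
  then obtain g where g: "\<And>y. y \<in> ball 0 R \<Longrightarrow> (\<lambda>k. summand L \<omega> k y vs) sums g y"
    "\<And>y. y \<in> ball 0 R \<Longrightarrow> (g has_derivative (\<lambda>v. hard_tower L \<omega> y (v # vs))) (at y within ball 0 R)"
    by blast
  have x: "x \<in> ball 0 R" by (simp add: R_def)
  have "(g has_derivative (\<lambda>v. hard_tower L \<omega> x (v # vs))) (at x)"
    using g(2)[OF x] at_within_open[OF x] by simp
  moreover have "hard_tower L \<omega> y vs = g y" if "y \<in> ball 0 R" for y
    using g(1)[OF that] by (simp add: hard_tower_def sums_iff)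
  ultimately show "((\<lambda>y. hard_tower L \<omega> y vs) has_derivative (\<lambda>v. hard_tower L \<omega> x (v # vs))) (at x)"
    by (rule_tac has_derivative_transform_within_open[OF _ open_ball x]) auto
qed

lemma hard_tower_local_bound:
  assumes "norm x \<le> R" "length vs \<le> Suc p"
  shows "\<bar>hard_tower L \<omega> x vs\<bar> \<le> growth R * (\<Prod>v\<leftarrow>vs. norm v)"
  using assms bowl_size_le by (intro hard_tower_bound) auto

lemma summand_cong:
  assumes "\<And>j. j < L k \<Longrightarrow> \<omega> (k, j) = \<omega>' (k, j)"
  shows "summand L \<omega> k = summand L \<omega>' k"
proof -
  have "block (dirs \<omega> k) (L k) (E k) R = block (dirs \<omega>' k) (L k) (E k) R" for R
    using assms by (intro block_cong) (simp add: dirs_def)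
  then show ?thesis by (simp add: summand_eq fun_eq_iff)
qed

lemma hard_tower_cong:
  assumes "\<And>k j. j < L k \<Longrightarrow> \<omega> (k, j) = \<omega>' (k, j)"
  shows "hard_tower L \<omega> = hard_tower L \<omega>'"
proof -
  have "summand L \<omega> k = summand L \<omega>' k" for k using assms by (intro summand_cong)
  then show ?thesis by (simp add: hard_tower_def fun_eq_iff)
qed

text \<open>The topology on the choices is the product of discrete ones. Finitely many choices
  determine the first \<open>n\<close> summands, and the remaining tails are uniformly small on a
  ball.\<close>

lemma hard_tower_continuous:
  assumes "0 < \<epsilon>"
  shows "\<exists>U. open U \<and> \<omega> \<in> U \<and> (\<forall>\<omega>'\<in>U. \<forall>x vs. norm x \<le> R \<longrightarrow> length vs \<le> p \<longrightarrow>
       \<bar>hard_tower L \<omega>' x vs - hard_tower L \<omega> x vs\<bar> \<le> \<epsilon> * (\<Prod>v\<leftarrow>vs. norm v))"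
proof -
  have "((\<lambda>n. (1 / 2 :: real) ^ n * (2 * growth R)) \<longlonglongrightarrow> 0 * (2 * growth R))"
    by (intro tendsto_mult tendsto_const LIMSEQ_power_zero) auto
  then have "\<forall>\<^sub>F n in sequentially. (1 / 2) ^ n * (2 * growth R) < \<epsilon>"
    using assms by (auto dest: order_tendstoD)
  then obtain n where n: "(1 / 2) ^ n * (2 * growth R) < \<epsilon>"
    by (auto simp: eventually_sequentially)
  \<comment> \<open>Exactly the choices that occur in the first \<open>n\<close> truncated chains
    are fixed.\<close>
  define U where "U = (\<Inter>c\<in>Sigma {..<n} (\<lambda>k. {..<L k}). {\<omega>'. \<omega>' c = \<omega> c})"
  have "open ((\<lambda>\<omega>' :: nat \<times> nat \<Rightarrow> nat. \<omega>' c) -` {\<omega> c})" for c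
    by (rule open_vimage[OF discrete_topology_class.open_discrete continuous_on_product_coordinates])
  then have "open U" unfolding U_def by (intro open_INT) (auto simp: vimage_def)
  moreover have "\<omega> \<in> U" by (simp add: U_def)
  moreover have "\<bar>hard_tower L \<omega>' x vs - hard_tower L \<omega> x vs\<bar> \<le> \<epsilon> * (\<Prod>v\<leftarrow>vs. norm v)"
    if \<omega>': "\<omega>' \<in> U" and x: "norm x \<le> R" and vs: "length vs \<le> p" for \<omega>' x vs
  proof -
    let ?P = "\<Prod>v\<leftarrow>vs. norm v"
    have P: "0 \<le> ?P" by (intro prod_list_nonneg) auto
    have tail: "\<bar>hard_tower L w x vs - (\<Sum>k<n. summand L w k x vs)\<bar> \<le> (1 / 2) ^ n * (growth R * ?P)" for w
      using hard_tower_tail[of vs x "growth R" w n] bowl_size_le[OF x] vs by simp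
    have "summand L \<omega>' k = summand L \<omega> k" if "k < n" for k
      using \<omega>' that by (intro summand_cong) (auto simp: U_def)
    then have eq: "(\<Sum>k<n. summand L \<omega>' k x vs) = (\<Sum>k<n. summand L \<omega> k x vs)" by simp
    have "\<bar>hard_tower L \<omega>' x vs - hard_tower L \<omega> x vs\<bar> \<le> (1 / 2) ^ n * (growth R * ?P) + (1 / 2) ^ n * (growth R * ?P)"
      using tail[of \<omega>'] tail[of \<omega>] eq by linarith
    also have "\<dots> = (1 / 2) ^ n * (2 * growth R) * ?P" by simp
    also have "\<dots> \<le> \<epsilon> * ?P" using n P by (intro mult_right_mono) auto
    finally show ?thesis .
  qed
  ultimately show ?thesis by blast
qed

lemma continuous_map_nderiv_hard:
  assumes "r \<le> p"
  shows "continuous_map euclidean (form_topology r) (\<lambda>z. nderiv r (hard L (snd z)) (fst z))"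
  using continuous_map_nderiv[OF tower_hard_tower hard_tower_local_bound hard_tower_continuous assms]
  by (simp add: hard_def[abs_def])

lemma nderiv_hard:
  assumes "r \<le> p"
  shows "nderiv r (hard L \<omega>) x = (\<lambda>vs. if length vs = r then hard_tower L \<omega> x vs else 0)"
  unfolding hard_def[abs_def] using assms by (intro nderiv_tower[OF tower_hard_tower]) simp

lemma hard_in_class: "hard L \<omega> \<in> ncvx_class p"
proof -
  have "cont_diff p (hard L \<omega>)"
    unfolding hard_def[abs_def] by (rule cont_diff_tower[OF tower_hard_tower hard_tower_local_bound])
  moreover have "form_norm p (\<lambda>vs. nderiv p (hard L \<omega>) x vs - nderiv p (hard L \<omega>) y vs) \<le> norm (x - y)" for x y
  proof (rule form_norm_le(2))
    fix vs :: "'a list" assume vs: "length vs = p"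
    have "\<bar>hard_tower L \<omega> x vs - hard_tower L \<omega> y vs\<bar> \<le> (\<Prod>v\<leftarrow>vs. norm v) * norm (x - y)"
    proof (rule tower_lipschitz[OF tower_hard_tower, where S = UNIV])
      fix z v :: 'a
      \<comment> \<open>The derivative of order \<open>p + 1 \<ge> 2\<close> does not feel the
        growth of the bowl, so it is bounded by 1 on the whole space.\<close>
      show "\<bar>hard_tower L \<omega> z (v # vs)\<bar> \<le> (\<Prod>v\<leftarrow>vs. norm v) * norm v"
        using hard_tower_bound[of "v # vs" z 1 \<omega>] vs p_pos by (simp add: bowl_size_def mult.commute)
    qed (use vs in \<open>auto intro!: prod_list_nonneg\<close>)
    then show "\<bar>nderiv p (hard L \<omega>) x vs - nderiv p (hard L \<omega>) y vs\<bar> \<le> norm (x - y) * (\<Prod>v\<leftarrow>vs. norm v)"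
      using vs by (simp add: nderiv_hard mult.commute)
  qed simp
  moreover have "- 1 \<le> hard L \<omega> x" for x
  proof -
    \<comment> \<open>The bowls are nonnegative, so only the humps lower the value, and these lower
      bounds sum to -1.\<close>
    have "- ((1 / 2) ^ Suc k) \<le> summand L \<omega> k x []" for k
    proof -
      have "a k * K 0 \<le> (1 / 2) ^ Suc k"
        using a_small[of 0 k] a_pos[of k] by (simp add: distrib_left)
      then show ?thesis
        using scaled_block_lower[OF E_orthonormal[of k] E_finite dirs_orthonormal[of \<omega> k] T_pos[of k] L
            less_imp_le[OF a_pos[of k]], where p = p and x = x]
        unfolding summand_def by linarith
    qed
    then have "(\<Sum>k. - ((1 / 2 :: real) ^ Suc k)) \<le> hard L \<omega> x"
      unfolding hard_def hard_tower_def using sums_minus[OF half_sums] summable_summand[of "[]"]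
      by (intro suminf_le) (auto simp: sums_iff)
    moreover have "(\<Sum>k. - ((1 / 2 :: real) ^ Suc k)) = - 1"
      using sums_minus[OF half_sums] by (simp add: sums_iff)
    ultimately show ?thesis by simp
  qed
  moreover have zero: "\<bar>hard_tower L \<omega> 0 vs\<bar> \<le> 1 * (\<Prod>v\<leftarrow>vs. norm v)" if "length vs \<le> p" for vs
    using that by (intro hard_tower_bound) (auto simp: bowl_size_def)
  moreover have "form_norm r (nderiv r (hard L \<omega>) 0) \<le> 1" if "r \<in> {1..p}" for r
    using zero that by (intro form_norm_le(2)) (auto simp: nderiv_hard)
  moreover have "hard L \<omega> 0 \<le> 1"
    using zero[of "[]"] by (simp add: hard_def)
  ultimately show ?thesis
    unfolding ncvx_class_def by (auto simp: le_INF_iff one_ereal_def intro: INF_lower)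
qed

end

section \<open>Gradient, hidden links and injectivity for the whole series\<close>

lemma hard_gradient:
  assumes dirs: "\<And>j. j < T k \<Longrightarrow> \<omega> (k, j) < N k"
    and x: "(cut_radius (T k))\<^sup>2 \<le> quad (E k) (scale k *\<^sub>R x) [] \<or>
      scale k *\<^sub>R x \<bullet> dirs \<omega> k (T k - 1) \<le> 1 / 2"
  shows "a k / real (T k) * (scale k / 2) \<le> form_norm 1 (nderiv 1 (hard T \<omega>) x)"
proof -
  have "\<exists>v. norm v \<le> 1 \<and> v \<in> span (E k) \<and>
      1 / 2 \<le> \<bar>block (dirs \<omega> k) (T k) (E k) (cut_radius (T k)) (scale k *\<^sub>R x) [v]\<bar>"
    using dirs x by (intro block_gradient E_orthonormal E_finite dirs_orthonormal T_pos) (auto simp: dirs_def e_in_E)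
  then obtain v where v: "norm v \<le> 1" "v \<in> span (E k)"
    and b: "1 / 2 \<le> \<bar>block (dirs \<omega> k) (T k) (E k) (cut_radius (T k)) (scale k *\<^sub>R x) [v]\<bar>" by blast
  \<comment> \<open>The test direction is orthogonal to all other pools, so the gradient of block
    \<open>k\<close> cannot be cancelled by another block.\<close>
  have "summand T \<omega> k' x [v] = 0" if "k' \<noteq> k" for k'
    using span_E_orthogonal[OF v(2) that]
    by (subst summand_eq, subst block_orthogonal_direction) (auto simp: E_def dirs_def)
  then have "hard_tower T \<omega> x [v] = (\<Sum>k'\<in>{k}. summand T \<omega> k' x [v])"
    unfolding hard_tower_def by (intro suminf_finite) auto
  then have "\<bar>hard_tower T \<omega> x [v]\<bar> = a k / real (T k) *
      (scale k * \<bar>block (dirs \<omega> k) (T k) (E k) (cut_radius (T k)) (scale k *\<^sub>R x) [v]\<bar>)"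
    using a_pos[of k] scale_pos[of k] by (simp add: summand_eq abs_mult)
  moreover have "a k / real (T k) * (scale k * (1 / 2)) \<le> a k / real (T k) *
      (scale k * \<bar>block (dirs \<omega> k) (T k) (E k) (cut_radius (T k)) (scale k *\<^sub>R x) [v]\<bar>)"
    using b a_pos[of k] scale_pos[of k] by (intro mult_left_mono) auto
  moreover have "\<bar>hard_tower T \<omega> x [v]\<bar> \<le> form_norm 1 (nderiv 1 (hard T \<omega>) x)"
  proof -
    have "bdd_above ((\<lambda>vs. \<bar>nderiv 1 (hard T \<omega>) x vs\<bar>) ` {vs. length vs = 1 \<and> (\<forall>v\<in>set vs. norm v \<le> 1)})"
    proof (rule bdd_aboveI2)
      fix vs :: "'a list" assume vs: "vs \<in> {vs. length vs = 1 \<and> (\<forall>v\<in>set vs. norm v \<le> 1)}"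
      have "\<bar>hard_tower T \<omega> x vs\<bar> \<le> growth (norm x) * (\<Prod>v\<leftarrow>vs. norm v)"
        using vs by (intro hard_tower_local_bound) auto
      also have "\<dots> \<le> growth (norm x) * 1"
        using vs prod_norm_le_1[of vs] by (intro mult_left_mono) (auto simp: growth_def)
      finally show "\<bar>nderiv 1 (hard T \<omega>) x vs\<bar> \<le> growth (norm x)"
        using vs p_pos by (simp add: nderiv_hard del: nderiv.simps One_nat_def)
    qed
    from cSUP_upper[OF _ this, of "[v]"] v show ?thesis
      unfolding form_norm_def using p_pos by (simp add: nderiv_hard del: nderiv.simps One_nat_def)
  qed
  ultimately show ?thesis by simp
qed

text \<open>At a query that detects no link from \<open>t - 1\<close> on, the full function and the
  one truncated to \<open>t\<close> links give the same answer, derivatives included.\<close>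

lemma hard_tower_hidden:
  assumes "1 \<le> t" "t \<le> T k"
    and "(cut_radius (T k))\<^sup>2 \<le> quad (E k) (scale k *\<^sub>R x) [] \<or>
      (\<forall>j<T k. t \<le> Suc j \<longrightarrow> scale k *\<^sub>R x \<bullet> dirs \<omega> k j \<le> 1 / 2)"
  shows "hard_tower T \<omega> x = hard_tower (T(k := t)) \<omega> x"
proof
  fix vs
  have "summand T \<omega> k' x vs = summand (T(k := t)) \<omega> k' x vs" for k'
    using hump_trunc[OF cut_radius(2)[OF T_pos] assms]
    by (cases "k' = k") (simp_all add: summand_eq block_def)
  then show "hard_tower T \<omega> x vs = hard_tower (T(k := t)) \<omega> x vs" by (simp add: hard_tower_def)
qed

text \<open>Positions beyond the end of a chain do not influence the function; a single option there
  keeps the map from choices to functions injective.\<close>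

definition options :: "nat \<times> nat \<Rightarrow> nat set" where
  "options = (\<lambda>(k, j). if j < T k then {..<N k} else {0})"

text \<open>The first difference in some chain separates the functions at a point in the span of
  that block's pool, where all other blocks agree because their coordinates vanish.\<close>

lemma hard_inj: "inj_on (hard T) (Pi UNIV options)"
proof (rule inj_onI, rule ccontr)
  fix \<omega> \<omega>' assume \<omega>: "\<omega> \<in> Pi UNIV options" "\<omega>' \<in> Pi UNIV options"
    and eq: "hard T \<omega> = hard T \<omega>'" and "\<omega> \<noteq> \<omega>'"
  then obtain k j0 where "\<omega> (k, j0) \<noteq> \<omega>' (k, j0)" by (auto simp: fun_eq_iff)
  define j where "j = (LEAST j. \<omega> (k, j) \<noteq> \<omega>' (k, j))"
  have j: "\<omega> (k, j) \<noteq> \<omega>' (k, j)" unfolding j_def using \<open>\<omega> (k, j0) \<noteq> \<omega>' (k, j0)\<close> by (rule LeastI)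
  have before: "\<omega> (k, i) = \<omega>' (k, i)" if "i < j" for i
    using that not_less_Least unfolding j_def by blast
  have mem: "\<omega> c \<in> options c" "\<omega>' c \<in> options c" for c using \<omega> by auto
  have jT: "j < T k"
    using j mem[of "(k, j)"] by (auto simp: options_def split: if_splits)
  have "\<exists>z\<in>span (E k). block (dirs \<omega> k) (T k) (E k) (cut_radius (T k)) z [] \<noteq>
      block (dirs \<omega>' k) (T k) (E k) (cut_radius (T k)) z []"
  proof (rule block_separates[OF E_orthonormal E_finite dirs_orthonormal _ dirs_orthonormal _ jT])
    show "dirs \<omega> k i \<in> E k" if "i < T k" for i
      using mem(1)[of "(k, i)"] that by (auto simp: dirs_def options_def intro: e_in_E)
    show "dirs \<omega>' k i \<bullet> dirs \<omega> k j = 0" for i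
      using j by (auto simp: dirs_def e_inner)
    show "dirs \<omega> k i = dirs \<omega>' k i" if "i < j" for i
      using before[OF that] by (simp add: dirs_def)
  qed
  then obtain z where z: "z \<in> span (E k)" and neq: "block (dirs \<omega> k) (T k) (E k) (cut_radius (T k)) z [] \<noteq>
      block (dirs \<omega>' k) (T k) (E k) (cut_radius (T k)) z []" by blast
  define x where "x = (1 / scale k) *\<^sub>R z"
  have xz: "scale k *\<^sub>R x = z" using scale_pos[of k] by (simp add: x_def)
  have same: "summand T \<omega> k' x [] - summand T \<omega>' k' x [] = 0" if "k' \<noteq> k" for k'
  proof -
    have "z \<bullet> dirs w k' i = 0" for w i
      using span_E_orthogonal[OF z that] by (simp add: dirs_def)
    then have "block (dirs \<omega> k') (T k') (E k') R (scale k' *\<^sub>R x) [] =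
        block (dirs \<omega>' k') (T k') (E k') R (scale k' *\<^sub>R x) []" for R
      by (intro block_orthogonal_point) (simp_all add: x_def)
    then show ?thesis by (simp add: summand_eq)
  qed
  have "hard T \<omega> x - hard T \<omega>' x = (\<Sum>k'. summand T \<omega> k' x [] - summand T \<omega>' k' x [])"
    unfolding hard_def hard_tower_def by (intro suminf_diff summable_summand) auto
  also have "\<dots> = (\<Sum>k'\<in>{k}. summand T \<omega> k' x [] - summand T \<omega>' k' x [])"
    using same by (intro suminf_finite) auto
  also have "\<dots> = a k / real (T k) * (block (dirs \<omega> k) (T k) (E k) (cut_radius (T k)) z [] -
      block (dirs \<omega>' k) (T k) (E k) (cut_radius (T k)) z [])"
    by (simp add: summand_eq xz algebra_simps)
  also have "\<dots> \<noteq> 0" using neq a_pos[of k] T_pos[of k] by auto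
  finally show False using eq by simp
qed

end

section \<open>Runs of an algorithm\<close>

lemma measurable_borel_of:
  assumes h: "continuous_map euclidean X h" and Z: "Z \<in> borel_measurable M"
  shows "(\<lambda>x. h (Z x)) \<in> measurable M (borel_of X)"
  unfolding borel_of_def
proof (rule measurable_measure_of)
  show "{U. openin X U} \<subseteq> Pow (topspace X)" using openin_subset by blast
  show "(\<lambda>x. h (Z x)) \<in> space M \<rightarrow> topspace X"
    using h by (auto simp: continuous_map_def)
  fix U assume "U \<in> {U. openin X U}"
  then have "openin euclidean {z \<in> topspace euclidean. h z \<in> U}"
    using h by (auto simp: continuous_map_def)
  then have "open {z. h z \<in> U}" by simp
  then have "Z -` {z. h z \<in> U} \<inter> space M \<in> sets M"
    by (intro measurable_sets[OF Z]) auto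
  then show "(\<lambda>x. h (Z x)) -` U \<inter> space M \<in> sets M" by (simp add: vimage_def)
qed

text \<open>Unlike in \<open>iterate\<close>, the function that answers may change with the query
  number. This admits runs answered by truncated functions.\<close>

fun run :: "'a::real_normed_vector algorithm \<Rightarrow> nat \<Rightarrow> (nat \<Rightarrow> 'a \<Rightarrow> real) \<Rightarrow> real \<Rightarrow> nat \<Rightarrow> 'a" where
  "run A p F \<xi> t =
     A t \<xi> (\<lambda>s. if 1 \<le> s \<and> s < t then jet p (F s) (run A p F \<xi> s) else undefined)"

declare run.simps [simp del]

lemma run_cong:
  assumes "\<And>s. 1 \<le> s \<Longrightarrow> s < t \<Longrightarrow> jet p (F s) (run A p F \<xi> s) = jet p (F' s) (run A p F \<xi> s)"
  shows "run A p F \<xi> t = run A p F' \<xi> t"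
  using assms
proof (induction t rule: less_induct)
  case (less t)
  have "(\<lambda>s. if 1 \<le> s \<and> s < t then jet p (F s) (run A p F \<xi> s) else undefined) =
      (\<lambda>s. if 1 \<le> s \<and> s < t then jet p (F' s) (run A p F' \<xi> s) else undefined)"
  proof
    fix s
    show "(if 1 \<le> s \<and> s < t then jet p (F s) (run A p F \<xi> s) else undefined) =
      (if 1 \<le> s \<and> s < t then jet p (F' s) (run A p F' \<xi> s) else undefined)"
    proof (cases "1 \<le> s \<and> s < t")
      case True
      then have "run A p F \<xi> s = run A p F' \<xi> s" using less.prems by (intro less.IH) auto
      moreover have "jet p (F s) (run A p F \<xi> s) = jet p (F' s) (run A p F \<xi> s)"
        using True by (intro less.prems) auto
      ultimately show ?thesis by simp
    qed auto
  qed
  then show ?case by (subst (1 2) run.simps) simp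
qed

lemma iterate_eq_run: "iterate A p f \<xi> t = run A p (\<lambda>_. f) \<xi> t"
proof (induction t rule: less_induct)
  case (less t)
  then have "(\<lambda>s. if 1 \<le> s \<and> s < t then jet p f (iterate A p f \<xi> s) else undefined) =
      (\<lambda>s. if 1 \<le> s \<and> s < t then jet p f (run A p (\<lambda>_. f) \<xi> s) else undefined)"
    by auto
  then show ?case by (subst run.simps, subst iterate.simps) simp
qed

text \<open>By induction the earlier iterates are measurable, and the history is a continuous
  function of them and of the parameter. Its domain is second countable, so measurability of the
  components gives Borel measurability; the continuous map carries this over to the history
  topology, whose factors may be nonseparable.\<close>

lemma run_measurable:
  fixes F :: "nat \<Rightarrow> 'w::second_countable_topology \<Rightarrow> 'a::{real_normed_vector, second_countable_topology} \<Rightarrow> real"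
  assumes A: "A \<in> rand_algorithms p"
    and F: "\<And>s r. r \<le> p \<Longrightarrow>
      continuous_map euclidean (form_topology r) (\<lambda>z. nderiv r (F s (snd z)) (fst z))"
    and g: "g \<in> borel_measurable M" and t: "1 \<le> t"
  shows "(\<lambda>x. run A p (\<lambda>s. F s (g (snd x))) (fst x) t) \<in> borel_measurable (seed \<Otimes>\<^sub>M M)"
  using t
proof (induction t rule: less_induct)
  case (less t)
  define run' where "run' x s = run A p (\<lambda>s. F s (g (snd x))) (fst x) s" for x s
  \<comment> \<open>The default 0 makes \<open>Y\<close> a sequence with a measurable value in every
    coordinate; \<open>h\<close> ignores the coordinates outside the range.\<close>
  define Y where "Y x s = (if 1 \<le> s \<and> s < t then run' x s else 0)" for x s
  define h where "h z = (\<lambda>s. if 1 \<le> s \<and> s < t then jet p (F s (snd z)) (fst z s) else undefined)"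
    for z :: "(nat \<Rightarrow> 'a) \<times> 'w"
  have "(\<lambda>x. Y x s) \<in> borel_measurable (seed \<Otimes>\<^sub>M M)" for s
  proof (cases "1 \<le> s \<and> s < t")
    case True
    then show ?thesis using less.IH[of s] by (simp add: Y_def run'_def)
  next
    case False
    then have "(\<lambda>x. Y x s) = (\<lambda>_. 0)" by (auto simp: Y_def)
    then show ?thesis by simp
  qed
  then have Y: "Y \<in> borel_measurable (seed \<Otimes>\<^sub>M M)"
    by (rule measurable_coordinatewise_then_product)
  have "(\<lambda>x. g (snd x)) \<in> borel_measurable (seed \<Otimes>\<^sub>M M)"
    using g by (rule measurable_compose[OF measurable_snd])
  with Y have Z: "(\<lambda>x. (Y x, g (snd x))) \<in> borel_measurable (seed \<Otimes>\<^sub>M M)"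
    by (rule borel_measurable_Pair)
  have h: "continuous_map euclidean (history_topology p t) h"
    unfolding history_topology_def
  proof (rule continuous_map_coordinatewise_then_product)
    fix s assume s: "s \<in> {1..<t}"
    show "continuous_map euclidean (product_topology form_topology {..p}) (\<lambda>z. h z s)"
    proof (rule continuous_map_coordinatewise_then_product)
      fix r assume r: "r \<in> {..p}"
      have "continuous_map euclidean (form_topology r)
          ((\<lambda>z. nderiv r (F s (snd z)) (fst z)) \<circ> (\<lambda>z::(nat \<Rightarrow> 'a) \<times> 'w. (fst z s, snd z)))"
      proof (rule continuous_map_compose)
        have "continuous_on UNIV (\<lambda>z::(nat \<Rightarrow> 'a) \<times> 'w. fst z s)"
          by (rule continuous_on_product_then_coordinatewise) (intro continuous_intros)
        then show "continuous_map euclidean euclidean (\<lambda>z::(nat \<Rightarrow> 'a) \<times> 'w. (fst z s, snd z))"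
          by (auto intro!: continuous_intros)
      qed (use F r in auto)
      then show "continuous_map euclidean (form_topology r) (\<lambda>z. h z s r)"
        using s r by (simp add: h_def jet_def comp_def)
    qed (use s in \<open>auto simp: h_def jet_def\<close>)
  qed (auto simp: h_def)
  have hist: "(\<lambda>x. h (Y x, g (snd x))) \<in> measurable (seed \<Otimes>\<^sub>M M) (borel_of (history_topology p t))"
    by (rule measurable_borel_of[OF h Z])
  have "(\<lambda>(\<xi>, h). A t \<xi> h) \<in> seed \<Otimes>\<^sub>M borel_of (history_topology p t) \<rightarrow>\<^sub>M borel"
    using A less.prems by (simp add: rand_algorithms_def)
  from measurable_compose[OF measurable_Pair[OF measurable_fst hist] this]
  have "(\<lambda>x. A t (fst x) (h (Y x, g (snd x)))) \<in> borel_measurable (seed \<Otimes>\<^sub>M M)" by simp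
  moreover have "h (Y x, g (snd x)) =
      (\<lambda>s. if 1 \<le> s \<and> s < t then jet p (F s (g (snd x))) (run A p (\<lambda>s. F s (g (snd x))) (fst x) s) else undefined)" for x
    by (auto simp: h_def Y_def run'_def)
  ultimately show ?case by (subst run.simps) simp
qed

text \<open>The norm is the distance to the zero form.\<close>

lemma form_norm_continuous:
  assumes "continuous_map euclidean (form_topology r) (\<lambda>z::'z::topological_space. G z)"
    and G: "\<And>z. G z \<in> forms r"
  shows "continuous_on UNIV (\<lambda>z. form_norm r (G z))"
proof -
  interpret M: Metric_space "forms r :: ('a::real_normed_vector list \<Rightarrow> real) set" "form_dist r"
    by (rule Metric_space_forms)
  have zero: "(\<lambda>_. 0) \<in> forms r"
    by (auto simp: forms_def linear_zero intro!: exI[of _ 0])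
  have "continuous_map euclidean euclidean (\<lambda>z. form_dist r (G z) (\<lambda>_. 0))"
    using continuous_map_mdist[of euclidean "metric (forms r, form_dist r)" G "\<lambda>_. \<lambda>_. 0"] assms zero
    by (simp add: form_topology_def)
  moreover have "form_dist r (G z) (\<lambda>_. 0) = form_norm r (G z)" for z
  proof -
    obtain B where B: "\<And>vs. length vs = r \<Longrightarrow> \<bar>G z vs\<bar> \<le> B * prod_list (map norm vs)"
      using G[of z] unfolding forms_def by blast
    have "\<bar>G z vs\<bar> \<le> max 0 B * prod_list (map norm vs)" if "length vs = r" for vs
      by (rule order_trans[OF B[OF that]]) (auto intro!: mult_right_mono prod_list_nonneg)
    then have "0 \<le> form_norm r (G z)" by (rule form_norm_le) auto
    then show ?thesis by (simp add: form_dist_def)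
  qed
  ultimately show ?thesis by simp
qed

section \<open>The random choice of the directions\<close>

text \<open>\<open>N_large\<close> is a union bound: there are at most \<open>(T k)\<^sup>2\<close>
  pairs of a query and a hidden link, and each is guessed with probability at most
  \<open>4 * R\<^sup>2 / N\<close>.\<close>

locale hard_distribution = hard_functions \<Psi> \<Phi> c e T N a p
  for \<Psi> \<Phi> c and e :: "nat \<Rightarrow> nat \<Rightarrow> nat \<Rightarrow> 'a::{real_inner, polish_space}" and T N a p +
  fixes \<delta> :: real
  assumes N_pos: "1 \<le> N k"
    and N_large: "(real (T k))\<^sup>2 * (4 * (cut_radius (T k))\<^sup>2 / real (N k)) \<le> \<delta>"
begin

definition coin :: "nat \<times> nat \<Rightarrow> nat measure" where
  "coin i = uniform_count_measure (options i)"

definition choices :: "(nat \<times> nat \<Rightarrow> nat) measure" where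
  "choices = PiM UNIV coin"

lemma options_finite: "finite (options i)" and options_nonempty: "options i \<noteq> {}"
  using N_pos by (auto simp: options_def lessThan_empty_iff Suc_le_eq split: prod.splits)

lemma space_coin: "space (coin i) = options i" and sets_coin: "sets (coin i) = Pow (options i)"
  by (simp_all add: coin_def space_uniform_count_measure sets_uniform_count_measure)

lemma prob_space_coin: "prob_space (coin i)"
  unfolding coin_def by (intro prob_space_uniform_count_measure options_finite options_nonempty)

lemma prob_space_choices: "prob_space choices"
  unfolding choices_def by (intro prob_space_PiM prob_space_coin)

lemma space_choices: "space choices = Pi UNIV options"
  by (simp add: choices_def space_PiM space_coin PiE_UNIV_domain)

lemma choice_measurable: "(\<lambda>\<omega>. \<omega> i) \<in> measurable choices (count_space UNIV)"
proof -
  have "(\<lambda>\<omega>. \<omega> i) \<in> measurable choices (coin i)"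
    unfolding choices_def by (rule measurable_component_singleton) simp
  moreover have "(\<lambda>n. n) \<in> measurable (coin i) (count_space UNIV)"
    by (auto simp: measurable_def sets_coin space_coin)
  ultimately show ?thesis by (rule measurable_compose)
qed

lemma id_measurable_choices: "(\<lambda>\<omega>. \<omega>) \<in> borel_measurable choices"
  by (rule measurable_coordinatewise_then_product)
    (rule measurable_compose[OF choice_measurable], simp)

lemma prob_space_seed: "prob_space seed"
  unfolding seed_def by (rule prob_space_uniform_measure) simp_all

lemma run_hard_measurable:
  assumes A: "A \<in> rand_algorithms p" and L: "\<And>s k. L s k \<le> T k" and t: "1 \<le> t"
    and g: "g \<in> borel_measurable M"
  shows "(\<lambda>x. run A p (\<lambda>s. hard (L s) (g (snd x))) (fst x) t) \<in> borel_measurable (seed \<Otimes>\<^sub>M M)"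
  using A continuous_map_nderiv_hard[OF L] g t by (rule run_measurable)

lemma hard_gradient_measurable:
  assumes "X \<in> borel_measurable M" "g \<in> borel_measurable M"
  shows "(\<lambda>x. form_norm 1 (nderiv 1 (hard T (g x)) (X x))) \<in> borel_measurable M"
proof -
  have "continuous_on UNIV (\<lambda>z. form_norm 1 (nderiv 1 (hard T (snd z)) (fst z)))"
  proof (rule form_norm_continuous)
    show "continuous_map euclidean (form_topology 1) (\<lambda>z. nderiv 1 (hard T (snd z)) (fst z))"
      using p_pos by (intro continuous_map_nderiv_hard) auto
    show "nderiv 1 (hard T (snd z)) (fst z) \<in> forms 1" for z
      unfolding hard_def[abs_def]
      using p_pos hard_tower_local_bound[of T "fst z" "norm (fst z)"]
      by (intro tower_forms[OF tower_hard_tower, where C = "growth (norm (fst z))"]) auto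
  qed
  from measurable_compose[OF borel_measurable_Pair[OF assms] borel_measurable_continuous_onI[OF this]]
  show ?thesis by simp
qed

text \<open>The answers to the first \<open>s\<close> queries only reveal the first \<open>s\<close> links of chain \<open>k\<close>.\<close>

definition blind_run ::
    "'a algorithm \<Rightarrow> nat \<Rightarrow> (nat \<times> nat \<Rightarrow> nat) \<Rightarrow> real \<Rightarrow> nat \<Rightarrow> 'a" where
  "blind_run A k \<omega> \<xi> t = run A p (\<lambda>s. hard (T(k := min s (T k))) \<omega>) \<xi> t"

section \<open>Probability of guessing a hidden direction\<close>

definition lucky_guess where
  "lucky_guess A k t j = {x \<in> space (seed \<Otimes>\<^sub>M choices).
     quad (E k) (scale k *\<^sub>R blind_run A k (snd x) (fst x) t) [] < (cut_radius (T k))\<^sup>2 \<and>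
     1 / 2 < scale k *\<^sub>R blind_run A k (snd x) (fst x) t \<bullet> dirs (snd x) k j}"

lemma lucky_guess_sets:
  assumes "A \<in> rand_algorithms p" "1 \<le> t"
  shows "lucky_guess A k t j \<in> sets (seed \<Otimes>\<^sub>M choices)"
proof -
  have Y [measurable]: "(\<lambda>x. blind_run A k (snd x) (fst x) t) \<in> borel_measurable (seed \<Otimes>\<^sub>M choices)"
    unfolding blind_run_def using assms
    by (intro run_hard_measurable[where g = "\<lambda>\<omega>. \<omega>"] id_measurable_choices) auto
  have [measurable]: "(\<lambda>x. dirs (snd x) k j) \<in> borel_measurable (seed \<Otimes>\<^sub>M choices)"
    unfolding dirs_def
    by (rule measurable_compose[OF measurable_compose[OF measurable_snd choice_measurable]]) simp
  have "Measurable.pred (seed \<Otimes>\<^sub>M choices) (\<lambda>x.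
     quad (E k) (scale k *\<^sub>R blind_run A k (snd x) (fst x) t) [] < (cut_radius (T k))\<^sup>2 \<and>
     1 / 2 < scale k *\<^sub>R blind_run A k (snd x) (fst x) t \<bullet> dirs (snd x) k j)"
    unfolding quad_0 by measurable
  then show ?thesis
    unfolding lucky_guess_def pred_def .
qed

text \<open>The source of independence: query \<open>t\<close> uses the answers to queries
  \<open>s < t\<close>, and these involve only links below \<open>s\<close>, hence below
  \<open>j\<close>. The choice at position \<open>j\<close> is therefore never consulted.\<close>

lemma blind_run_cong:
  assumes "t \<le> Suc j"
  shows "blind_run A k (fun_upd \<omega> (k, j) i) \<xi> t = blind_run A k \<omega> \<xi> t"
  unfolding blind_run_def
proof (rule run_cong)
  fix s assume s: "1 \<le> s" "s < t"
  have "hard (T(k := min s (T k))) (fun_upd \<omega> (k, j) i) = hard (T(k := min s (T k))) \<omega>"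
    unfolding hard_def
    using s assms by (subst hard_tower_cong[where \<omega> = "fun_upd \<omega> (k, j) i" and \<omega>' = \<omega>]) (auto split: if_splits)
  then show "jet p (hard (T(k := min s (T k))) (fun_upd \<omega> (k, j) i)) y = jet p (hard (T(k := min s (T k))) \<omega>) y" for y
    by simp
qed

text \<open>Each large coordinate uses up 1/4 of the squared norm, which is less than
  \<open>r\<^sup>2\<close> inside the cutoff.\<close>

lemma few_large_coordinates:
  assumes "j < T k"
  shows "real (card {i. i < N k \<and> quad (E k) z [] < r\<^sup>2 \<and> 1 / 2 < z \<bullet> e k j i}) \<le> 4 * r\<^sup>2"
proof (cases "quad (E k) z [] < r\<^sup>2")
  case True
  let ?I = "{i. i < N k \<and> 1 / 2 < z \<bullet> e k j i}"
  have "real (card ?I) * (1 / 4) = (\<Sum>i\<in>?I. (1 / 2)\<^sup>2)" by (simp add: power2_eq_square)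
  also have "\<dots> \<le> (\<Sum>i\<in>?I. (z \<bullet> e k j i)\<^sup>2)" by (intro sum_mono power_mono) auto
  also have "\<dots> = (\<Sum>v\<in>e k j ` ?I. (z \<bullet> v)\<^sup>2)"
    by (subst sum.reindex) (auto simp: inj_on_def e_eq_iff)
  also have "\<dots> \<le> (\<Sum>v\<in>E k. (z \<bullet> v)\<^sup>2)"
    using assms by (intro sum_mono2 E_finite) (auto intro: e_in_E)
  also have "\<dots> \<le> r\<^sup>2" using True by (simp add: quad_0)
  finally show ?thesis using True by simp
qed simp

text \<open>Fubini: with the seed and all other choices fixed, the query no longer moves, and only
  the uniform choice at \<open>(k, j)\<close> remains random. At most \<open>4 * R\<^sup>2\<close>
  of its \<open>N k\<close> values are hits.\<close>

lemma lucky_guess_measure: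
  assumes A: "A \<in> rand_algorithms p" and t: "1 \<le> t" "t \<le> Suc j" and j: "j < T k"
  shows "measure (seed \<Otimes>\<^sub>M choices) (lucky_guess A k t j) \<le> 4 * (cut_radius (T k))\<^sup>2 / real (N k)"
proof -
  interpret S: prob_space seed by (rule prob_space_seed)
  interpret W: prob_space choices by (rule prob_space_choices)
  define q where "q = 4 * (cut_radius (T k))\<^sup>2 / real (N k)"
  have q: "0 \<le> q" by (simp add: q_def)
  let ?i = "(k, j)" and ?B = "lucky_guess A k t j"
  let ?M = "PiM (UNIV - {?i}) coin"
  interpret C: prob_space "coin ?i" by (rule prob_space_coin)
  interpret M: prob_space ?M by (intro prob_space_PiM prob_space_coin)
  interpret CM: pair_sigma_finite "coin ?i" ?M ..
  have B: "?B \<in> sets (seed \<Otimes>\<^sub>M choices)" using A t(1) by (rule lucky_guess_sets)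
  have upd: "(\<lambda>(x, w). w(?i := x)) \<in> measurable (coin ?i \<Otimes>\<^sub>M ?M) choices"
    using measurable_compose[OF measurable_pair_swap' measurable_add_dim[of ?i "UNIV - {?i}" coin]]
    by (simp add: choices_def insert_Diff case_prod_beta)
  \<comment> \<open>The coordinate \<open>(k, j)\<close> is split off from the product
    measure.\<close>
  have distr: "choices = distr (coin ?i \<Otimes>\<^sub>M ?M) choices (\<lambda>(x, w). w(?i := x))"
    using distr_pair_PiM_eq_PiM[of "UNIV - {?i}" coin ?i] prob_space_coin
    by (simp add: choices_def insert_Diff)
  have slice: "emeasure choices (Pair \<xi> -` ?B) \<le> ennreal q" for \<xi>
  proof -
    have X: "Pair \<xi> -` ?B \<in> sets choices" using B by (rule sets_Pair1)
    let ?X = "(\<lambda>(x, w). w(?i := x)) -` (Pair \<xi> -` ?B) \<inter> space (coin ?i \<Otimes>\<^sub>M ?M)"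
    have sX: "?X \<in> sets (coin ?i \<Otimes>\<^sub>M ?M)" using upd X by (rule measurable_sets)
    have "emeasure choices (Pair \<xi> -` ?B) = emeasure (coin ?i \<Otimes>\<^sub>M ?M) ?X"
      by (subst distr) (rule emeasure_distr[OF upd X])
    also have "\<dots> = (\<integral>\<^sup>+w. emeasure (coin ?i) ((\<lambda>x. (x, w)) -` ?X) \<partial>?M)"
      by (rule CM.emeasure_pair_measure_alt2[OF sX])
    also have "\<dots> \<le> (\<integral>\<^sup>+w. ennreal q \<partial>?M)"
    proof (rule nn_integral_mono)
      fix w
      define z where "z = scale k *\<^sub>R blind_run A k w \<xi> t"
      let ?I = "{i. i < N k \<and> quad (E k) z [] < (cut_radius (T k))\<^sup>2 \<and> 1 / 2 < z \<bullet> e k j i}"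
      have opt: "options ?i = {..<N k}" using j by (simp add: options_def)
      \<comment> \<open>By \<open>blind_run_cong\<close> the query can be computed from
        \<open>w\<close> alone, whatever value is written at \<open>(k, j)\<close>.\<close>
      have "(\<lambda>x. (x, w)) -` ?X \<subseteq> ?I"
        using opt by (auto simp: lucky_guess_def blind_run_cong[OF t(2)] z_def dirs_def
            space_pair_measure space_coin)
      then have "emeasure (coin ?i) ((\<lambda>x. (x, w)) -` ?X) \<le> emeasure (coin ?i) ?I"
        by (intro emeasure_mono) (auto simp: sets_coin opt)
      also have "\<dots> = ennreal (real (card ?I) / real (N k))"
        unfolding coin_def opt by (subst emeasure_uniform_count_measure) auto
      also have "\<dots> \<le> ennreal q"
        unfolding q_def using few_large_coordinates[OF j]
        by (intro ennreal_leI divide_right_mono) auto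
      finally show "emeasure (coin ?i) ((\<lambda>x. (x, w)) -` ?X) \<le> ennreal q" .
    qed
    also have "\<dots> = ennreal q" by (simp add: M.emeasure_space_1)
    finally show ?thesis .
  qed
  have "emeasure (seed \<Otimes>\<^sub>M choices) ?B = (\<integral>\<^sup>+\<xi>. emeasure choices (Pair \<xi> -` ?B) \<partial>seed)"
    by (rule W.emeasure_pair_measure_alt[OF B])
  also have "\<dots> \<le> (\<integral>\<^sup>+\<xi>. ennreal q \<partial>seed)" by (intro nn_integral_mono slice)
  also have "\<dots> = ennreal q" by (simp add: S.emeasure_space_1)
  finally show ?thesis
    using q by (simp add: measure_def q_def enn2real_leI)
qed

text \<open>Query \<open>t\<close> may have learned the directions with index below
  \<open>t - 1\<close> from the preceding answers, so only indices from \<open>t - 1\<close> on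
  count as guesses.\<close>

definition unlucky where
  "unlucky A k = space (seed \<Otimes>\<^sub>M choices) -
     (\<Union>(t, j)\<in>Sigma {1..T k} (\<lambda>t. {t - 1..<T k}). lucky_guess A k t j)"

lemma unlucky_sets:
  "A \<in> rand_algorithms p \<Longrightarrow> unlucky A k \<in> sets (seed \<Otimes>\<^sub>M choices)"
  unfolding unlucky_def
  by (intro sets.Diff sets.finite_UN) (auto intro!: lucky_guess_sets)

lemma unlucky_measure:
  assumes A: "A \<in> rand_algorithms p"
  shows "1 - \<delta> \<le> measure (seed \<Otimes>\<^sub>M choices) (unlucky A k)"
proof -
  interpret S: prob_space seed by (rule prob_space_seed)
  interpret W: prob_space choices by (rule prob_space_choices)
  interpret P: pair_prob_space seed choices ..
  let ?I = "Sigma {1..T k} (\<lambda>t. {t - 1..<T k})" and ?q = "4 * (cut_radius (T k))\<^sup>2 / real (N k)"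
  let ?U = "\<Union>i\<in>?I. lucky_guess A k (fst i) (snd i)"
  have sets: "lucky_guess A k (fst i) (snd i) \<in> sets (seed \<Otimes>\<^sub>M choices)" if "i \<in> ?I" for i
    using that by (intro lucky_guess_sets A) auto
  have "measure (seed \<Otimes>\<^sub>M choices) ?U \<le> (\<Sum>i\<in>?I. measure (seed \<Otimes>\<^sub>M choices) (lucky_guess A k (fst i) (snd i)))"
    using sets by (intro measure_UNION_le) auto
  also have "\<dots> \<le> (\<Sum>i\<in>?I. ?q)"
    by (intro sum_mono lucky_guess_measure A) auto
  also have "\<dots> = real (card ?I) * ?q" by simp
  also have "\<dots> \<le> (real (T k))\<^sup>2 * ?q"
  proof (rule mult_right_mono)
    have "card ?I \<le> card ({1..T k} \<times> {..<T k})" by (intro card_mono) auto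
    also have "\<dots> = (T k)\<^sup>2" by (simp add: power2_eq_square)
    finally show "real (card ?I) \<le> (real (T k))\<^sup>2" by (metis of_nat_le_iff of_nat_power)
  qed simp
  also have "\<dots> \<le> \<delta>" by (rule N_large)
  finally have "measure (seed \<Otimes>\<^sub>M choices) ?U \<le> \<delta>" .
  moreover have "unlucky A k = space (seed \<Otimes>\<^sub>M choices) - ?U"
    by (simp add: unlucky_def case_prod_beta)
  moreover have "?U \<in> sets (seed \<Otimes>\<^sub>M choices)" using sets by (intro sets.finite_UN) auto
  ultimately show ?thesis by (simp add: P.prob_compl)
qed

text \<open>If the blind run guesses nothing, each of its truncated answers equals the true answer,
  so it coincides with the actual run. Its query \<open>T k\<close> still misses the last direction
  or lies outside the cutoff, and either way the gradient is large.\<close>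

lemma unlucky_gradient:
  assumes "(\<xi>, \<omega>) \<in> unlucky A k"
  shows "a k / real (T k) * (scale k / 2) \<le>
    form_norm 1 (nderiv 1 (hard T \<omega>) (iterate A p (hard T \<omega>) \<xi> (T k)))"
proof -
  define y where "y t = scale k *\<^sub>R blind_run A k \<omega> \<xi> t" for t
  have \<omega>: "\<omega> i \<in> options i" for i
    using assms by (auto simp: unlucky_def space_pair_measure space_choices)
  have hidden: "(cut_radius (T k))\<^sup>2 \<le> quad (E k) (y t) [] \<or> y t \<bullet> dirs \<omega> k j \<le> 1 / 2"
    if "1 \<le> t" "t \<le> Suc j" "j < T k" for t j
  proof -
    have "(t, j) \<in> Sigma {1..T k} (\<lambda>t. {t - 1..<T k})" using that by auto
    then have "(\<xi>, \<omega>) \<notin> lucky_guess A k t j" using assms unfolding unlucky_def by blast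
    then show ?thesis using assms unfolding lucky_guess_def unlucky_def y_def by auto
  qed
  have "blind_run A k \<omega> \<xi> t = run A p (\<lambda>_. hard T \<omega>) \<xi> t" if "t \<le> T k" for t
    unfolding blind_run_def
  proof (rule run_cong)
    fix s assume s: "1 \<le> s" "s < t"
    then have sT: "min s (T k) = s" using that by simp
    have le: "(T(k := s)) k' \<le> T k'" for k' using s that by simp
    \<comment> \<open>At query \<open>s\<close> the links from \<open>s\<close> on are hidden, as
      the coordinates with index at least \<open>s - 1\<close> are at most 1/2 or the cutoff
      vanishes.\<close>
    have tower: "hard_tower T \<omega> (blind_run A k \<omega> \<xi> s) = hard_tower (T(k := s)) \<omega> (blind_run A k \<omega> \<xi> s)"
      using hidden[of s] s that unfolding y_def by (intro hard_tower_hidden) auto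
    have "nderiv r (hard (T(k := s)) \<omega>) (blind_run A k \<omega> \<xi> s) = nderiv r (hard T \<omega>) (blind_run A k \<omega> \<xi> s)"
      if "r \<le> p" for r
      unfolding nderiv_hard[of T, OF order_refl that] nderiv_hard[of "T(k := s)", OF le that] tower ..
    then show "jet p (hard (T(k := min s (T k))) \<omega>) (run A p (\<lambda>s. hard (T(k := min s (T k))) \<omega>) \<xi> s) =
        jet p (hard T \<omega>) (run A p (\<lambda>s. hard (T(k := min s (T k))) \<omega>) \<xi> s)"
      unfolding sT blind_run_def[symmetric] jet_def by (intro restrict_ext) auto
  qed
  then have eq: "iterate A p (hard T \<omega>) \<xi> (T k) = blind_run A k \<omega> \<xi> (T k)"
    by (simp add: iterate_eq_run)
  show ?thesis
    unfolding eq
  proof (rule hard_gradient)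
    show "\<omega> (k, j) < N k" if "j < T k" for j
      using \<omega>[of "(k, j)"] that by (simp add: options_def)
    show "(cut_radius (T k))\<^sup>2 \<le> quad (E k) (scale k *\<^sub>R blind_run A k \<omega> \<xi> (T k)) [] \<or>
        scale k *\<^sub>R blind_run A k \<omega> \<xi> (T k) \<bullet> dirs \<omega> k (T k - 1) \<le> 1 / 2"
      using hidden[of "T k" "T k - 1"] T_pos[of k] by (simp add: y_def)
  qed
qed

end

section \<open>Infinitely many events and the measure on functions\<close>

lemma limsup_ge_1:
  fixes f :: "nat \<Rightarrow> ereal"
  assumes "\<And>n. \<exists>m\<ge>n. 1 \<le> f m"
  shows "1 \<le> limsup f"
  unfolding limsup_INF_SUP
proof (rule INF_greatest)
  fix n
  obtain m where "n \<le> m" "1 \<le> f m" using assms by blast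
  then show "1 \<le> (SUP m\<in>{n..}. f m)" by (intro SUP_upper2[of m]) auto
qed

text \<open>Continuity from above: the tail unions decrease to the limsup set, and each contains an
  event of probability at least \<open>q\<close>.\<close>

lemma (in prob_space) prob_infinitely_often:
  fixes A :: "nat \<Rightarrow> 'a set"
  assumes "\<And>k. A k \<in> events" "\<And>k. q \<le> prob (A k)"
  shows "q \<le> prob (\<Inter>n. \<Union>k\<in>{n..}. A k)"
proof -
  have "(\<lambda>n. prob (\<Union>k\<in>{n..}. A k)) \<longlonglongrightarrow> prob (\<Inter>n. \<Union>k\<in>{n..}. A k)"
  proof (rule finite_Lim_measure_decseq)
    show "decseq (\<lambda>n. \<Union>k\<in>{n..}. A k)"
      unfolding decseq_def by (intro allI impI UN_mono) auto
  qed (use assms(1) in auto)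
  moreover have "q \<le> prob (\<Union>k\<in>{n..}. A k)" for n
    using assms(1) by (intro order_trans[OF assms(2)[of n]] finite_measure_mono) auto
  ultimately show ?thesis by (intro LIMSEQ_le_const) auto
qed

context hard_distribution
begin

text \<open>
  Since \<open>hard T\<close> is injective on the choices, the functions can carry the \<open>\<sigma>\<close>-algebra of the choices.
  This makes the choices a measurable function of \<open>F\<close>.
\<close>

definition decode :: "('a \<Rightarrow> real) \<Rightarrow> nat \<times> nat \<Rightarrow> nat" where
  "decode = inv_into (space choices) (hard T)"

definition hard_algebra :: "('a \<Rightarrow> real) measure" where
  "hard_algebra = vimage_algebra (hard T ` space choices) decode choices"

definition hard_measure :: "('a \<Rightarrow> real) measure" where
  "hard_measure = distr choices hard_algebra (hard T)"

lemma decode_hard: "\<omega> \<in> space choices \<Longrightarrow> decode (hard T \<omega>) = \<omega>"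
  using hard_inj by (simp add: decode_def space_choices)

lemma hard_measurable: "hard T \<in> measurable choices hard_algebra"
  unfolding hard_algebra_def
proof (rule measurable_vimage_algebra2)
  show "(\<lambda>\<omega>. decode (hard T \<omega>)) \<in> measurable choices choices"
    using measurable_ident by (subst measurable_cong[OF decode_hard]) (auto simp: id_def)
qed auto

lemma decode_measurable: "decode \<in> measurable hard_measure choices"
proof -
  have "decode \<in> measurable hard_algebra choices"
    unfolding hard_algebra_def
    by (rule measurable_vimage_algebra1) (auto simp: decode_hard)
  then show ?thesis by (simp add: hard_measure_def)
qed

lemma space_hard_measure: "space hard_measure = hard T ` space choices"
  by (simp add: hard_measure_def hard_algebra_def)

lemma hard_decode: "F \<in> space hard_measure \<Longrightarrow> hard T (decode F) = F"
  by (auto simp: space_hard_measure decode_hard)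

lemma prob_space_hard_measure: "prob_space hard_measure"
  unfolding hard_measure_def
  using prob_space_choices hard_measurable by (rule prob_space.prob_space_distr)

text \<open>The sigma-algebra carried over from the choices contains the one generated by the point
  evaluations, because the value at \<open>x\<close> depends continuously on the choices.\<close>

lemma evaluation_measurable: "(\<lambda>F. F x) \<in> borel_measurable hard_measure"
proof -
  have "continuous_on UNIV (\<lambda>\<omega>. hard T \<omega> x)"
    unfolding continuous_on_def
  proof
    fix \<omega>
    show "((\<lambda>\<omega>. hard T \<omega> x) \<longlongrightarrow> hard T \<omega> x) (at \<omega>)"
    proof (rule tendstoI)
      fix \<epsilon> :: real assume "0 < \<epsilon>"
      then have "0 < \<epsilon> / 2" by simp
      from hard_tower_continuous[of T, OF order_refl this, of \<omega> "norm x"]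
      obtain U where U: "open U" "\<omega> \<in> U"
        "\<forall>\<omega>'\<in>U. \<forall>y vs. norm y \<le> norm x \<longrightarrow> length vs \<le> p \<longrightarrow>
          \<bar>hard_tower T \<omega>' y vs - hard_tower T \<omega> y vs\<bar> \<le> \<epsilon> / 2 * (\<Prod>v\<leftarrow>vs. norm v)"
        by blast
      have "dist (hard T \<omega>' x) (hard T \<omega> x) < \<epsilon>" if "\<omega>' \<in> U" for \<omega>'
        using U(3)[rule_format, OF that, of x "[]"] \<open>0 < \<epsilon>\<close> by (simp add: dist_real_def hard_def)
      then show "\<forall>\<^sub>F \<omega>' in at \<omega>. dist (hard T \<omega>' x) (hard T \<omega> x) < \<epsilon>"
        unfolding eventually_at_topological using U(1,2) by blast
    qed
  qed
  then have "(\<lambda>\<omega>. hard T \<omega> x) \<in> borel_measurable borel" by (rule borel_measurable_continuous_onI)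
  from measurable_compose[OF measurable_compose[OF decode_measurable id_measurable_choices] this]
  have "(\<lambda>F. hard T (decode F) x) \<in> borel_measurable hard_measure" .
  then show ?thesis by (subst measurable_cong[OF arg_cong[OF hard_decode[symmetric], of _ "\<lambda>F. F x"]])
qed

text \<open>The event is pulled back to seeds and choices, where it contains the event that
  infinitely many blocks remain unguessed.\<close>

lemma hard_measure_limsup:
  fixes \<rho> :: "real \<Rightarrow> real"
  assumes A: "A \<in> rand_algorithms p"
    and \<rho>: "\<And>k. 0 < \<rho> (real (T k - 1))"
      "\<And>k. \<rho> (real (T k - 1)) \<le> real (T k - 1) powr (real p / (real p + 1)) * (a k / real (T k) * (scale k / 2))"
    and T: "\<And>k. k < T k"
  shows "1 - \<delta> \<le> measure (seed \<Otimes>\<^sub>M hard_measure)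
        {(\<xi>, F) \<in> space (seed \<Otimes>\<^sub>M hard_measure).
          1 \<le> limsup (\<lambda>n. ereal (real n powr (real p / (real p + 1))
                 * form_norm 1 (nderiv 1 F (algorithm_output A p F \<xi> n)) / \<rho> (real n)))}"
    (is "_ \<le> measure _ ?E")
proof -
  interpret S: prob_space seed by (rule prob_space_seed)
  interpret W: prob_space choices by (rule prob_space_choices)
  interpret H: prob_space hard_measure by (rule prob_space_hard_measure)
  interpret P: pair_prob_space seed choices ..
  define f where "f F \<xi> n = ereal (real n powr (real p / (real p + 1))
     * form_norm 1 (nderiv 1 F (algorithm_output A p F \<xi> n)) / \<rho> (real n))" for F \<xi> n
  \<comment> \<open>Within this proof \<Phi> is the map from choices to functions and hides the ramp
    of the same name.\<close>
  define \<Phi> where "\<Phi> = (\<lambda>(\<xi>::real, \<omega>). (\<xi>, hard T \<omega>))"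
  have \<Phi>: "\<Phi> \<in> measurable (seed \<Otimes>\<^sub>M choices) (seed \<Otimes>\<^sub>M hard_measure)"
    using hard_measurable by (auto simp: \<Phi>_def hard_measure_def)
  have P: "seed \<Otimes>\<^sub>M hard_measure = distr (seed \<Otimes>\<^sub>M choices) (seed \<Otimes>\<^sub>M hard_measure) \<Phi>"
  proof -
    have "seed \<Otimes>\<^sub>M hard_measure = distr seed seed (\<lambda>\<xi>. \<xi>) \<Otimes>\<^sub>M distr choices hard_algebra (hard T)"
      by (simp add: hard_measure_def)
    also have "\<dots> = distr (seed \<Otimes>\<^sub>M choices) (seed \<Otimes>\<^sub>M hard_algebra) \<Phi>"
      unfolding \<Phi>_def using hard_measurable H.sigma_finite_measure_axioms
      by (intro pair_measure_distr) (auto simp: hard_measure_def)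
    also have "\<dots> = distr (seed \<Otimes>\<^sub>M choices) (seed \<Otimes>\<^sub>M hard_measure) \<Phi>"
      by (intro distr_cong refl sets_pair_measure_cong) (auto simp: hard_measure_def)
    finally show ?thesis .
  qed
  have dec: "(\<lambda>F. decode F) \<in> borel_measurable hard_measure"
    using measurable_compose[OF decode_measurable id_measurable_choices] .
  have dec2: "(\<lambda>x. decode (snd x)) \<in> borel_measurable (seed \<Otimes>\<^sub>M hard_measure)"
    using dec by (rule measurable_compose[OF measurable_snd])
  have fm: "(\<lambda>x. f (hard T (decode (snd x))) (fst x) n) \<in> borel_measurable (seed \<Otimes>\<^sub>M hard_measure)" for n
  proof -
    have "(\<lambda>x. algorithm_output A p (hard T (decode (snd x))) (fst x) n) \<in> borel_measurable (seed \<Otimes>\<^sub>M hard_measure)"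
      unfolding algorithm_output_def iterate_eq_run
      using run_hard_measurable[OF A, of "\<lambda>_. T" "n + 1" decode hard_measure] dec by simp
    from hard_gradient_measurable[OF this dec2]
    show ?thesis unfolding f_def by measurable
  qed
  \<comment> \<open>Rewriting \<open>F\<close> as the image of its decoded choices expresses the
    event through random variables already known to be measurable.\<close>
  have E: "?E = {x \<in> space (seed \<Otimes>\<^sub>M hard_measure). 1 \<le> limsup (f (hard T (decode (snd x))) (fst x))}"
    unfolding f_def[abs_def]
    by (rule Collect_cong) (auto simp: space_pair_measure hard_decode simp del: nderiv.simps One_nat_def)
  have "(\<lambda>x. limsup (f (hard T (decode (snd x))) (fst x))) \<in> borel_measurable (seed \<Otimes>\<^sub>M hard_measure)"
    using fm by (rule borel_measurable_limsup)
  then have E_sets: "?E \<in> sets (seed \<Otimes>\<^sub>M hard_measure)"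
    unfolding E by (intro borel_measurable_le) simp_all
  have "(\<Inter>n. \<Union>k\<in>{n..}. unlucky A k) \<subseteq> \<Phi> -` ?E \<inter> space (seed \<Otimes>\<^sub>M choices)"
  proof
    fix x assume x: "x \<in> (\<Inter>n. \<Union>k\<in>{n..}. unlucky A k)"
    obtain \<xi> \<omega> where x': "x = (\<xi>, \<omega>)" by (cases x)
    have sp: "x \<in> space (seed \<Otimes>\<^sub>M choices)"
      using x by (auto simp: unlucky_def)
    have "1 \<le> limsup (f (hard T \<omega>) \<xi>)"
    proof (rule limsup_ge_1)
      fix n
      obtain k where k: "n \<le> k" "(\<xi>, \<omega>) \<in> unlucky A k" using x x' by auto
      let ?g = "form_norm 1 (nderiv 1 (hard T \<omega>) (iterate A p (hard T \<omega>) \<xi> (T k)))"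
      have "real (T k - 1) powr (real p / (real p + 1)) * (a k / real (T k) * (scale k / 2)) \<le>
          real (T k - 1) powr (real p / (real p + 1)) * ?g"
        using unlucky_gradient[OF k(2)] by (intro mult_left_mono) auto
      then have "\<rho> (real (T k - 1)) \<le> real (T k - 1) powr (real p / (real p + 1)) * ?g"
        using \<rho>(2)[of k] by linarith
      then have "1 \<le> real (T k - 1) powr (real p / (real p + 1)) * ?g / \<rho> (real (T k - 1))"
        using \<rho>(1)[of k] by simp
      \<comment> \<open>The output after \<open>T k - 1\<close> oracle calls is the iterate with
        index \<open>T k\<close>.\<close>
      then have "1 \<le> f (hard T \<omega>) \<xi> (T k - 1)"
        using T_pos[of k] by (simp add: f_def algorithm_output_def one_ereal_def del: One_nat_def)
      moreover have "n \<le> T k - 1" using k(1) T[of k] by linarith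
      ultimately show "\<exists>m\<ge>n. 1 \<le> f (hard T \<omega>) \<xi> m" by blast
    qed
    then show "x \<in> \<Phi> -` ?E \<inter> space (seed \<Otimes>\<^sub>M choices)"
      using sp unfolding E
      by (auto simp: x' \<Phi>_def decode_hard space_pair_measure space_hard_measure)
  qed
  then have "P.prob (\<Inter>n. \<Union>k\<in>{n..}. unlucky A k) \<le> P.prob (\<Phi> -` ?E \<inter> space (seed \<Otimes>\<^sub>M choices))"
    using measurable_sets[OF \<Phi> E_sets] by (intro P.finite_measure_mono) auto
  moreover have "1 - \<delta> \<le> P.prob (\<Inter>n. \<Union>k\<in>{n..}. unlucky A k)"
    using unlucky_sets[OF A] unlucky_measure[OF A] by (rule P.prob_infinitely_often)
  moreover have "measure (seed \<Otimes>\<^sub>M hard_measure) ?E = P.prob (\<Phi> -` ?E \<inter> space (seed \<Otimes>\<^sub>M choices))"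
    by (subst P) (rule measure_distr[OF \<Phi> E_sets])
  ultimately show ?thesis by linarith
qed

end

text \<open>Gram-Schmidt: finitely many vectors never span the space, so a vector outside their span
  leaves a nonzero residual to normalise.\<close>

lemma orthonormal_sequence_exists:
  assumes "\<nexists>B :: 'a::real_inner set. finite B \<and> span B = UNIV"
  shows "\<exists>u :: nat \<Rightarrow> 'a. orthonormal_seq u"
proof -
  have "\<exists>u :: nat \<Rightarrow> 'a. \<forall>n. norm (u n) = 1 \<and> (\<forall>m<n. u n \<bullet> u m = 0)"
  proof (rule dependent_wellorder_choice)
    fix n and f :: "nat \<Rightarrow> 'a"
    assume f: "\<And>m. m < n \<Longrightarrow> norm (f m) = 1 \<and> (\<forall>l<m. f m \<bullet> f l = 0)"
    have ff: "f l \<bullet> f m = of_bool (l = m)" if "l < n" "m < n" for l m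
      using f[of l] f[of m] that
      by (cases l m rule: linorder_cases) (auto simp: inner_commute norm_eq_1)
    have "span (f ` {..<n}) \<noteq> UNIV" using assms by blast
    then obtain x where x: "x \<notin> span (f ` {..<n})" by blast
    define y where "y = x - (\<Sum>l<n. (x \<bullet> f l) *\<^sub>R f l)"
    have "y \<noteq> 0"
    proof
      assume "y = 0"
      then have "x = (\<Sum>l<n. (x \<bullet> f l) *\<^sub>R f l)" by (simp add: y_def)
      also have "\<dots> \<in> span (f ` {..<n})" by (intro span_sum span_scale span_base) auto
      finally show False using x by simp
    qed
    moreover have "y \<bullet> f m = 0" if "m < n" for m
    proof -
      have "(\<Sum>l<n. (x \<bullet> f l) *\<^sub>R f l) \<bullet> f m = (\<Sum>l<n. if l = m then x \<bullet> f l else 0)"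
        using that ff by (auto simp: inner_sum_left intro!: sum.cong)
      then show ?thesis using that by (simp add: y_def inner_diff_left)
    qed
    ultimately show "\<exists>r. norm r = 1 \<and> (\<forall>m<n. r \<bullet> f m = 0)"
      by (intro exI[of _ "(1 / norm y) *\<^sub>R y"]) auto
  qed auto
  then obtain u :: "nat \<Rightarrow> 'a" where u: "\<And>n. norm (u n) = 1" "\<And>n m. m < n \<Longrightarrow> u n \<bullet> u m = 0"
    by blast
  have "u i \<bullet> u j = of_bool (i = j)" for i j
    using u(1)[of i] u(2)[of i j] u(2)[of j i] by (cases i j rule: linorder_cases) (auto simp: inner_commute norm_eq_1)
  then show ?thesis unfolding orthonormal_seq_def by blast
qed

section \<open>Choice of the parameters and conclusion\<close>

theorem corollary3:
  fixes \<rho> :: "real \<Rightarrow> real" and \<delta> :: real and p :: nat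
  assumes "\<nexists>B :: 'a::{real_inner, polish_space} set. finite B \<and> span B = UNIV"
    and "bij_betw \<rho> {1..} {0<..1}" and "antimono_on {1..} \<rho>"
    and "0 < \<delta>" and "\<delta> \<le> 1 / 2" and "1 \<le> p"
  shows "\<exists>D :: ('a \<Rightarrow> real) measure.
    prob_space D \<and> space D \<subseteq> ncvx_class p \<and> (\<forall>x. (\<lambda>F. F x) \<in> borel_measurable D) \<and>
    (\<forall>A \<in> rand_algorithms p.
      measure (seed \<Otimes>\<^sub>M D)
        {(\<xi>, F) \<in> space (seed \<Otimes>\<^sub>M D).
          1 \<le> limsup (\<lambda>n. ereal (real n powr (real p / (real p + 1))
                 * form_norm 1 (nderiv 1 F (algorithm_output A p F \<xi> n)) / \<rho> (real n)))}
      \<ge> 1 - 2 * \<delta>)"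
proof -
  obtain \<Psi> \<Phi> c where "chain_functions \<Psi> \<Phi> c" using chain_functions_exist by blast
  then interpret CF: chain_functions \<Psi> \<Phi> c .
  obtain u :: "nat \<Rightarrow> 'a" where u: "orthonormal_seq u"
    using orthonormal_sequence_exists[OF assms(1)] by blast
  \<comment> \<open>Two pairings distribute one orthonormal sequence injectively over block,
    position and candidate.\<close>
  define e where "e k j i = u (prod_encode (k, prod_encode (j, i)))" for k j i
  \<comment> \<open>\<open>M\<close> dominates \<open>K r + 1\<close> for all orders up to
    \<open>p + 1\<close>, so dividing by it makes the amplitudes \<open>a k\<close> small enough at
    all these orders at once.\<close>
  define M where "M = 1 + (\<Sum>r\<le>Suc p. CF.K r)"
  have M: "0 < M" unfolding M_def using CF.K_nonneg by (intro add_pos_nonneg sum_nonneg) auto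
  define a where "a k = (1 / 2) ^ Suc k / M" for k
  have a: "0 < a k" for k using M by (simp add: a_def)
  have a_small: "a k * (CF.K r + 1) \<le> (1 / 2) ^ Suc k" if "r \<le> Suc p" for k r
  proof -
    have "CF.K r \<le> (\<Sum>r\<le>Suc p. CF.K r)" using that CF.K_nonneg by (intro member_le_sum) auto
    then have "CF.K r + 1 \<le> M" by (simp add: M_def)
    then have "(1 / 2) ^ Suc k / M * (CF.K r + 1) \<le> (1 / 2) ^ Suc k / M * M"
      using M by (intro mult_left_mono) auto
    then show ?thesis using M by (simp add: a_def)
  qed
  \<comment> \<open>Surjectivity and monotonicity make \<rho> eventually smaller than any positive
    number. One factor 1/2 in the target is the gradient bound of a block; the other pays for
    comparing \<open>n\<close> with \<open>T = n + 1\<close>.\<close>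
  have "\<exists>n. Suc k \<le> n \<and> \<rho> (real n) \<le> a k / 4" for k
  proof -
    have "min 1 (a k / 4) \<in> {0<..1}" using a[of k] by auto
    then obtain s where s: "1 \<le> s" "\<rho> s = min 1 (a k / 4)"
      using assms(2) unfolding bij_betw_def by (metis atLeast_iff imageE)
    obtain n where n: "max s (real (Suc k)) \<le> real n" using real_arch_simple by blast
    then have "\<rho> (real n) \<le> \<rho> s"
      using s(1) assms(3) by (auto simp: monotone_on_def)
    then show ?thesis using n s(2) by (intro exI[of _ n]) auto
  qed
  then obtain n where n: "\<And>k. Suc k \<le> n k" "\<And>k. \<rho> (real (n k)) \<le> a k / 4" by metis
  define T where "T k = Suc (n k)" for k
  have "\<exists>N\<ge>1. (real (T k))\<^sup>2 * (4 * (CF.cut_radius (T k))\<^sup>2 / real N) \<le> \<delta>" for k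
  proof -
    let ?x = "(real (T k))\<^sup>2 * (4 * (CF.cut_radius (T k))\<^sup>2)"
    obtain N where N: "?x / \<delta> \<le> real N" using real_arch_simple by blast
    have "?x / \<delta> \<le> real (Suc N)" using N by simp
    then have "?x / real (Suc N) \<le> \<delta>" using assms(4) by (simp add: field_simps)
    then show ?thesis by (intro exI[of _ "Suc N"]) simp
  qed
  then obtain N where N: "\<And>k. 1 \<le> N k"
    "\<And>k. (real (T k))\<^sup>2 * (4 * (CF.cut_radius (T k))\<^sup>2 / real (N k)) \<le> \<delta>" by metis
  interpret hard_distribution \<Psi> \<Phi> c e T N a p \<delta>
  proof
    show "e k j i \<bullet> e k' j' i' = of_bool (k = k' \<and> j = j' \<and> i = i')" for k j i k' j' i'
      using orthonormal_seqD[OF u] by (simp add: e_def)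
  qed (use N a a_small assms(6) in \<open>auto simp: T_def\<close>)
  have pos: "0 < \<rho> (real (T k - 1))" for k
  proof -
    have "real (T k - 1) \<in> {1..}" using n(1)[of k] by (auto simp: T_def)
    then have "\<rho> (real (T k - 1)) \<in> {0<..1}" using assms(2) bij_betwE by blast
    then show ?thesis by simp
  qed
  have large: "\<rho> (real (T k - 1)) \<le>
      real (T k - 1) powr (real p / (real p + 1)) * (a k / real (T k) * (scale k / 2))" for k
  proof -
    define q where "q = real p / (real p + 1)"
    have q: "0 \<le> q" "q \<le> 1" by (auto simp: q_def)
    have n0: "1 \<le> real (n k)" using n(1)[of k] by simp
    have T0: "real (T k) = real (n k) + 1" by (simp add: T_def)
    have "1 / (real p + 1) - 1 = - q" by (simp add: q_def field_simps)
    then have st: "scale k / real (T k) = real (T k) powr (- q)"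
      using powr_diff[of "real (T k)" "1 / (real p + 1)" 1] T0 by (simp add: scale_def)
    have "a k / real (T k) * (scale k / 2) = a k / 2 * (scale k / real (T k))" by simp
    then have eq: "real (n k) powr q * (a k / real (T k) * (scale k / 2)) =
        a k / 2 * (real (n k) powr q * real (T k) powr (- q))"
      unfolding st by (simp only: mult_ac)
    \<comment> \<open>The comparison of powers is
      \<open>(n / (n + 1)) powr q \<ge> n / (n + 1) \<ge> 1 / 2\<close>, using
      \<open>q \<le> 1\<close> and \<open>n \<ge> 1\<close>.\<close>
    have "real (n k) powr q * real (T k) powr (- q) = (real (n k) / real (T k)) powr q"
      using n0 T0 by (simp add: powr_divide powr_minus_divide)
    also have "\<dots> \<ge> (real (n k) / real (T k)) powr 1"
      using n0 T0 q by (intro powr_mono') auto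
    finally have "real (n k) / real (T k) \<le> real (n k) powr q * real (T k) powr (- q)"
      using n0 T0 by simp
    moreover have "1 / 2 \<le> real (n k) / real (T k)" using n0 T0 by (simp add: field_simps)
    ultimately have "1 / 2 \<le> real (n k) powr q * real (T k) powr (- q)" by linarith
    then have "a k / 2 * (1 / 2) \<le> a k / 2 * (real (n k) powr q * real (T k) powr (- q))"
      using a[of k] by (intro mult_left_mono) auto
    then show ?thesis using n(2)[of k] eq by (simp add: T_def q_def)
  qed
  have "1 - 2 * \<delta> \<le> measure (seed \<Otimes>\<^sub>M hard_measure)
        {(\<xi>, F) \<in> space (seed \<Otimes>\<^sub>M hard_measure).
          1 \<le> limsup (\<lambda>n. ereal (real n powr (real p / (real p + 1))
                 * form_norm 1 (nderiv 1 F (algorithm_output A p F \<xi> n)) / \<rho> (real n)))}"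
    if A: "A \<in> rand_algorithms p" for A
  proof -
    have "k < T k" for k using n(1)[of k] by (simp add: T_def)
    \<comment> \<open>The construction achieves \<open>1 - \<delta>\<close>, which is at least the
      required \<open>1 - 2 * \<delta>\<close>.\<close>
    from hard_measure_limsup[OF A pos large this] show ?thesis using assms(4) by linarith
  qed
  moreover have "space hard_measure \<subseteq> ncvx_class p"
    using hard_in_class[of T] by (auto simp: space_hard_measure)
  ultimately show ?thesis
    using prob_space_hard_measure evaluation_measurable by (intro exI[of _ hard_measure]) auto
qed

end
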